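(* Let $p\ge3$ and let $A_i=T(a_i)+E_i\in\mathcal{QT}$, for $i=1,\ldots,p$, be positive definite. Put $(s_1,s_2,\ldots,s_{p-1})=\bigl(\frac{p-1}{p},\frac{p-2}{p-1},\ldots,\frac12\bigr)$. Then the operators $A_i^{(k)}$ generated by the NBMP iteration $$A_i^{(0)}=A_i,\qquad A_i^{(k+1)}=A_i^{(k)}\#_{s_1}G_{s_2,\ldots,s_{p-1}}(A_1^{(k)},\ldots,A_{i-1}^{(k)},A_{i+1}^{(k)},\ldots,A_p^{(k)}),\quad i=1,\ldots,p,$$ and the NBMP mean $G=G(A_1,\ldots,A_p)$ of $A_1,\ldots,A_p$ satisfy the following properties: 1. $A_i^{(k)}=T(g)+K_i^{(k)}\in\mathcal{QT}$ with $K_i^{(k)}$ compact, for $i=1,\ldots,p$ and any $k\ge1$, where $g=(a_1\cdots a_p)^{1/p}$; 2. $G=T(g)+K_G\in\mathcal{QT}$ with $K_G$ compact; 3. $\lim_k\|K_i^{(k)}-K_G\|_2=0$, for $i=1,\ldots,p$.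
   Context: $\ell^2$ is the complex Hilbert space of square-summable sequences indexed by the positive integers and $\|\cdot\|_2$ is the operator norm on $\mathcal B(\ell^2)$. $C_{2\pi}$ is the set of continuous $a:[0,2\pi]\to\mathbb C$ with $a(0)=a(2\pi)$. For $a\in C_{2\pi}$ with Fourier series $\sum_{k}a_ke^{\mathrm{i}kt}$, $T(a)$ is the bounded operator on $\ell^2$ with matrix $(T(a))_{i,j}=a_{j-i}$, $i,j\ge1$. $\mathcal{QT}=\{T(a)+K: a\in C_{2\pi},\ K \text{ compact on }\ell^2\}$ is the $C^*$-subalgebra of $\mathcal B(\ell^2)$ of quasi-Toeplitz matrices; the decomposition $A=T(a)+K$ of $A\in\mathcal{QT}$ is unique and $a$ is called the symbol of $A$. A bounded operator $A$ is positive definite if it is self-adjoint and there is $\gamma>0$ with $v^*Av\ge\gamma\|v\|_2^2$ for all $v\in\ell^2$; its symbol, if $A\in\mathcal{QT}$, is then strictly positive. For positive definite operators $A,B$ and $t\in[0,1]$, $A\#_tB=A^{1/2}(A^{-1/2}BA^{-1/2})^tA^{1/2}$. For two operators, $G_t(A,B)=A\#_tB$. For $p\ge3$ the mean $G_{s_1,\ldots,s_{p-1}}(A_1,\ldots,A_p)$ is defined recursively on $p$ as the common limit of the $p$ sequences $\{A_i^{(k)}\}_k$ generated by $A_i^{(0)}=A_i$, $A_i^{(k+1)}=A_i^{(k)}\#_{s_1}G_{s_2,\ldots,s_{p-1}}(A_1^{(k)},\ldots,A_{i-1}^{(k)},A_{i+1}^{(k)},\ldots,A_p^{(k)})$. The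 NBMP mean is the case $(s_1,\ldots,s_{p-1})=((p-1)/p,(p-2)/(p-1),\ldots,1/2)$; it is known that in this case the sequences converge, in the Thompson metric and hence in operator norm, to a common positive definite limit, so the NBMP mean is well defined for positive definite operators. *)

theory Defs
  imports "HOL-Analysis.Analysis" "HOL-Computational_Algebra.Polynomial"
begin

section \<open>The complex Hilbert space of square-summable sequences\<close>

text \<open>Coordinates are numbered from 0 instead of from 1.\<close>

typedef l2 = "{x :: nat \<Rightarrow> complex. summable (\<lambda>i. (cmod (x i))\<^sup>2)}"
  morphisms l2_nth Abs_l2
  by (rule exI[of _ "\<lambda>_. 0"]) simp

setup_lifting type_definition_l2

lemma l2_eqI: "(\<And>i. l2_nth x i = l2_nth y i) \<Longrightarrow> x = y"
  by (metis ext l2_nth_inject)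

lemma summable_sq_add:
  fixes x y :: "nat \<Rightarrow> complex"
  assumes "summable (\<lambda>i. (cmod (x i))\<^sup>2)" "summable (\<lambda>i. (cmod (y i))\<^sup>2)"
  shows "summable (\<lambda>i. (cmod (x i + y i))\<^sup>2)"
proof (rule summable_comparison_test')
  show "summable (\<lambda>i. 2 * (cmod (x i))\<^sup>2 + 2 * (cmod (y i))\<^sup>2)"
    using assms by (intro summable_add summable_mult)
  fix i :: nat
  have "(cmod (x i + y i))\<^sup>2 \<le> (cmod (x i) + cmod (y i))\<^sup>2"
    by (intro power_mono norm_triangle_ineq) simp
  also have "\<dots> \<le> 2 * (cmod (x i))\<^sup>2 + 2 * (cmod (y i))\<^sup>2"
    using zero_le_power2[of "cmod (x i) - cmod (y i)"]
    by (simp add: power2_eq_square algebra_simps)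
  finally show "norm ((cmod (x i + y i))\<^sup>2) \<le> 2 * (cmod (x i))\<^sup>2 + 2 * (cmod (y i))\<^sup>2"
    by simp
qed

lemma summable_sq_scale:
  fixes x :: "nat \<Rightarrow> complex"
  assumes "summable (\<lambda>i. (cmod (x i))\<^sup>2)"
  shows "summable (\<lambda>i. (cmod (c * x i))\<^sup>2)"
  using summable_mult[OF assms, of "(cmod c)\<^sup>2"] by (simp add: norm_mult power_mult_distrib)

lemma summable_cmod_mult:
  fixes x y :: "nat \<Rightarrow> complex"
  assumes "summable (\<lambda>i. (cmod (x i))\<^sup>2)" "summable (\<lambda>i. (cmod (y i))\<^sup>2)"
  shows "summable (\<lambda>i. cmod (x i) * cmod (y i))"
proof (rule summable_comparison_test')
  show "summable (\<lambda>i. (cmod (x i))\<^sup>2 + (cmod (y i))\<^sup>2)"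
    using assms by (intro summable_add)
  fix i :: nat
  show "norm (cmod (x i) * cmod (y i)) \<le> (cmod (x i))\<^sup>2 + (cmod (y i))\<^sup>2"
    using sum_squares_bound[of "cmod (x i)" "cmod (y i)"] mult_nonneg_nonneg[OF norm_ge_zero norm_ge_zero, of "x i" "y i"]
    by (simp only: real_norm_def abs_mult abs_norm_cancel)
qed

lift_definition cinner :: "l2 \<Rightarrow> l2 \<Rightarrow> complex"
  is "\<lambda>x y. \<Sum>i. cnj (x i) * y i" .

lemma summable_cinner: "summable (\<lambda>i. cnj (l2_nth x i) * l2_nth y i)"
  by (rule summable_norm_cancel)
     (use summable_cmod_mult[of "l2_nth x" "l2_nth y"] l2_nth in \<open>auto simp: norm_mult\<close>)

lift_definition scaleC_l2 :: "complex \<Rightarrow> l2 \<Rightarrow> l2" is "\<lambda>c x i. c * x i"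
  by (rule summable_sq_scale)

instantiation l2 :: real_inner
begin

lift_definition zero_l2 :: l2 is "\<lambda>_. 0" by simp

lift_definition plus_l2 :: "l2 \<Rightarrow> l2 \<Rightarrow> l2" is "\<lambda>x y i. x i + y i"
  by (rule summable_sq_add)

lift_definition uminus_l2 :: "l2 \<Rightarrow> l2" is "\<lambda>x i. - x i" by simp

definition minus_l2 :: "l2 \<Rightarrow> l2 \<Rightarrow> l2" where "minus_l2 x y = x + - y"

definition scaleR_l2 :: "real \<Rightarrow> l2 \<Rightarrow> l2" where "scaleR_l2 r x = scaleC_l2 (of_real r) x"

definition inner_l2 :: "l2 \<Rightarrow> l2 \<Rightarrow> real" where "inner_l2 x y = Re (cinner x y)"

definition norm_l2 :: "l2 \<Rightarrow> real" where "norm_l2 x = sqrt (\<Sum>i. (cmod (l2_nth x i))\<^sup>2)"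

definition sgn_l2 :: "l2 \<Rightarrow> l2" where "sgn_l2 x = scaleR (inverse (norm x)) x"

definition dist_l2 :: "l2 \<Rightarrow> l2 \<Rightarrow> real" where "dist_l2 x y = norm (x - y)"

definition [code del]:
  "(uniformity :: (l2 \<times> l2) filter) = (INF e\<in>{0 <..}. principal {(x, y). dist x y < e})"

definition open_l2 :: "l2 set \<Rightarrow> bool"
  where [code del]: "open_l2 S = (\<forall>x\<in>S. \<forall>\<^sub>F (x', y) in uniformity. x' = x \<longrightarrow> y \<in> S)"

instance
proof
  fix x y z :: l2 and r s :: real
  note nth = zero_l2.rep_eq plus_l2.rep_eq uminus_l2.rep_eq scaleC_l2.rep_eq
  show "x + y + z = x + (y + z)" "x + y = y + x" "0 + x = x" "- x + x = 0" "x - y = x + - y"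
    by (auto intro!: l2_eqI simp: nth minus_l2_def)
  show "r *\<^sub>R (x + y) = r *\<^sub>R x + r *\<^sub>R y" "(r + s) *\<^sub>R x = r *\<^sub>R x + s *\<^sub>R x"
    "r *\<^sub>R s *\<^sub>R x = (r * s) *\<^sub>R x" "1 *\<^sub>R x = x"
    by (auto intro!: l2_eqI simp: nth scaleR_l2_def algebra_simps)
  show "inner x y = inner y x"
  proof -
    have "cinner x y = (\<Sum>i. cnj (cnj (l2_nth y i) * l2_nth x i))"
      by (simp add: cinner.rep_eq mult.commute)
    also have "\<dots> = cnj (cinner y x)"
      unfolding cinner.rep_eq
      using sums_unique[OF sums_cnj[THEN iffD2, OF summable_sums[OF summable_cinner[of y x]]]]
      by simp
    finally show ?thesis by (simp add: inner_l2_def)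
  qed
  show "inner (x + y) z = inner x z + inner y z"
    using suminf_add[OF summable_cinner[of x z] summable_cinner[of y z]]
    by (simp add: inner_l2_def cinner.rep_eq nth algebra_simps flip: plus_complex.simps)
  show "inner (r *\<^sub>R x) y = r * inner x y"
    using suminf_mult[OF summable_cinner[of x y], of "of_real r"]
    by (simp add: inner_l2_def cinner.rep_eq nth scaleR_l2_def mult.assoc)
  have inner_self: "inner u u = (\<Sum>i. (cmod (l2_nth u i))\<^sup>2)" for u :: l2
  proof -
    have "cinner u u = (\<Sum>i. of_real ((cmod (l2_nth u i))\<^sup>2))"
      unfolding cinner.rep_eq
      by (simp add: complex_norm_square mult.commute flip: of_real_power)
    also have "\<dots> = of_real (\<Sum>i. (cmod (l2_nth u i))\<^sup>2)"
      using l2_nth[of u] by (subst suminf_of_real) auto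
    finally show ?thesis by (simp add: inner_l2_def)
  qed
  show "0 \<le> inner x x"
    using l2_nth[of x] by (auto simp: inner_self intro!: suminf_nonneg)
  show "inner x x = 0 \<longleftrightarrow> x = 0"
    using l2_nth[of x] suminf_eq_zero_iff[of "\<lambda>i. (cmod (l2_nth x i))\<^sup>2"]
    by (auto simp: inner_self nth intro!: l2_eqI)
  show "norm x = sqrt (inner x x)"
    by (simp add: inner_self norm_l2_def)
qed (simp_all add: sgn_l2_def dist_l2_def open_l2_def uniformity_l2_def)

end

lemmas l2_nth_simps [simp] =
  zero_l2.rep_eq plus_l2.rep_eq uminus_l2.rep_eq scaleC_l2.rep_eq

lemma l2_nth_minus [simp]: "l2_nth (x - y) i = l2_nth x i - l2_nth y i"
  by (subst minus_l2_def, subst plus_l2.rep_eq) simp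

lemma l2_norm_sq: "(norm x)\<^sup>2 = (\<Sum>i. (cmod (l2_nth x i))\<^sup>2)"
  using l2_nth[of x] by (auto simp: norm_l2_def intro!: suminf_nonneg)

lemma sum_le_l2_norm_sq: "finite I \<Longrightarrow> (\<Sum>i\<in>I. (cmod (l2_nth x i))\<^sup>2) \<le> (norm x)\<^sup>2"
  unfolding l2_norm_sq using l2_nth[of x] by (intro sum_le_suminf) auto

lemma cmod_l2_nth_le: "cmod (l2_nth x i) \<le> norm x"
  using sum_le_l2_norm_sq[of "{i}" x] by - (rule power2_le_imp_le, auto)

lemma norm_scaleC_l2: "norm (scaleC_l2 c x) = cmod c * norm x"
proof -
  have "(norm (scaleC_l2 c x))\<^sup>2 = (cmod c * norm x)\<^sup>2"
    using suminf_mult[of "\<lambda>i. (cmod (l2_nth x i))\<^sup>2" "(cmod c)\<^sup>2"] l2_nth[of x]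
    by (simp add: l2_norm_sq norm_mult power_mult_distrib)
  then show ?thesis by (rule power2_eq_imp_eq) auto
qed

lemma l2_nth_scaleR [simp]: "l2_nth (r *\<^sub>R x) i = of_real r * l2_nth x i"
  by (simp add: scaleR_l2_def)

instance l2 :: complete_space
proof
  fix X :: "nat \<Rightarrow> l2"
  assume X: "Cauchy X"
  have "Cauchy (\<lambda>n. l2_nth (X n) i)" for i
  proof (rule metric_CauchyI)
    fix e :: real assume "e > 0"
    then obtain N where N: "\<And>m n. m \<ge> N \<Longrightarrow> n \<ge> N \<Longrightarrow> dist (X m) (X n) < e"
      using X by (meson metric_CauchyD)
    have "dist (l2_nth (X m) i) (l2_nth (X n) i) < e" if "m \<ge> N" "n \<ge> N" for m n
      using cmod_l2_nth_le[of "X m - X n" i] N[OF that] by (simp add: dist_norm)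
    then show "\<exists>M. \<forall>m\<ge>M. \<forall>n\<ge>M. dist (l2_nth (X m) i) (l2_nth (X n) i) < e" by blast
  qed
  then have "\<forall>i. \<exists>l. (\<lambda>n. l2_nth (X n) i) \<longlonglongrightarrow> l"
    using Cauchy_convergent_iff convergent_def by blast
  then obtain y where y: "\<And>i. (\<lambda>n. l2_nth (X n) i) \<longlonglongrightarrow> y i" by metis
  have bound: "(\<Sum>i<k. (cmod (l2_nth (X m) i - y i))\<^sup>2) \<le> e\<^sup>2"
    if N: "\<And>n. n \<ge> N \<Longrightarrow> dist (X m) (X n) \<le> e" for m k N e
  proof (rule LIMSEQ_le_const2)
    show "(\<lambda>n. \<Sum>i<k. (cmod (l2_nth (X m) i - l2_nth (X n) i))\<^sup>2) \<longlonglongrightarrow>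
        (\<Sum>i<k. (cmod (l2_nth (X m) i - y i))\<^sup>2)"
      by (intro tendsto_intros y)
    have "(\<Sum>i<k. (cmod (l2_nth (X m) i - l2_nth (X n) i))\<^sup>2) \<le> e\<^sup>2" if "n \<ge> N" for n
    proof -
      have "(norm (X m - X n))\<^sup>2 \<le> e\<^sup>2"
        using N[OF that] by (intro power_mono) (auto simp: dist_norm)
      then show ?thesis using sum_le_l2_norm_sq[of "{..<k}" "X m - X n"] by simp
    qed
    then show "\<exists>N. \<forall>n\<ge>N. (\<Sum>i<k. (cmod (l2_nth (X m) i - l2_nth (X n) i))\<^sup>2) \<le> e\<^sup>2" by blast
  qed
  obtain N1 where N1: "\<And>m n. m \<ge> N1 \<Longrightarrow> n \<ge> N1 \<Longrightarrow> dist (X m) (X n) < 1"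
    using X by (meson metric_CauchyD zero_less_one)
  have "summable (\<lambda>i. (cmod (l2_nth (X N1) i - y i))\<^sup>2)"
  proof (rule bounded_imp_summable)
    show "(\<Sum>i\<le>n. (cmod (l2_nth (X N1) i - y i))\<^sup>2) \<le> 1\<^sup>2" for n
      using bound[of N1 N1 1 "Suc n"] N1[of N1]
      by (simp only: lessThan_Suc_atMost order.refl less_imp_le)
  qed simp
  then have "summable (\<lambda>i. (cmod (y i - l2_nth (X N1) i))\<^sup>2)" by (simp add: norm_minus_commute)
  then have sy: "summable (\<lambda>i. (cmod (y i))\<^sup>2)"
    using summable_sq_add[of "\<lambda>i. y i - l2_nth (X N1) i" "l2_nth (X N1)"] l2_nth[of "X N1"] by simp
  define Y where "Y = Abs_l2 y"
  have nthY: "l2_nth Y = y" using sy by (simp add: Y_def Abs_l2_inverse)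
  have "X \<longlonglongrightarrow> Y"
  proof (rule metric_LIMSEQ_I)
    fix e :: real assume "e > 0"
    then obtain N where N: "\<And>m n. m \<ge> N \<Longrightarrow> n \<ge> N \<Longrightarrow> dist (X m) (X n) < e / 2"
      using X by (meson metric_CauchyD half_gt_zero)
    have "dist (X m) Y < e" if "m \<ge> N" for m
    proof -
      have "(norm (X m - Y))\<^sup>2 \<le> (e/2)\<^sup>2"
        unfolding l2_norm_sq using l2_nth[of "X m - Y"] bound[of N m "e/2"] N[OF that]
        by (intro suminf_le_const) (auto simp: nthY less_imp_le)
      then have "norm (X m - Y) \<le> e / 2" by (rule power2_le_imp_le) (use \<open>e > 0\<close> in simp)
      then show ?thesis using \<open>e > 0\<close> by (simp add: dist_norm)
    qed
    then show "\<exists>N. \<forall>n\<ge>N. dist (X n) Y < e" by blast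
  qed
  then show "convergent X" by (auto simp: convergent_def)
qed

instance l2 :: banach ..

lift_definition l2_unit :: "nat \<Rightarrow> l2" is "\<lambda>j i. if i = j then 1 else 0"
proof -
  fix j :: nat
  show "summable (\<lambda>i. (cmod (if i = j then 1 else 0))\<^sup>2)"
    by (rule summable_finite[of "{j}"]) auto
qed


section \<open>Bounded operators\<close>

typedef bop = "{f :: l2 \<Rightarrow> l2. bounded_linear f \<and> (\<forall>c x. f (scaleC_l2 c x) = scaleC_l2 c (f x))}"
  morphisms bop_apply Abs_bop
  by (rule exI[of _ "\<lambda>_. 0"]) (auto intro!: l2_eqI)

setup_lifting type_definition_bop

lemma scaleC_l2_add: "scaleC_l2 c (x + y) = scaleC_l2 c x + scaleC_l2 c y"
  by (auto intro!: l2_eqI simp: algebra_simps)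

lemma scaleC_l2_minus: "scaleC_l2 c (- x) = - scaleC_l2 c x"
  by (auto intro!: l2_eqI)

lemma scaleC_l2_diff: "scaleC_l2 c (x - y) = scaleC_l2 c x - scaleC_l2 c y"
  by (auto intro!: l2_eqI simp: algebra_simps)

lemma scaleC_l2_commute: "scaleC_l2 c (scaleC_l2 d x) = scaleC_l2 d (scaleC_l2 c x)"
  by (auto intro!: l2_eqI)

lemma scaleC_l2_scaleR: "scaleC_l2 c (r *\<^sub>R x) = r *\<^sub>R scaleC_l2 c x"
  by (auto intro!: l2_eqI)

lemma bounded_linear_scaleC_l2: "bounded_linear (scaleC_l2 c)"
  by (rule bounded_linear_intro[of _ "cmod c"])
     (auto intro!: l2_eqI simp: algebra_simps norm_scaleC_l2)

lift_definition scaleC_bop :: "complex \<Rightarrow> bop \<Rightarrow> bop" is "\<lambda>c f x. scaleC_l2 c (f x)"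
  using bounded_linear_compose[OF bounded_linear_scaleC_l2]
  by (auto simp: scaleC_l2_commute)

text \<open>Multiplication is composition and the norm is the operator norm.\<close>

instantiation bop :: real_normed_algebra_1
begin

lift_definition zero_bop :: bop is "\<lambda>_. 0" by (auto intro!: l2_eqI)

lift_definition one_bop :: bop is "\<lambda>x. x" by simp

lift_definition plus_bop :: "bop \<Rightarrow> bop \<Rightarrow> bop" is "\<lambda>f g x. f x + g x"
  by (auto intro: bounded_linear_add simp: scaleC_l2_add)

lift_definition uminus_bop :: "bop \<Rightarrow> bop" is "\<lambda>f x. - f x"
  by (auto intro: bounded_linear_minus simp: scaleC_l2_minus)

lift_definition minus_bop :: "bop \<Rightarrow> bop \<Rightarrow> bop" is "\<lambda>f g x. f x - g x"
  by (auto intro: bounded_linear_sub simp: scaleC_l2_diff)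

lift_definition times_bop :: "bop \<Rightarrow> bop \<Rightarrow> bop" is "\<lambda>f g x. f (g x)"
  by (auto intro: bounded_linear_compose)

lift_definition scaleR_bop :: "real \<Rightarrow> bop \<Rightarrow> bop" is "\<lambda>r f x. r *\<^sub>R f x"
  using bounded_linear_compose[OF bounded_linear_scaleR_right]
  by (auto simp: scaleC_l2_scaleR)

lift_definition norm_bop :: "bop \<Rightarrow> real" is onorm .

definition sgn_bop :: "bop \<Rightarrow> bop" where "sgn_bop A = scaleR (inverse (norm A)) A"

definition dist_bop :: "bop \<Rightarrow> bop \<Rightarrow> real" where "dist_bop A B = norm (A - B)"

definition [code del]:
  "(uniformity :: (bop \<times> bop) filter) = (INF e\<in>{0 <..}. principal {(x, y). dist x y < e})"

definition open_bop :: "bop set \<Rightarrow> bool"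
  where [code del]: "open_bop S = (\<forall>x\<in>S. \<forall>\<^sub>F (x', y) in uniformity. x' = x \<longrightarrow> y \<in> S)"

instance
proof
  fix A B C :: bop and r s :: real
  show "A + B + C = A + (B + C)" "A + B = B + A" "0 + A = A" "- A + A = 0" "A - B = A + - B"
    "r *\<^sub>R (A + B) = r *\<^sub>R A + r *\<^sub>R B" "(r + s) *\<^sub>R A = r *\<^sub>R A + s *\<^sub>R A"
    "r *\<^sub>R s *\<^sub>R A = (r * s) *\<^sub>R A" "1 *\<^sub>R A = A"
    "A * B * C = A * (B * C)" "1 * A = A" "A * 1 = A" "(A + B) * C = A * C + B * C"
    "r *\<^sub>R A * B = r *\<^sub>R (A * B)"
    by (transfer, auto simp: algebra_simps)+
  show "A * (B + C) = A * B + A * C"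
    by (transfer, auto simp: linear_add bounded_linear.linear)
  show "A * r *\<^sub>R B = r *\<^sub>R (A * B)"
    by (transfer, auto simp: linear_scale bounded_linear.linear)
  show "(0::bop) \<noteq> 1"
  proof
    assume "(0::bop) = 1"
    then have "bop_apply 0 (l2_unit 0) = bop_apply 1 (l2_unit 0)" by simp
    then have "l2_unit 0 = 0" by (simp add: zero_bop.rep_eq one_bop.rep_eq)
    then have "l2_nth (l2_unit 0) 0 = 0" by simp
    then show False by (simp add: l2_unit.rep_eq)
  qed
  show "norm A = 0 \<longleftrightarrow> A = 0"
    by (transfer, auto simp: onorm_eq_0)
  show "norm (A + B) \<le> norm A + norm B"
    by (transfer, auto intro: onorm_triangle)
  show "norm (r *\<^sub>R A) = \<bar>r\<bar> * norm A"
    by (transfer, auto simp: onorm_scaleR)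
  show "norm (A * B) \<le> norm A * norm B"
    by (transfer, use onorm_compose in \<open>auto simp: o_def\<close>)
  show "norm (1::bop) = 1"
  proof (rule antisym)
    show "norm (1::bop) \<le> 1" by (transfer, rule onorm_id_le)
    have u: "norm (l2_unit 0) \<noteq> 0"
    proof
      assume "norm (l2_unit 0) = 0"
      then have "l2_nth (l2_unit 0) 0 = 0" by simp
      then show False by (simp add: l2_unit.rep_eq)
    qed
    have "norm (l2_unit 0) \<le> norm (1::bop) * norm (l2_unit 0)"
      unfolding norm_bop.rep_eq one_bop.rep_eq
      by (rule onorm[of "\<lambda>x. x", OF bounded_linear_ident])
    then show "1 \<le> norm (1::bop)" using u by simp
  qed
qed (simp_all add: sgn_bop_def dist_bop_def open_bop_def uniformity_bop_def)

end

definition selfadjoint :: "bop \<Rightarrow> bool"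
  where "selfadjoint A \<longleftrightarrow> (\<forall>v w. cinner (bop_apply A v) w = cinner v (bop_apply A w))"

text \<open>For self-adjoint \<open>A\<close> the number \<open>v\<^sup>*Av\<close> is real.\<close>

definition posdef :: "bop \<Rightarrow> bool"
  where "posdef A \<longleftrightarrow> selfadjoint A \<and>
    (\<exists>\<gamma>>0. \<forall>v. Re (cinner v (bop_apply A v)) \<ge> \<gamma> * (norm v)\<^sup>2)"

definition compact_op :: "bop \<Rightarrow> bool"
  where "compact_op K \<longleftrightarrow> compact (closure (bop_apply K ` cball 0 1))"


section \<open>Quasi-Toeplitz operators\<close>

text \<open>Only the values on \<open>[0, 2\<pi>]\<close> matter.\<close>

definition C_2pi :: "(real \<Rightarrow> complex) set"
  where "C_2pi = {a. continuous_on {0..2*pi} a \<and> a 0 = a (2*pi)}"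

definition fourier_coeff :: "(real \<Rightarrow> complex) \<Rightarrow> int \<Rightarrow> complex"
  where "fourier_coeff a k = integral {0..2*pi} (\<lambda>t. a t * cis (- (of_int k * t))) / (2 * pi)"

text \<open>The matrix entry depends on \<open>j - i\<close> only, so it is unaffected by numbering from 0.\<close>

definition toeplitz :: "(real \<Rightarrow> complex) \<Rightarrow> bop"
  where "toeplitz a = (THE A. \<forall>i j. l2_nth (bop_apply A (l2_unit j)) i =
    fourier_coeff a (int j - int i))"

definition QT :: "bop set"
  where "QT = {toeplitz a + K | a K. a \<in> C_2pi \<and> compact_op K}"


section \<open>Functional calculus and real powers\<close>

definition invertible_op :: "bop \<Rightarrow> bool"
  where "invertible_op A \<longleftrightarrow> (\<exists>B. A * B = 1 \<and> B * A = 1)"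

definition spectrum_op :: "bop \<Rightarrow> complex set"
  where "spectrum_op A = {z. \<not> invertible_op (A - scaleC_bop z 1)}"

definition poly_op :: "real poly \<Rightarrow> bop \<Rightarrow> bop"
  where "poly_op q A = (\<Sum>i\<le>degree q. coeff q i *\<^sub>R A ^ i)"

text \<open>
  Continuous functional calculus of a self-adjoint \<open>A\<close>, whose spectrum is a compact set of reals:
  \<open>f(A)\<close> is the norm limit of \<open>q\<^sub>n(A)\<close> for any polynomials \<open>q\<^sub>n\<close> converging to \<open>f\<close> uniformly
  on the spectrum. Of no meaning if \<open>A\<close> is not self-adjoint or \<open>f\<close> is not continuous there.
\<close>

definition fun_calc :: "(real \<Rightarrow> real) \<Rightarrow> bop \<Rightarrow> bop"
  where "fun_calc f A = (THE B. \<exists>q :: nat \<Rightarrow> real poly.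
    uniform_limit {x. complex_of_real x \<in> spectrum_op A} (\<lambda>n. poly (q n)) f sequentially \<and>
    (\<lambda>n. poly_op (q n) A) \<longlonglongrightarrow> B)"

text \<open>Used for positive definite \<open>A\<close> only, whose spectrum lies in \<open>(0, \<infinity>)\<close>.\<close>

definition powr_op :: "bop \<Rightarrow> real \<Rightarrow> bop"
  where "powr_op A s = fun_calc (\<lambda>x. x powr s) A"


section \<open>Means\<close>

definition wgm :: "real \<Rightarrow> bop \<Rightarrow> bop \<Rightarrow> bop"
  where "wgm t A B =
    powr_op A (1/2) * powr_op (powr_op A (-1/2) * B * powr_op A (-1/2)) t * powr_op A (1/2)"

text \<open>
  A tuple of \<open>p\<close> operators is a function on \<open>nat\<close> of which only the values at \<open>1, \<dots>, p\<close> matter.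
\<close>

definition omit :: "nat \<Rightarrow> (nat \<Rightarrow> 'a) \<Rightarrow> nat \<Rightarrow> 'a"
  where "omit i A = (\<lambda>j. if j < i then A j else A (Suc j))"

text \<open>
  The \<open>k\<close>-th iterate, for the weight \<open>s\<close> and a mean \<open>M\<close> of one operator fewer.
\<close>

primrec mean_iter :: "real \<Rightarrow> ((nat \<Rightarrow> bop) \<Rightarrow> bop) \<Rightarrow> (nat \<Rightarrow> bop) \<Rightarrow> nat \<Rightarrow> nat \<Rightarrow> bop"
  where
    "mean_iter s M A 0 = A"
  | "mean_iter s M A (Suc k) =
      (\<lambda>i. wgm s (mean_iter s M A k i) (M (omit i (mean_iter s M A k))))"

definition common_limit :: "nat \<Rightarrow> (nat \<Rightarrow> nat \<Rightarrow> bop) \<Rightarrow> bop"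
  where "common_limit p X = (THE L. \<forall>i\<in>{1..p}. (\<lambda>k. X k i) \<longlonglongrightarrow> L)"

text \<open>A list of \<open>p - 1\<close> weights yields a mean of \<open>p\<close> operators; the empty list is a dummy case.\<close>

fun gmean :: "real list \<Rightarrow> (nat \<Rightarrow> bop) \<Rightarrow> bop"
  where
    "gmean [] A = A 1"
  | "gmean [s] A = wgm s (A 1) (A 2)"
  | "gmean (s # s' # ss) A =
      common_limit (length ss + 3) (mean_iter s (gmean (s' # ss)) A)"

definition nbmp_weights :: "nat \<Rightarrow> real list"
  where "nbmp_weights p = map (\<lambda>j. (real p - real j) / (real p - real j + 1)) [1..<p]"

definition nbmp_iter :: "nat \<Rightarrow> (nat \<Rightarrow> bop) \<Rightarrow> nat \<Rightarrow> nat \<Rightarrow> bop"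
  where "nbmp_iter p = mean_iter (hd (nbmp_weights p)) (gmean (tl (nbmp_weights p)))"

definition nbmp_mean :: "nat \<Rightarrow> (nat \<Rightarrow> bop) \<Rightarrow> bop"
  where "nbmp_mean p = gmean (nbmp_weights p)"

end

theory Submission
  imports Defs "HOL-Computational_Algebra.Fundamental_Theorem_Algebra" "HOL-Combinatorics.Permutations"
begin

text \<open>
  The map \<open>T(a) + K \<mapsto> a\<close> is multiplicative modulo compact operators and
  \<open>\<parallel>T(a)\<parallel>\<^sub>2 \<le> sup \<bar>a\<bar>\<close>, so approximating \<open>x\<^sup>s\<close> by polynomials shows
  that \<open>A\<^sup>s\<close> has symbol \<open>a\<^sup>s\<close> when \<open>A\<close> has symbol \<open>a\<close>. Hence the weighted mean of operators with
  symbols \<open>a\<close> and \<open>b\<close> has symbol \<open>a\<^bsup>1-t\<^esup> b\<^sup>t\<close>, and with the NBMP weights all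
  symbols equal \<open>g\<close> after one step. Since they do not change afterwards, the compact parts are
  \<open>A\<^sub>i\<^bsup>(k)\<^esup> - T(g)\<close> and converge as soon as the iterates do.

  The iterates converge because each step shrinks the Thompson diameter of the tuple by the factor
  \<open>2/p\<close>: the mean of \<open>p - 1\<close> operators is symmetric and is nonexpansive with weight \<open>1/(p - 1)\<close> in
  every argument. This rests on the joint monotonicity of \<open>A #\<^sub>t B\<close>, which for \<open>t = 1/2\<close>
  follows from the Riccati equation, then by repeated midpoints for dyadic \<open>t\<close>, and by
  continuity for all \<open>t\<close>.
\<close>

section \<open>Operators and the Loewner order\<close>

text \<open>Powers are available only through \<open>fun_calc\<close>, a description by
  approximating polynomials, so the norm of \<open>q(A)\<close> must first be read off from the
  values of \<open>q\<close> on the spectrum. For this \<open>q\<close> is split into real factors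
  without zeros on the spectrum: linear ones, invertible by definition of the spectrum, and
  quadratic ones, positive definite at \<open>A\<close>. Operator monotonicity of \<open>x^t\<close>
  is not taken from an integral representation; its source is the monotonicity of the square root,
  proved by excluding negative spectrum, together with the equation \<open>Z X^(-1) Z = Y\<close>
  for the midpoint mean. The factor \<open>2/p\<close> arises as follows. The weights are chosen so
  that each step gives weight \<open>1/p\<close> to every argument. Two new entries \<open>i\<close>
  and \<open>j\<close> differ in the direct argument, and the tuples without \<open>i\<close> and
  without \<open>j\<close> agree up to order after one entry is changed: \<open>1/p\<close> from
  each. The mean of \<open>p - 1\<close> operators enters a step as a black box, so all its
  properties are carried together through an induction on \<open>p\<close>. Real powers of symbols
  need strict positivity. It is derived by testing the operator on finitely supported vectors
  shifted to infinity.\<close>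

notation bop_apply (infixr "\<cdot>" 75)

lemma bounded_linear_bop_apply: "bounded_linear (bop_apply A)"
  using bop_apply[of A] by simp

lemma bop_apply_scaleC: "A \<cdot> scaleC_l2 c x = scaleC_l2 c (A \<cdot> x)"
  using bop_apply[of A] by simp

lemma bop_eqI: "(\<And>v. A \<cdot> v = B \<cdot> v) \<Longrightarrow> A = B"
  by (metis bop_apply_inject ext)

lemmas linear_bop_apply = bounded_linear.linear[OF bounded_linear_bop_apply]

lemmas bop_simps [simp] =
  zero_bop.rep_eq one_bop.rep_eq plus_bop.rep_eq uminus_bop.rep_eq minus_bop.rep_eq
  times_bop.rep_eq scaleR_bop.rep_eq scaleC_bop.rep_eq
  linear_0[OF linear_bop_apply] linear_add[OF linear_bop_apply] linear_diff[OF linear_bop_apply]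
  linear_neg[OF linear_bop_apply] linear_scale[OF linear_bop_apply]

lemma norm_bop_apply: "norm (A \<cdot> v) \<le> norm A * norm v"
  unfolding norm_bop.rep_eq by (rule onorm[OF bounded_linear_bop_apply])

lemma norm_bop_le:
  assumes "c \<ge> 0" "\<And>v. norm (A \<cdot> v) \<le> c * norm v"
  shows "norm A \<le> c"
  unfolding norm_bop.rep_eq by (rule onorm_bound) (use assms in \<open>auto intro: order_trans[OF norm_ge_zero]\<close>)

text \<open>A Cauchy sequence converges in the space of bounded real-linear maps, which carries the
  same norm; complex homogeneity passes to the pointwise limit.\<close>

instance bop :: complete_space
proof
  fix X :: "nat \<Rightarrow> bop"
  assume X: "Cauchy X"
  define Y where "Y n = Blinfun (bop_apply (X n))" for n
  have Y: "blinfun_apply (Y n) = bop_apply (X n)" for n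
    by (simp add: Y_def bounded_linear_bop_apply bounded_linear_Blinfun_apply)
  have dist: "dist (Y m) (Y n) = dist (X m) (X n)" for m n
    by (simp add: dist_norm norm_blinfun.rep_eq norm_bop.rep_eq Y minus_blinfun.rep_eq
        minus_bop.rep_eq)
  have "Cauchy Y" using X by (simp add: Cauchy_def dist)
  then obtain L where L: "Y \<longlonglongrightarrow> L" using Cauchy_convergent_iff convergent_def by blast
  have lim: "(\<lambda>n. X n \<cdot> v) \<longlonglongrightarrow> blinfun_apply L v" for v
    using bounded_linear.tendsto[OF blinfun.bounded_linear_left L, of v] by (simp add: Y)
  have "blinfun_apply L (scaleC_l2 c x) = scaleC_l2 c (blinfun_apply L x)" for c x
    using lim[of "scaleC_l2 c x"] bounded_linear.tendsto[OF bounded_linear_scaleC_l2 lim, of c x]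
    by (auto simp: bop_apply_scaleC intro: LIMSEQ_unique)
  then have B: "bop_apply (Abs_bop (blinfun_apply L)) = blinfun_apply L"
    by (intro Abs_bop_inverse) (auto intro: blinfun.bounded_linear_right)
  have "dist (X n) (Abs_bop (blinfun_apply L)) = dist (Y n) L" for n
    by (simp add: dist_norm norm_blinfun.rep_eq norm_bop.rep_eq Y minus_blinfun.rep_eq
        minus_bop.rep_eq B)
  then have "X \<longlonglongrightarrow> Abs_bop (blinfun_apply L)"
    using L by (simp add: tendsto_dist_iff[of X] tendsto_dist_iff[of Y])
  then show "convergent X" by (auto simp: convergent_def)
qed

instance bop :: banach ..

section \<open>Self-adjointness in terms of the real inner product\<close>

lemma cinner_scaleC_right: "cinner x (scaleC_l2 c y) = c * cinner x y"
  using suminf_mult[OF summable_cinner[of x y], of c]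
  by (simp add: cinner.rep_eq mult.left_commute)

lemma Re_cinner: "Re (cinner x y) = inner x y"
  by (simp add: inner_l2_def)

lemma Im_cinner: "Im (cinner x y) = - inner x (scaleC_l2 \<i> y)"
  by (simp add: inner_l2_def cinner_scaleC_right)

lemma cinner_l2_unit: "cinner (l2_unit k) y = l2_nth y k"
proof -
  have "(\<Sum>i. cnj (l2_nth (l2_unit k) i) * l2_nth y i) = (\<Sum>i\<in>{k}. cnj (l2_nth (l2_unit k) i) * l2_nth y i)"
    by (rule suminf_finite) (auto simp: l2_unit.rep_eq)
  then show ?thesis by (simp add: cinner.rep_eq l2_unit.rep_eq)
qed

lemma norm_l2_unit [simp]: "norm (l2_unit k) = 1"
  using Re_cinner[of "l2_unit k" "l2_unit k"]
  by (simp add: cinner_l2_unit l2_unit.rep_eq norm_eq_sqrt_inner)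

text \<open>The imaginary part of \<open>cinner\<close> is a real inner product with a vector
  multiplied by \<open>\<i>\<close>, and operators commute with this multiplication. All order
  arguments below can therefore use \<open>inner\<close> alone.\<close>

lemma selfadjoint_iff_inner:
  "selfadjoint A \<longleftrightarrow> (\<forall>v w. inner (A \<cdot> v) w = inner v (A \<cdot> w))"
  by (auto simp: selfadjoint_def complex_eq_iff Re_cinner Im_cinner simp flip: bop_apply_scaleC)

lemma selfadjointD: "selfadjoint A \<Longrightarrow> inner (A \<cdot> v) w = inner v (A \<cdot> w)"
  by (simp add: selfadjoint_iff_inner)

lemma selfadjoint_one [simp]: "selfadjoint 1"
  and selfadjoint_zero [simp]: "selfadjoint 0"
  by (simp_all add: selfadjoint_iff_inner)

lemma selfadjoint_add: "selfadjoint A \<Longrightarrow> selfadjoint B \<Longrightarrow> selfadjoint (A + B)"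
  and selfadjoint_diff: "selfadjoint A \<Longrightarrow> selfadjoint B \<Longrightarrow> selfadjoint (A - B)"
  and selfadjoint_scaleR: "selfadjoint A \<Longrightarrow> selfadjoint (r *\<^sub>R A)"
  by (simp_all add: selfadjoint_iff_inner inner_add_left inner_add_right inner_diff_left
      inner_diff_right)

lemma selfadjoint_mult:
  "selfadjoint A \<Longrightarrow> selfadjoint B \<Longrightarrow> A * B = B * A \<Longrightarrow> selfadjoint (A * B)"
  by (auto simp: selfadjoint_iff_inner) (metis times_bop.rep_eq)

lemma selfadjoint_conj:
  "selfadjoint S \<Longrightarrow> selfadjoint A \<Longrightarrow> selfadjoint (S * A * S)"
  by (auto simp: selfadjoint_iff_inner)



lemma bounded_linear_bop_apply_left: "bounded_linear (\<lambda>A. A \<cdot> v)"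
  by (rule bounded_linear_intro[of _ "norm v"])
    (auto simp: norm_bop_apply)

lemmas tendsto_bop_apply = bounded_linear.tendsto[OF bounded_linear_bop_apply_left]

lemma selfadjoint_limit:
  assumes "X \<longlonglongrightarrow> L" "\<And>n. selfadjoint (X n)"
  shows "selfadjoint L"
  unfolding selfadjoint_iff_inner
proof (intro allI)
  fix v w
  have "(\<lambda>n. inner (X n \<cdot> v) w) \<longlonglongrightarrow> inner (L \<cdot> v) w"
    by (intro tendsto_intros tendsto_bop_apply assms)
  moreover have "(\<lambda>n. inner (X n \<cdot> v) w) \<longlonglongrightarrow> inner v (L \<cdot> w)"
    using assms(2) by (simp only: selfadjointD) (intro tendsto_intros tendsto_bop_apply assms)
  ultimately show "inner (L \<cdot> v) w = inner v (L \<cdot> w)" by (rule LIMSEQ_unique)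
qed

text \<open>Only quadratic forms are compared, so this is a preorder on all operators;
  self-adjointness enters as a hypothesis where antisymmetry is wanted.\<close>

definition loewner_le :: "bop \<Rightarrow> bop \<Rightarrow> bool" (infix "\<preceq>" 50)
  where "A \<preceq> B \<longleftrightarrow> (\<forall>v. inner v (A \<cdot> v) \<le> inner v (B \<cdot> v))"

lemma loewner_refl [simp]: "A \<preceq> A"
  by (simp add: loewner_le_def)

lemma loewner_trans [trans]: "A \<preceq> B \<Longrightarrow> B \<preceq> C \<Longrightarrow> A \<preceq> C"
  unfolding loewner_le_def by (meson order_trans)

lemma loewner_scaleR: "A \<preceq> B \<Longrightarrow> 0 \<le> r \<Longrightarrow> r *\<^sub>R A \<preceq> r *\<^sub>R B"
  by (auto simp: loewner_le_def mult_left_mono)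

lemma loewner_conj:
  assumes "A \<preceq> B" "selfadjoint S"
  shows "S * A * S \<preceq> S * B * S"
  unfolding loewner_le_def
proof
  fix v
  have "inner v ((S * C * S) \<cdot> v) = inner (S \<cdot> v) (C \<cdot> S \<cdot> v)" for C
    using selfadjointD[OF assms(2), of v "C \<cdot> S \<cdot> v"] by simp
  then show "inner v ((S * A * S) \<cdot> v) \<le> inner v ((S * B * S) \<cdot> v)"
    using assms(1) by (simp add: loewner_le_def)
qed

lemma loewner_limit:
  assumes "X \<longlonglongrightarrow> A" "Y \<longlonglongrightarrow> B" "\<And>n. X n \<preceq> Y n"
  shows "A \<preceq> B"
  unfolding loewner_le_def
proof
  fix v
  show "inner v (A \<cdot> v) \<le> inner v (B \<cdot> v)"
  proof (rule LIMSEQ_le)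
    show "(\<lambda>n. inner v (X n \<cdot> v)) \<longlonglongrightarrow> inner v (A \<cdot> v)"
      "(\<lambda>n. inner v (Y n \<cdot> v)) \<longlonglongrightarrow> inner v (B \<cdot> v)"
      by (intro tendsto_intros tendsto_bop_apply assms)+
  qed (use assms(3) in \<open>auto simp: loewner_le_def\<close>)
qed

lemma inner_bop_le: "\<bar>inner v (A \<cdot> w)\<bar> \<le> norm A * norm v * norm w"
proof -
  have "\<bar>inner v (A \<cdot> w)\<bar> \<le> norm v * norm (A \<cdot> w)" by (rule Cauchy_Schwarz_ineq2)
  also have "\<dots> \<le> norm v * (norm A * norm w)"
    by (intro mult_left_mono norm_bop_apply) simp
  finally show ?thesis by (simp add: mult_ac)
qed

lemma loewner_le_norm: "A \<preceq> norm A *\<^sub>R 1"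
  unfolding loewner_le_def
proof
  fix v
  show "inner v (A \<cdot> v) \<le> inner v ((norm A *\<^sub>R 1) \<cdot> v)"
    using inner_bop_le[of v A v] by (simp add: power2_norm_eq_inner[symmetric] power2_eq_square mult_ac)
qed

lemma posdef_iff: "posdef A \<longleftrightarrow> selfadjoint A \<and> (\<exists>\<gamma>>0. \<gamma> *\<^sub>R 1 \<preceq> A)"
  by (simp add: posdef_def loewner_le_def Re_cinner power2_norm_eq_inner)

lemma posdef_selfadjoint: "posdef A \<Longrightarrow> selfadjoint A"
  by (simp add: posdef_def)

lemma posdef_pos: "posdef A \<Longrightarrow> inner v (A \<cdot> v) \<ge> 0"
  unfolding posdef_def Re_cinner by (meson mult_nonneg_nonneg order_less_imp_le order_trans zero_le_power2)

text \<open>Polarization: \<open>4 <Bx, y>\<close> is the difference of the quadratic form at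
  \<open>x + y\<close> and at \<open>x - y\<close>, and the parallelogram law sums up the two
  bounds. This turns order bounds into norm bounds.\<close>

lemma norm_selfadjoint_le:
  assumes "selfadjoint B" and c: "c \<ge> 0" and assm: "\<And>v. \<bar>inner v (B \<cdot> v)\<bar> \<le> c * (norm v)\<^sup>2"
  shows "norm B \<le> c"
proof (rule norm_bop_le[OF c])
  fix u
  have polar: "4 * inner (B \<cdot> x) y \<le> 2 * c * ((norm x)\<^sup>2 + (norm y)\<^sup>2)" for x y
  proof -
    have "4 * inner (B \<cdot> x) y = inner (x + y) (B \<cdot> (x + y)) - inner (x - y) (B \<cdot> (x - y))"
      using selfadjointD[OF assms(1), of x y]
      by (simp add: inner_add_left inner_add_right inner_diff_left inner_diff_right inner_commute)
    also have "\<dots> \<le> c * (norm (x + y))\<^sup>2 + c * (norm (x - y))\<^sup>2"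
      using assm[of "x + y"] assm[of "x - y"] by linarith
    also have "\<dots> = 2 * c * ((norm x)\<^sup>2 + (norm y)\<^sup>2)"
      by (simp add: power2_norm_eq_inner inner_add_left inner_add_right inner_diff_left
          inner_diff_right inner_commute algebra_simps)
    finally show ?thesis .
  qed
  show "norm (B \<cdot> u) \<le> c * norm u"
  proof (cases "B \<cdot> u = 0 \<or> u = 0")
    case True
    then show ?thesis using c by auto
  next
    case False
    \<comment> \<open>With this scale \<open>s B u\<close> is as long as \<open>u\<close>, which
      makes the two squares in \<open>polar\<close> equal.\<close>
    define s where "s = norm u / norm (B \<cdot> u)"
    have s: "s > 0" using False by (simp add: s_def)
    have "4 * (s * (norm (B \<cdot> u))\<^sup>2) \<le> 2 * c * ((norm u)\<^sup>2 + (norm (s *\<^sub>R (B \<cdot> u)))\<^sup>2)"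
      using polar[of u "s *\<^sub>R (B \<cdot> u)"] by (simp only: power2_norm_eq_inner inner_scaleR_right)
    moreover have "norm (s *\<^sub>R (B \<cdot> u)) = norm u" using False by (simp add: s_def)
    moreover have "s * (norm (B \<cdot> u))\<^sup>2 = norm u * norm (B \<cdot> u)"
      using False by (simp add: s_def power2_eq_square)
    ultimately have "norm u * norm (B \<cdot> u) \<le> norm u * (c * norm u)"
      by (simp only: power2_eq_square) (simp add: mult_ac)
    then show ?thesis using False by simp
  qed
qed

lemma loewner_antisym:
  assumes "selfadjoint A" "selfadjoint B" "A \<preceq> B" "B \<preceq> A"
  shows "A = B"
proof -
  have "norm (A - B) \<le> 0"
    using assms by (intro norm_selfadjoint_le selfadjoint_diff)
      (auto simp: loewner_le_def inner_diff_right intro: antisym)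
  then show ?thesis by simp
qed

section \<open>Inverses of positive definite operators\<close>

lemma neumann_inverse:
  fixes A :: bop
  assumes "norm (1 - A) < 1"
  obtains B where "A * B = 1" "B * A = 1"
proof
  let ?D = "1 - A"
  have s: "summable (\<lambda>n. ?D ^ n)" using summable_geometric_iff assms
    by (rule_tac summable_comparison_test'[of "\<lambda>n. norm ?D ^ n" 0])
      (auto intro: norm_power_ineq summable_geometric)
  let ?B = "\<Sum>n. ?D ^ n"
  have "?B = 1 + (\<Sum>n. ?D ^ Suc n)" using suminf_split_head[OF s] by simp
  moreover have "(\<Sum>n. ?D ^ Suc n) = ?D * ?B" using suminf_mult[OF s, of ?D] by simp
  moreover have "(\<Sum>n. ?D ^ Suc n) = ?B * ?D"
    using suminf_mult2[OF s, of ?D] by (simp add: power_commutes)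
  ultimately show "A * ?B = 1" "?B * A = 1" by (simp_all add: algebra_simps)
qed

text \<open>Divided by a large \<open>M\<close>, the form of \<open>A\<close> lies between
  \<open>\<gamma> / M\<close> and 1. Hence \<open>1 - A / M\<close> has norm at most
  \<open>1 - \<gamma> / M\<close> and the Neumann series applies.\<close>

lemma posdef_inverse:
  assumes "posdef A"
  obtains B where "A * B = 1" "B * A = 1"
proof -
  obtain \<gamma> where \<gamma>: "\<gamma> > 0" "\<gamma> *\<^sub>R 1 \<preceq> A" and sa: "selfadjoint A"
    using assms by (auto simp: posdef_iff)
  define M where "M = norm A + \<gamma>"
  have M: "M > 0" "\<gamma> \<le> M" using \<gamma>(1) by (auto simp: M_def add_nonneg_pos)
  have "norm (1 - (1 / M) *\<^sub>R A) \<le> 1 - \<gamma> / M"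
  proof (rule norm_selfadjoint_le)
    show "0 \<le> 1 - \<gamma> / M" using M by simp
    fix v
    have 1: "\<gamma> * (norm v)\<^sup>2 \<le> inner v (A \<cdot> v)"
      using \<gamma>(2) by (simp add: loewner_le_def power2_norm_eq_inner)
    have "inner v (A \<cdot> v) \<le> norm A * (norm v)\<^sup>2"
      using inner_bop_le[of v A v] by (simp add: power2_eq_square mult_ac)
    also have "\<dots> \<le> M * (norm v)\<^sup>2" using \<gamma>(1) by (intro mult_right_mono) (auto simp: M_def)
    finally have 2: "inner v (A \<cdot> v) \<le> M * (norm v)\<^sup>2" .
    have "inner v (A \<cdot> v) / M \<le> (norm v)\<^sup>2"
      "\<gamma> * (norm v)\<^sup>2 / M \<le> inner v (A \<cdot> v) / M"
      using 1 2 M by (simp_all add: divide_right_mono pos_divide_le_eq mult.commute)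
    then show "\<bar>inner v ((1 - (1 / M) *\<^sub>R A) \<cdot> v)\<bar> \<le> (1 - \<gamma> / M) * (norm v)\<^sup>2"
      by (simp add: inner_diff_right power2_norm_eq_inner algebra_simps)
  qed (intro selfadjoint_diff selfadjoint_scaleR sa selfadjoint_one)
  also have "\<dots> < 1" using \<gamma>(1) M by simp
  finally obtain B where B: "(1 / M) *\<^sub>R A * B = 1" "B * ((1 / M) *\<^sub>R A) = 1"
    by (rule neumann_inverse)
  show thesis
    by (rule that[of "(1 / M) *\<^sub>R B"]) (use B in simp_all)
qed

text \<open>With \<open>w = Ui v\<close> and \<open>x = Xi v\<close>, expand
  \<open>0 \<le> <w - x, X (w - x)>\<close> and replace \<open>X\<close> by \<open>U\<close> in the
  term quadratic in \<open>w\<close>. No square root of an operator is involved; powers are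
  constructed only later.\<close>

lemma inverse_antitone:
  assumes "posdef X" "posdef U" "X \<preceq> U"
    and Xi: "X * Xi = 1" "Xi * X = 1" and Ui: "U * Ui = 1" "Ui * U = 1"
  shows "Ui \<preceq> Xi"
  unfolding loewner_le_def
proof
  fix v
  define w where "w = Ui \<cdot> v"
  define x where "x = Xi \<cdot> v"
  have Uw: "U \<cdot> w = v" using Ui(1) unfolding w_def by (metis one_bop.rep_eq times_bop.rep_eq)
  have Xx: "X \<cdot> x = v" using Xi(1) unfolding x_def by (metis one_bop.rep_eq times_bop.rep_eq)
  have "0 \<le> inner (w - x) (X \<cdot> (w - x))" by (rule posdef_pos[OF assms(1)])
  also have "\<dots> = inner w (X \<cdot> w) - 2 * inner w v + inner x v"
    using selfadjointD[OF posdef_selfadjoint[OF assms(1)], of x w]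
    by (simp add: inner_diff_left inner_diff_right Xx inner_commute)
  also have "\<dots> \<le> inner w (U \<cdot> w) - 2 * inner w v + inner x v"
    using assms(3) by (simp add: loewner_le_def)
  also have "\<dots> = inner v x - inner v w" by (simp add: Uw inner_commute)
  finally show "inner v (Ui \<cdot> v) \<le> inner v (Xi \<cdot> v)" by (simp add: w_def x_def)
qed

lemma posdef_mult_sq:
  assumes "selfadjoint A" and "c > 0" "\<And>v. norm (A \<cdot> v) \<ge> c * norm v"
  shows "posdef (A * A)"
  unfolding posdef_def Re_cinner
proof (intro conjI exI allI)
  show "c\<^sup>2 > 0" using assms(2) by simp
  fix v
  have "(c * norm v)\<^sup>2 \<le> (norm (A \<cdot> v))\<^sup>2" using assms by (intro power_mono) auto
  also have "\<dots> = inner v ((A * A) \<cdot> v)"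
    using selfadjointD[OF assms(1), of v "A \<cdot> v"] by (simp add: power2_norm_eq_inner)
  finally show "c\<^sup>2 * (norm v)\<^sup>2 \<le> inner v ((A * A) \<cdot> v)" by (simp add: power_mult_distrib)
qed (use assms selfadjoint_mult in auto)

lemma inverse_bounded_below:
  assumes "B * A = 1"
  obtains c where "c > 0" "\<And>v. norm (A \<cdot> v) \<ge> c * norm v"
proof
  have "B \<noteq> 0" using assms by auto
  then show "1 / norm B > 0" by simp
  fix v
  have "norm v \<le> norm B * norm (A \<cdot> v)"
    using norm_bop_apply[of B "A \<cdot> v"] assms by (metis one_bop.rep_eq times_bop.rep_eq)
  then show "norm (A \<cdot> v) \<ge> 1 / norm B * norm v"
    using \<open>B \<noteq> 0\<close> by (simp add: pos_divide_le_eq mult.commute)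
qed

text \<open>The left inverse \<open>T\<close> bounds \<open>S\<close> from below, so
  \<open>S * S \<succeq> \<delta>\<close> for some positive \<open>\<delta>\<close>, and the lower
  bound \<open>\<gamma>\<close> of \<open>A\<close> becomes
  \<open>\<gamma> * \<delta>\<close>.\<close>

lemma posdef_conj:
  assumes "posdef A" "selfadjoint S" "T * S = 1"
  shows "posdef (S * A * S)"
proof -
  obtain \<gamma> where \<gamma>: "\<gamma> > 0" "\<gamma> *\<^sub>R 1 \<preceq> A" and sa: "selfadjoint A"
    using assms by (auto simp: posdef_iff)
  obtain c where c: "c > 0" "\<And>v. norm (S \<cdot> v) \<ge> c * norm v"
    using inverse_bounded_below[OF assms(3)] by blast
  obtain \<delta> where d: "\<delta> > 0" "\<delta> *\<^sub>R 1 \<preceq> S * S"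
    using posdef_mult_sq[OF assms(2) c] by (auto simp: posdef_iff)
  have "(\<gamma> * \<delta>) *\<^sub>R 1 \<preceq> S * (\<gamma> *\<^sub>R 1) * S"
    using loewner_scaleR[OF d(2), of \<gamma>] \<gamma>(1) by simp
  also have "\<dots> \<preceq> S * A * S" by (rule loewner_conj[OF \<gamma>(2) assms(2)])
  finally have "(\<gamma> * \<delta>) *\<^sub>R 1 \<preceq> S * A * S" .
  moreover have "0 < \<gamma> * \<delta>" using \<gamma>(1) d(1) by simp
  ultimately show ?thesis unfolding posdef_iff using selfadjoint_conj[OF assms(2) sa] by blast
qed

section \<open>Functional calculus and real powers\<close>

lemma poly_op_eq_sum:
  assumes "degree q \<le> n"
  shows "poly_op q A = (\<Sum>i\<le>n. coeff q i *\<^sub>R A ^ i)"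
  unfolding poly_op_def
  by (rule sum.mono_neutral_left) (use assms in \<open>auto simp: coeff_eq_0\<close>)

lemma poly_op_pCons: "poly_op (pCons c q) A = c *\<^sub>R 1 + A * poly_op q A"
proof -
  have "poly_op (pCons c q) A = (\<Sum>i\<le>Suc (degree q). coeff (pCons c q) i *\<^sub>R A ^ i)"
    by (rule poly_op_eq_sum) (simp add: degree_pCons_le)
  also have "\<dots> = c *\<^sub>R 1 + (\<Sum>i\<le>degree q. coeff q i *\<^sub>R A ^ Suc i)"
    by (subst sum.atMost_Suc_shift) simp
  also have "(\<Sum>i\<le>degree q. coeff q i *\<^sub>R A ^ Suc i) = A * poly_op q A"
    by (simp add: poly_op_def sum_distrib_left)
  finally show ?thesis .
qed

lemma poly_op_0 [simp]: "poly_op 0 A = 0"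
  by (simp add: poly_op_def)

lemma poly_op_const [simp]: "poly_op [:c:] A = c *\<^sub>R 1"
  by (simp add: poly_op_pCons)

lemma poly_op_linear: "poly_op [:c, d:] A = c *\<^sub>R 1 + d *\<^sub>R A"
  by (simp add: poly_op_pCons)

lemma poly_op_add: "poly_op (p + q) A = poly_op p A + poly_op q A"
  by (subst (1 2 3) poly_op_eq_sum[where n = "max (degree p) (degree q)"])
    (auto simp: degree_add_le scaleR_left_distrib sum.distrib)

lemma poly_op_smult: "poly_op (smult c q) A = c *\<^sub>R poly_op q A"
  by (subst (1 2) poly_op_eq_sum[where n = "degree q"])
    (auto simp: scaleR_sum_right intro: degree_smult_le)

lemma poly_op_diff: "poly_op (p - q) A = poly_op p A - poly_op q A"
  using poly_op_add[of p "smult (-1) q" A] poly_op_smult[of "-1" q A] by simp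

lemma poly_op_mult: "poly_op (p * q) A = poly_op p A * poly_op q A"
  by (induction p) (simp_all add: poly_op_pCons poly_op_add poly_op_smult algebra_simps)

lemma poly_op_commute: "poly_op p A * poly_op q A = poly_op q A * poly_op p A"
  by (metis mult.commute poly_op_mult)

lemma selfadjoint_poly_op:
  assumes "selfadjoint A"
  shows "selfadjoint (poly_op q A)"
proof (induction q)
  case (pCons c q)
  have "A * poly_op q A = poly_op q A * A"
    using poly_op_commute[of "[:0, 1:]" A q] by (simp add: poly_op_linear)
  then show ?case
    unfolding poly_op_pCons
    by (intro selfadjoint_add selfadjoint_scaleR selfadjoint_mult selfadjoint_one assms pCons.IH)
qed simp

lemma invertible_op_mult: "invertible_op A \<Longrightarrow> invertible_op B \<Longrightarrow> invertible_op (A * B)"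
  unfolding invertible_op_def by (metis mult.assoc mult.right_neutral)

lemma invertible_op_posdef: "posdef A \<Longrightarrow> invertible_op A"
  unfolding invertible_op_def using posdef_inverse by blast

lemma invertible_op_scaleR:
  assumes "invertible_op A" "c \<noteq> 0"
  shows "invertible_op (c *\<^sub>R A)"
proof -
  obtain B where "A * B = 1" "B * A = 1" using assms by (auto simp: invertible_op_def)
  then show ?thesis unfolding invertible_op_def using assms(2)
    by (intro exI[of _ "(1 / c) *\<^sub>R B"]) simp
qed

definition real_spectrum :: "bop \<Rightarrow> real set"
  where "real_spectrum A = {x. complex_of_real x \<in> spectrum_op A}"

lemma real_spectrum_iff: "x \<in> real_spectrum A \<longleftrightarrow> \<not> invertible_op (A - x *\<^sub>R 1)"
proof -
  have "scaleC_bop (complex_of_real x) 1 = x *\<^sub>R 1"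
    by (rule bop_eqI) (simp add: scaleR_l2_def)
  then show ?thesis by (simp add: real_spectrum_def spectrum_op_def)
qed

section \<open>Zeros of real polynomials and the spectrum\<close>

lemma poly_map_poly_of_real_pCons:
  "poly (map_poly complex_of_real (pCons a p)) z
    = of_real a + z * poly (map_poly complex_of_real p) z"
  by (simp add: map_poly_pCons)

lemma poly_map_poly_of_real_of_real:
  "poly (map_poly complex_of_real p) (of_real x) = of_real (poly p x)"
  by (induction p) (simp_all add: poly_map_poly_of_real_pCons)

lemma poly_map_poly_of_real_add:
  "poly (map_poly complex_of_real (p + q)) z
    = poly (map_poly complex_of_real p) z + poly (map_poly complex_of_real q) z"
  by (induction p q rule: poly_induct2) (simp_all add: poly_map_poly_of_real_pCons algebra_simps)

lemma poly_map_poly_of_real_smult: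
  "poly (map_poly complex_of_real (smult a p)) z = of_real a * poly (map_poly complex_of_real p) z"
  by (induction p) (simp_all add: poly_map_poly_of_real_pCons algebra_simps)

lemma poly_map_poly_of_real_mult:
  "poly (map_poly complex_of_real (p * q)) z
    = poly (map_poly complex_of_real p) z * poly (map_poly complex_of_real q) z"
  by (induction p) (simp_all add: poly_map_poly_of_real_pCons poly_map_poly_of_real_add
      poly_map_poly_of_real_smult algebra_simps)

text \<open>The quadratic is \<open>(x - z)(x - cnj z)\<close>. Division leaves a real remainder
  \<open>u + v x\<close> that vanishes at \<open>z\<close>; as \<open>z\<close> is not real,
  \<open>v = 0\<close> and then \<open>u = 0\<close>.\<close>

lemma real_quadratic_dvd:
  fixes q :: "real poly"
  assumes z: "poly (map_poly complex_of_real q) z = 0" and "Im z \<noteq> 0"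
  shows "[:(cmod z)\<^sup>2, - 2 * Re z, 1:] dvd q"
proof -
  let ?Q = "[:(cmod z)\<^sup>2, - 2 * Re z, 1:]"
  have Qz: "poly (map_poly complex_of_real ?Q) z = 0"
    unfolding poly_map_poly_of_real_pCons
    by (simp add: complex_eq_iff cmod_power2) (simp add: power2_eq_square algebra_simps)
  have "degree (q mod ?Q) < 2"
    using degree_mod_less[of ?Q q] by auto
  then obtain u v where uv: "q mod ?Q = [:u, v:]"
    by (metis One_nat_def degree_eq_zeroE less_2_cases_iff degree1_coeffs pCons_0_0)
  have "poly (map_poly complex_of_real (q div ?Q * ?Q + q mod ?Q)) z = 0"
    using z by (simp only: div_mult_mod_eq)
  then have "of_real u + z * of_real v = 0"
    unfolding poly_map_poly_of_real_add poly_map_poly_of_real_mult Qz uv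
    by (simp add: poly_map_poly_of_real_pCons)
  then have "v = 0" "u = 0" using assms(2) by (auto simp: complex_eq_iff)
  then show ?thesis using uv by (simp add: mod_eq_0_iff_dvd)
qed

text \<open>Strong induction on the degree, splitting off one real factor at a complex zero
  \<open>z\<close>. For real \<open>z\<close> the linear factor is invertible because
  \<open>z\<close> is off the spectrum; otherwise the quadratic factor is
  \<open>(A - Re z)^2 + (Im z)^2\<close>, which is positive definite.\<close>

lemma invertible_poly_op:
  assumes A: "selfadjoint A" and "q \<noteq> 0" "\<And>x. x \<in> real_spectrum A \<Longrightarrow> poly q x \<noteq> 0"
  shows "invertible_op (poly_op q A)"
  using assms(2,3)
proof (induction "degree q" arbitrary: q rule: less_induct)
  case less
  show ?case
  proof (cases "degree q = 0")
    case True
    then obtain c where "q = [:c:]" by (metis degree_eq_zeroE)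
    moreover have "invertible_op 1" by (auto simp: invertible_op_def)
    ultimately show ?thesis using less.prems(1) by (simp add: invertible_op_scaleR)
  next
    case False
    let ?cq = "map_poly complex_of_real q"
    have "degree ?cq \<noteq> 0" using False by (simp add: degree_map_poly)
    then have "\<exists>z. poly ?cq z = 0"
      by (intro fundamental_theorem_of_algebra) (simp add: constant_degree)
    then obtain z where z: "poly ?cq z = 0" by blast
    obtain d where d: "d dvd q" "degree d > 0" "invertible_op (poly_op d A)"
    proof (cases "Im z = 0")
      case True
      then have "z = of_real (Re z)" by (simp add: complex_eq_iff)
      then have "complex_of_real (poly q (Re z)) = 0"
        using z by (metis poly_map_poly_of_real_of_real)
      then have root: "poly q (Re z) = 0" by simp
      then have "Re z \<notin> real_spectrum A" using less.prems by blast
      then have "invertible_op (poly_op [:- Re z, 1:] A)"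
        by (simp add: real_spectrum_iff poly_op_linear)
      then show ?thesis using root by (intro that[of "[:- Re z, 1:]"]) (auto simp: poly_eq_0_iff_dvd)
    next
      case False
      let ?Q = "[:(cmod z)\<^sup>2, - 2 * Re z, 1:]" and ?B = "A - Re z *\<^sub>R 1"
      have B: "selfadjoint ?B" using A by (intro selfadjoint_diff selfadjoint_scaleR) auto
      have "poly_op ?Q A = ?B * ?B + (Im z)\<^sup>2 *\<^sub>R 1"
        by (simp add: poly_op_pCons algebra_simps cmod_power2)
          (simp add: power2_eq_square scaleR_2 scaleR_add_right flip: scaleR_scaleR)
      moreover have "posdef (?B * ?B + (Im z)\<^sup>2 *\<^sub>R 1)"
        unfolding posdef_iff
      proof (intro conjI exI[of _ "(Im z)\<^sup>2"])
        have "0 \<le> inner v (?B \<cdot> ?B \<cdot> v)" for v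
          using selfadjointD[OF B, of v "?B \<cdot> v"] by (metis inner_ge_zero)
        then show "(Im z)\<^sup>2 *\<^sub>R 1 \<preceq> ?B * ?B + (Im z)\<^sup>2 *\<^sub>R 1"
          unfolding loewner_le_def by (simp only: bop_simps inner_add_right) simp
      qed (use B False in \<open>simp_all add: selfadjoint_add selfadjoint_mult selfadjoint_scaleR\<close>)
      ultimately have "invertible_op (poly_op ?Q A)" by (simp add: invertible_op_posdef)
      then show ?thesis using real_quadratic_dvd[OF z False] by (intro that[of ?Q]) auto
    qed
    then obtain r where r: "q = d * r" by (auto simp: dvd_def)
    then have "degree r < degree q" "r \<noteq> 0"
      using d(2) less.prems(1) by (auto simp: degree_mult_eq)
    then have "invertible_op (poly_op r A)"
      using less.prems(2) by (intro less.hyps) (auto simp: r)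
    then show ?thesis using d(3) by (simp add: r poly_op_mult invertible_op_mult)
  qed
qed

text \<open>Otherwise the product \<open>B * B - N^2\<close> with \<open>N = norm B\<close> would be
  invertible, hence bounded below by some \<open>c\<close>. But the squared norm of
  \<open>(B * B - N^2) v\<close> is at most \<open>N^2 (N^2 |v|^2 - |B v|^2)\<close>, so
  \<open>|B v| / |v|\<close> would stay away from \<open>N\<close>. It follows that the spectrum
  contains \<open>N\<close> or \<open>-N\<close>.\<close>

lemma norm_not_both_invertible:
  assumes B: "selfadjoint B"
  shows "\<not> (invertible_op (B - norm B *\<^sub>R 1) \<and> invertible_op (B - (- norm B) *\<^sub>R 1))"
proof
  let ?N = "norm B"
  assume "invertible_op (B - ?N *\<^sub>R 1) \<and> invertible_op (B - (- ?N) *\<^sub>R 1)"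
  then have "invertible_op ((B - ?N *\<^sub>R 1) * (B - (- ?N) *\<^sub>R 1))" by (intro invertible_op_mult) auto
  then obtain R where "R * ((B - ?N *\<^sub>R 1) * (B - (- ?N) *\<^sub>R 1)) = 1"
    by (auto simp: invertible_op_def)
  moreover have "(B - ?N *\<^sub>R 1) * (B - (- ?N) *\<^sub>R 1) = B * B - ?N\<^sup>2 *\<^sub>R 1"
    by (simp add: algebra_simps power2_eq_square)
  ultimately obtain c where c: "c > 0" "\<And>v. c * norm v \<le> norm ((B * B - ?N\<^sup>2 *\<^sub>R 1) \<cdot> v)"
    using inverse_bounded_below by metis
  have N0: "?N > 0"
  proof (rule ccontr)
    assume "\<not> ?N > 0"
    then have "B = 0" by simp
    then show False using c(2)[of "l2_unit 0"] c(1) by simp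
  qed
  \<comment> \<open>The first entry is the gap that the estimate yields; the second keeps the
    radicand below nonnegative, as a norm bound must be.\<close>
  define \<delta> where "\<delta> = min (c\<^sup>2 / ?N\<^sup>2) (?N\<^sup>2)"
  have \<delta>: "\<delta> > 0" "\<delta> \<le> c\<^sup>2 / ?N\<^sup>2" "\<delta> \<le> ?N\<^sup>2" using c(1) N0 by (auto simp: \<delta>_def)
  have "norm (B \<cdot> v) \<le> sqrt (?N\<^sup>2 - \<delta>) * norm v" for v
  proof -
    have "c\<^sup>2 * (norm v)\<^sup>2 \<le> (norm ((B * B - ?N\<^sup>2 *\<^sub>R 1) \<cdot> v))\<^sup>2"
      using c by (metis power_mono power_mult_distrib less_imp_le mult_nonneg_nonneg norm_ge_zero)
    also have "\<dots> = (norm (B \<cdot> B \<cdot> v))\<^sup>2 - 2 * ?N\<^sup>2 * (norm (B \<cdot> v))\<^sup>2 + ?N ^ 4 * (norm v)\<^sup>2"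
      using selfadjointD[OF B, of "B \<cdot> v" v]
      by (simp add: power2_norm_eq_inner inner_diff_left inner_diff_right inner_commute algebra_simps)
    also have "(norm (B \<cdot> B \<cdot> v))\<^sup>2 \<le> ?N\<^sup>2 * (norm (B \<cdot> v))\<^sup>2"
      using power_mono[OF norm_bop_apply[of B "B \<cdot> v"], of 2] by (simp add: power_mult_distrib)
    finally have "c\<^sup>2 * (norm v)\<^sup>2 \<le> ?N\<^sup>2 * (?N\<^sup>2 * (norm v)\<^sup>2 - (norm (B \<cdot> v))\<^sup>2)"
      by (simp add: algebra_simps power2_eq_square power4_eq_xxxx)
    then have "c\<^sup>2 / ?N\<^sup>2 * (norm v)\<^sup>2 \<le> ?N\<^sup>2 * (norm v)\<^sup>2 - (norm (B \<cdot> v))\<^sup>2"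
      using N0 by (simp add: pos_divide_le_eq mult.commute)
    moreover have "\<delta> * (norm v)\<^sup>2 \<le> c\<^sup>2 / ?N\<^sup>2 * (norm v)\<^sup>2" using \<delta>(2) by (intro mult_right_mono) auto
    ultimately have "(norm (B \<cdot> v))\<^sup>2 \<le> (?N\<^sup>2 - \<delta>) * (norm v)\<^sup>2" by (simp add: algebra_simps)
    then have "sqrt ((norm (B \<cdot> v))\<^sup>2) \<le> sqrt ((?N\<^sup>2 - \<delta>) * (norm v)\<^sup>2)" by (rule real_sqrt_le_mono)
    then show ?thesis by (simp add: real_sqrt_mult)
  qed
  then have "?N \<le> sqrt (?N\<^sup>2 - \<delta>)" using \<delta>(3) by (intro norm_bop_le) auto
  also have "\<dots> < sqrt (?N\<^sup>2)" using \<delta>(1) by (intro real_sqrt_less_mono) simp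
  finally show False by simp
qed

section \<open>Monotonicity of the square root\<close>

lemma posdef_one: "posdef 1"
  unfolding posdef_iff by (auto intro!: exI[of _ 1])

lemma loewner_scaleR_mono:
  assumes "posdef A" "r \<le> q"
  shows "r *\<^sub>R A \<preceq> q *\<^sub>R A"
  using posdef_pos[OF assms(1)] assms(2) by (simp add: loewner_le_def mult_right_mono)

text \<open>\<open>A * A\<close> is positive definite and so has an inverse \<open>B\<close>. It
  commutes with \<open>A\<close>, and \<open>A * B\<close> inverts \<open>A\<close> from both
  sides.\<close>

lemma invertible_op_bounded_below:
  assumes "selfadjoint A" "c > 0" "\<And>v. c * norm v \<le> norm (A \<cdot> v)"
  shows "invertible_op A"
proof -
  obtain B where B: "A * A * B = 1" "B * (A * A) = 1"
    using posdef_inverse[OF posdef_mult_sq[OF assms]] by blast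
  have "A * B = B * (A * A) * (A * B)" using B(2) by simp
  also have "\<dots> = B * A * (A * A * B)" by (simp only: mult.assoc)
  finally have "A * B = B * A" using B(1) by simp
  then have "A * (A * B) = 1" "A * B * A = 1" using B by (simp_all add: mult.assoc)
  then show ?thesis unfolding invertible_op_def by blast
qed

text \<open>
  For \<open>D = Q - P\<close> the hypothesis says that \<open>Q D + D Q \<ge> D\<^sup>2\<close>. This makes \<open>D + c\<close> bounded
  below for every \<open>c > 0\<close>, so \<open>D\<close> has no negative spectrum.
\<close>

lemma loewner_sqrt_mono:
  assumes P: "selfadjoint P" and Q: "posdef Q" and le: "P * P \<preceq> Q * Q"
  shows "P \<preceq> Q"
proof -
  have saQ: "selfadjoint Q" by (rule posdef_selfadjoint[OF Q])
  obtain \<gamma> where \<gamma>: "\<gamma> > 0" "\<And>v. \<gamma> * (norm v)\<^sup>2 \<le> inner v (Q \<cdot> v)"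
    using Q by (auto simp: posdef_def Re_cinner)
  define D where "D = Q - P"
  have D: "selfadjoint D" using P saQ by (simp add: D_def selfadjoint_diff)
  have pos: "0 \<le> inner (Q \<cdot> v) (D \<cdot> v)" for v
  proof -
    have PQ: "P = Q - D" by (simp add: D_def)
    have "0 \<le> inner v ((Q * Q) \<cdot> v) - inner v ((P * P) \<cdot> v)" using le by (simp add: loewner_le_def)
    also have "\<dots> = inner (Q \<cdot> v) (Q \<cdot> v) - inner (P \<cdot> v) (P \<cdot> v)"
      using selfadjointD[OF P, of v "P \<cdot> v"] selfadjointD[OF saQ, of v "Q \<cdot> v"] by simp
    also have "\<dots> = 2 * inner (Q \<cdot> v) (D \<cdot> v) - inner (D \<cdot> v) (D \<cdot> v)"
      unfolding PQ by (simp add: inner_diff_left inner_diff_right inner_commute)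
    also have "\<dots> \<le> 2 * inner (Q \<cdot> v) (D \<cdot> v)" by simp
    finally show ?thesis by simp
  qed
  have inv: "invertible_op (D + c *\<^sub>R 1)" if c: "c > 0" for c
  proof (rule invertible_op_bounded_below)
    let ?E = "D + c *\<^sub>R 1" and ?K = "norm Q + 1"
    have K: "?K > 0" by (simp add: add_nonneg_pos)
    show "selfadjoint ?E" using D by (intro selfadjoint_add selfadjoint_scaleR) auto
    show "0 < c * \<gamma> / ?K" using c \<gamma>(1) K by simp
    fix v
    have "c * (\<gamma> * (norm v)\<^sup>2) \<le> c * inner v (Q \<cdot> v)"
      using \<gamma>(2) c by (intro mult_left_mono) auto
    also have "\<dots> \<le> inner (Q \<cdot> v) (?E \<cdot> v)"
      using pos[of v] by (simp add: inner_add_right inner_commute)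
    also have "\<dots> \<le> norm (Q \<cdot> v) * norm (?E \<cdot> v)" by (rule norm_cauchy_schwarz)
    also have "\<dots> \<le> ?K * norm v * norm (?E \<cdot> v)"
      using norm_bop_apply[of Q v] by (intro mult_right_mono) (auto simp: distrib_right intro: add_increasing2)
    finally have "norm v * (c * \<gamma> * norm v) \<le> norm v * (?K * norm (?E \<cdot> v))"
      by (simp add: power2_eq_square mult_ac)
    then have "c * \<gamma> * norm v \<le> ?K * norm (?E \<cdot> v)" using K by (cases "v = 0") auto
    then show "c * \<gamma> / ?K * norm v \<le> norm (?E \<cdot> v)" using K by (simp add: pos_divide_le_eq mult.commute)
  qed
  \<comment> \<open>Passing from invertibility of all \<open>D + c\<close> to
    \<open>0 \<preceq> D\<close>: by construction \<open>F\<close> is nonnegative, so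
    \<open>- norm F\<close> is no spectral value; if \<open>norm F > norm D\<close>, then
    \<open>norm F\<close> is none either, because \<open>F - norm F\<close> is
    \<open>-(D + c)\<close> with \<open>c > 0\<close>. Hence \<open>norm F \<le> norm D\<close>,
    which bounds \<open>F\<close> by \<open>norm D\<close>.\<close>
  define F where "F = norm D *\<^sub>R 1 - D"
  have F: "selfadjoint F" using D by (simp add: F_def selfadjoint_diff selfadjoint_scaleR)
  have "norm F \<le> norm D"
  proof (rule ccontr)
    assume less: "\<not> norm F \<le> norm D"
    have eq: "F - norm F *\<^sub>R 1 = (-1) *\<^sub>R (D + (norm F - norm D) *\<^sub>R 1)"
      by (simp add: F_def algebra_simps)
    have "invertible_op (F - norm F *\<^sub>R 1)"
      unfolding eq using less by (intro invertible_op_scaleR inv) auto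
    moreover have "invertible_op (F - (- norm F) *\<^sub>R 1)"
    proof (rule invertible_op_posdef, unfold posdef_iff, intro conjI exI)
      show "0 < norm F" using less norm_ge_zero[of D] by linarith
      show "norm F *\<^sub>R 1 \<preceq> F - (- norm F) *\<^sub>R 1"
        using loewner_le_norm[of D] by (simp add: loewner_le_def F_def inner_diff_right inner_add_right)
    qed (intro selfadjoint_diff selfadjoint_scaleR F selfadjoint_one)
    ultimately show False using norm_not_both_invertible[OF F] by blast
  qed
  then have "F \<preceq> norm D *\<^sub>R 1"
    by (rule loewner_trans[OF loewner_le_norm loewner_scaleR_mono[OF posdef_one]])
  then show ?thesis by (simp add: loewner_le_def F_def D_def inner_diff_right)
qed

section \<open>Existence and uniqueness in the functional calculus\<close>

lemma real_spectrum_nonempty: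
  assumes A: "selfadjoint A"
  shows "real_spectrum A \<noteq> {}"
  using norm_not_both_invertible[OF assms] real_spectrum_iff by blast

text \<open>Plus or minus the norm of \<open>q(A)\<close> is a spectral value \<open>c\<close> of
  \<open>q(A)\<close>, so \<open>q - c\<close> must vanish somewhere on the spectrum of
  \<open>A\<close>. If \<open>q - c\<close> is the zero polynomial, any point of the nonempty
  spectrum will do.\<close>

lemma norm_poly_op_attained:
  assumes A: "selfadjoint A"
  obtains x where "x \<in> real_spectrum A" "\<bar>poly q x\<bar> = norm (poly_op q A)"
proof -
  let ?N = "norm (poly_op q A)"
  obtain c where c: "\<bar>c\<bar> = ?N" "\<not> invertible_op (poly_op q A - c *\<^sub>R 1)"
    using norm_not_both_invertible[OF selfadjoint_poly_op[OF A, of q]]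
    by (metis abs_minus_cancel abs_norm_cancel)
  then have ni: "\<not> invertible_op (poly_op (q - [:c:]) A)" by (simp add: poly_op_diff)
  show thesis
  proof (cases "q - [:c:] = 0")
    case True
    then have "q = [:c:]" by simp
    then show thesis using real_spectrum_nonempty[OF A] c(1) that by auto
  next
    case False
    then obtain x where "x \<in> real_spectrum A" "poly (q - [:c:]) x = 0"
      using invertible_poly_op[OF A False] ni by blast
    then show thesis using c(1) by (intro that[of x]) auto
  qed
qed


text \<open>Justifies the definite description in \<open>fun_calc\<close>: two approximating
  sequences come uniformly close on the spectrum, so by \<open>norm_poly_op_attained\<close> their
  operators come close in norm.\<close>

lemma fun_calc_eqI:
  assumes A: "selfadjoint A"
    and q: "uniform_limit (real_spectrum A) (\<lambda>n. poly (q n)) f sequentially"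
      "(\<lambda>n. poly_op (q n) A) \<longlonglongrightarrow> B"
  shows "fun_calc f A = B"
  unfolding fun_calc_def real_spectrum_def[symmetric]
proof (rule the_equality)
  show "\<exists>q. uniform_limit (real_spectrum A) (\<lambda>n. poly (q n)) f sequentially \<and>
      (\<lambda>n. poly_op (q n) A) \<longlonglongrightarrow> B" using q by blast
next
  fix C
  assume "\<exists>r. uniform_limit (real_spectrum A) (\<lambda>n. poly (r n)) f sequentially \<and>
      (\<lambda>n. poly_op (r n) A) \<longlonglongrightarrow> C"
  then obtain r where r: "uniform_limit (real_spectrum A) (\<lambda>n. poly (r n)) f sequentially"
      "(\<lambda>n. poly_op (r n) A) \<longlonglongrightarrow> C" by blast
  have "(\<lambda>n. poly_op (r n) A - poly_op (q n) A) \<longlonglongrightarrow> 0"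
  proof (rule LIMSEQ_I)
    fix e :: real assume e: "0 < e"
    have "\<forall>\<^sub>F n in sequentially. norm (poly_op (r n) A - poly_op (q n) A) < e"
      using uniform_limitD[OF q(1) half_gt_zero[OF e]] uniform_limitD[OF r(1) half_gt_zero[OF e]]
    proof eventually_elim
      case (elim n)
      obtain x where x: "x \<in> real_spectrum A"
        "\<bar>poly (r n - q n) x\<bar> = norm (poly_op (r n - q n) A)"
        using norm_poly_op_attained[OF A] by blast
      have "\<bar>poly (r n) x - poly (q n) x\<bar> < e"
        using elim(1)[rule_format, OF x(1)] elim(2)[rule_format, OF x(1)]
        unfolding dist_real_def by linarith
      then show ?case using x(2) by (simp add: poly_op_diff)
    qed
    then show "\<exists>N. \<forall>n\<ge>N. norm (poly_op (r n) A - poly_op (q n) A - 0) < e"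
      by (simp add: eventually_sequentially)
  qed
  then have "C - B = 0" using tendsto_diff[OF r(2) q(2)] LIMSEQ_unique by blast
  then show "C = B" by simp
qed

text \<open>An interval around the spectrum, expressed by order bounds: these are read off from
  positive definiteness, can be widened freely, and allow Weierstrass approximation on
  \<open>{m..M}\<close>.\<close>

definition spec_within :: "real \<Rightarrow> real \<Rightarrow> bop \<Rightarrow> bool"
  where "spec_within m M A \<longleftrightarrow> selfadjoint A \<and> m *\<^sub>R 1 \<preceq> A \<and> A \<preceq> M *\<^sub>R 1"

lemma real_spectrum_subset:
  assumes "spec_within m M A"
  shows "real_spectrum A \<subseteq> {m..M}"
proof
  fix x assume x: "x \<in> real_spectrum A"
  have A: "selfadjoint A" "m *\<^sub>R 1 \<preceq> A" "A \<preceq> M *\<^sub>R 1" using assms by (auto simp: spec_within_def)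
  have "\<not> x < m"
  proof
    assume "x < m"
    have "(m - x) *\<^sub>R 1 \<preceq> A - x *\<^sub>R 1"
      using A(2) by (simp add: loewner_le_def inner_diff_right algebra_simps)
    moreover have "selfadjoint (A - x *\<^sub>R 1)"
      using A(1) by (intro selfadjoint_diff selfadjoint_scaleR) auto
    ultimately have "posdef (A - x *\<^sub>R 1)" using \<open>x < m\<close> unfolding posdef_iff by (metis diff_gt_0_iff_gt)
    then show False using x invertible_op_posdef by (simp add: real_spectrum_iff)
  qed
  moreover have "\<not> x > M"
  proof
    assume "x > M"
    have "(x - M) *\<^sub>R 1 \<preceq> x *\<^sub>R 1 - A"
      using A(3) by (simp add: loewner_le_def inner_diff_right algebra_simps)
    moreover have "selfadjoint (x *\<^sub>R 1 - A)"
      using A(1) by (intro selfadjoint_diff selfadjoint_scaleR) auto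
    ultimately have "posdef (x *\<^sub>R 1 - A)" using \<open>x > M\<close> unfolding posdef_iff by (metis diff_gt_0_iff_gt)
    then have "invertible_op ((-1) *\<^sub>R (x *\<^sub>R 1 - A))"
      by (intro invertible_op_scaleR invertible_op_posdef) auto
    then show False using x by (simp add: real_spectrum_iff)
  qed
  ultimately show "x \<in> {m..M}" by simp
qed

lemma norm_poly_op_le:
  assumes "spec_within m M A" "\<And>x. x \<in> {m..M} \<Longrightarrow> \<bar>poly q x\<bar> \<le> c"
  shows "norm (poly_op q A) \<le> c"
proof -
  have "selfadjoint A" using assms(1) by (simp add: spec_within_def)
  then obtain x where "x \<in> real_spectrum A" "\<bar>poly q x\<bar> = norm (poly_op q A)"
    by (rule norm_poly_op_attained)
  then show ?thesis using assms(2) real_spectrum_subset[OF assms(1)] by fastforce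
qed

text \<open>The condition inside \<open>fun_calc\<close> with the spectrum replaced by a set
  \<open>I\<close>. Algebraic rules are proved for this relation, where approximating polynomials
  can be combined, and reach \<open>fun_calc\<close> through \<open>fun_calc_eq\<close>.\<close>

definition fun_calc_rel :: "bop \<Rightarrow> real set \<Rightarrow> (real \<Rightarrow> real) \<Rightarrow> bop \<Rightarrow> bool"
  where "fun_calc_rel A I f B \<longleftrightarrow> (\<exists>q. uniform_limit I (\<lambda>n. poly (q n)) f sequentially \<and>
    (\<lambda>n. poly_op (q n) A) \<longlonglongrightarrow> B)"

lemma fun_calc_eq:
  assumes "spec_within m M A" "fun_calc_rel A {m..M} f B"
  shows "fun_calc f A = B"
  using assms real_spectrum_subset[OF assms(1)]
  by (auto simp: fun_calc_rel_def spec_within_def intro: fun_calc_eqI uniform_limit_on_subset)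

lemma uniform_limit_inverse_Suc:
  assumes "\<And>n x. x \<in> S \<Longrightarrow> dist (f n x) (g x) < inverse (real (Suc n))"
  shows "uniform_limit S f g sequentially"
proof (rule uniform_limitI)
  fix e :: real assume "e > 0"
  then obtain N where N: "inverse (real (Suc N)) < e" using reals_Archimedean by blast
  show "\<forall>\<^sub>F n in sequentially. \<forall>x\<in>S. dist (f n x) (g x) < e"
  proof (rule eventually_sequentiallyI[of N], intro ballI)
    fix n x assume "N \<le> n" "x \<in> S"
    have "inverse (real (Suc n)) \<le> inverse (real (Suc N))" using \<open>N \<le> n\<close> by (simp add: field_simps)
    then show "dist (f n x) (g x) < e" using assms[OF \<open>x \<in> S\<close>, of n] N by linarith
  qed
qed

lemma weierstrass_poly:
  fixes f :: "real \<Rightarrow> real"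
  assumes "continuous_on {m..M} f"
  obtains q :: "nat \<Rightarrow> real poly" where "uniform_limit {m..M} (\<lambda>n. poly (q n)) f sequentially"
proof -
  have "\<exists>q. \<forall>x\<in>{m..M}. \<bar>f x - poly q x\<bar> < e" if e: "e > 0" for e
  proof -
    obtain g where g: "real_polynomial_function g" "\<And>x. x \<in> {m..M} \<Longrightarrow> \<bar>f x - g x\<bar> < e"
      using Stone_Weierstrass_real_polynomial_function[OF compact_Icc assms e] by blast
    obtain a n where "g = (\<lambda>x. \<Sum>i\<le>n. a i * x ^ i)"
      using g(1) real_polynomial_function_iff_sum by blast
    then have "g x = poly (\<Sum>i\<le>n. monom (a i) i) x" for x by (simp add: poly_sum poly_monom)
    then show ?thesis using g(2) by metis
  qed
  then have "\<forall>n. \<exists>q. \<forall>x\<in>{m..M}. \<bar>f x - poly q x\<bar> < inverse (real (Suc n))" by simp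
  then obtain q where q: "\<And>n x. x \<in> {m..M} \<Longrightarrow> \<bar>f x - poly (q n) x\<bar> < inverse (real (Suc n))"
    by metis
  have "uniform_limit {m..M} (\<lambda>n. poly (q n)) f sequentially"
    using q by (intro uniform_limit_inverse_Suc) (simp add: dist_real_def abs_minus_commute)
  then show thesis by (rule that)
qed

lemma fun_calc_rel_exists:
  assumes A: "spec_within m M A" and f: "continuous_on {m..M} f"
  shows "fun_calc_rel A {m..M} f (fun_calc f A)"
proof -
  obtain q where q: "uniform_limit {m..M} (\<lambda>n. poly (q n)) f sequentially"
    using weierstrass_poly[OF f] .
  have "Cauchy (\<lambda>n. poly_op (q n) A)"
  proof (rule metric_CauchyI)
    fix e :: real assume e: "e > 0"
    obtain N where N: "\<And>n x. n \<ge> N \<Longrightarrow> x \<in> {m..M} \<Longrightarrow> dist (poly (q n) x) (f x) < e / 3"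
      using uniform_limitD[OF q, of "e / 3"] e unfolding eventually_sequentially
      by (meson divide_pos_pos zero_less_numeral)
    have "dist (poly_op (q k) A) (poly_op (q n) A) < e" if "k \<ge> N" "n \<ge> N" for k n
    proof -
      have "norm (poly_op (q k - q n) A) \<le> 2 * e / 3"
      proof (rule norm_poly_op_le[OF A])
        fix x assume "x \<in> {m..M}"
        then show "\<bar>poly (q k - q n) x\<bar> \<le> 2 * e / 3"
          using N[OF that(1), of x] N[OF that(2), of x] unfolding dist_real_def poly_diff by linarith
      qed
      then show ?thesis using e by (simp add: dist_norm poly_op_diff)
    qed
    then show "\<exists>N. \<forall>k\<ge>N. \<forall>n\<ge>N. dist (poly_op (q k) A) (poly_op (q n) A) < e" by blast
  qed
  then obtain B where "(\<lambda>n. poly_op (q n) A) \<longlonglongrightarrow> B"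
    using Cauchy_convergent_iff convergent_def by blast
  then have "fun_calc_rel A {m..M} f B" using q by (auto simp: fun_calc_rel_def)
  then show ?thesis using fun_calc_eq[OF A] by blast
qed

lemma fun_calc_rel_norm_le:
  assumes A: "spec_within m M A" and "fun_calc_rel A {m..M} f B"
    and f: "\<And>x. x \<in> {m..M} \<Longrightarrow> \<bar>f x\<bar> \<le> c"
  shows "norm B \<le> c"
proof -
  obtain q where q: "uniform_limit {m..M} (\<lambda>n. poly (q n)) f sequentially"
    "(\<lambda>n. poly_op (q n) A) \<longlonglongrightarrow> B"
    using assms(2) by (auto simp: fun_calc_rel_def)
  show ?thesis
  proof (rule field_le_epsilon)
    fix e :: real assume e: "e > 0"
    have "\<forall>\<^sub>F n in sequentially. norm (poly_op (q n) A) \<le> c + e"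
      using uniform_limitD[OF q(1) e]
    proof eventually_elim
      case (elim n)
      show ?case
      proof (rule norm_poly_op_le[OF A])
        fix x assume "x \<in> {m..M}"
        then show "\<bar>poly (q n) x\<bar> \<le> c + e"
          using elim f[of x] unfolding dist_real_def by fastforce
      qed
    qed
    then show "norm B \<le> c + e"
      by (rule tendsto_upperbound[OF tendsto_norm[OF q(2)]]) simp
  qed
qed

lemma fun_calc_rel_mult:
  assumes "fun_calc_rel A {m..M} f B" "fun_calc_rel A {m..M} g C"
    and "continuous_on {m..M} f" "continuous_on {m..M} g"
  shows "fun_calc_rel A {m..M} (\<lambda>x. f x * g x) (B * C)"
proof -
  obtain q r where q: "uniform_limit {m..M} (\<lambda>n. poly (q n)) f sequentially"
      "(\<lambda>n. poly_op (q n) A) \<longlonglongrightarrow> B"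
    and r: "uniform_limit {m..M} (\<lambda>n. poly (r n)) g sequentially"
      "(\<lambda>n. poly_op (r n) A) \<longlonglongrightarrow> C"
    using assms(1,2) by (auto simp: fun_calc_rel_def)
  have "uniform_limit {m..M} (\<lambda>n x. poly (q n) x * poly (r n) x) (\<lambda>x. f x * g x) sequentially"
    using assms(3,4) q(1) r(1)
    by (intro uniform_lim_mult compact_imp_bounded compact_continuous_image) auto
  moreover have "(\<lambda>n. poly_op (q n * r n) A) \<longlonglongrightarrow> B * C"
    unfolding poly_op_mult by (intro tendsto_mult q r)
  moreover have "(\<lambda>n. poly (q n * r n)) = (\<lambda>n x. poly (q n) x * poly (r n) x)"
    by (simp add: fun_eq_iff)
  ultimately show ?thesis unfolding fun_calc_rel_def by (metis (no_types))
qed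

lemma fun_calc_rel_diff:
  assumes "fun_calc_rel A I f B" "fun_calc_rel A I g C"
  shows "fun_calc_rel A I (\<lambda>x. f x - g x) (B - C)"
proof -
  obtain q r where q: "uniform_limit I (\<lambda>n. poly (q n)) f sequentially"
      "(\<lambda>n. poly_op (q n) A) \<longlonglongrightarrow> B"
    and r: "uniform_limit I (\<lambda>n. poly (r n)) g sequentially"
      "(\<lambda>n. poly_op (r n) A) \<longlonglongrightarrow> C"
    using assms by (auto simp: fun_calc_rel_def)
  have "uniform_limit I (\<lambda>n x. poly (q n) x - poly (r n) x) (\<lambda>x. f x - g x) sequentially"
    by (intro uniform_limit_intros q r)
  moreover have "(\<lambda>n. poly_op (q n - r n) A) \<longlonglongrightarrow> B - C"
    unfolding poly_op_diff by (intro tendsto_diff q r)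
  moreover have "(\<lambda>n. poly (q n - r n)) = (\<lambda>n x. poly (q n) x - poly (r n) x)"
    by (simp add: fun_eq_iff)
  ultimately show ?thesis unfolding fun_calc_rel_def by (metis (no_types))
qed

lemma fun_calc_rel_cong:
  assumes "fun_calc_rel A I f B" "\<And>x. x \<in> I \<Longrightarrow> f x = g x"
  shows "fun_calc_rel A I g B"
  using assms uniform_limit_cong'[of I _ _ f g] unfolding fun_calc_rel_def by metis

lemma fun_calc_rel_poly: "fun_calc_rel A I (poly q) (poly_op q A)"
  unfolding fun_calc_rel_def by (intro exI[of _ "\<lambda>_. q"]) (simp add: uniform_limit_const)

lemma fun_calc_rel_selfadjoint:
  "selfadjoint A \<Longrightarrow> fun_calc_rel A I f B \<Longrightarrow> selfadjoint B"
  unfolding fun_calc_rel_def using selfadjoint_poly_op selfadjoint_limit by blast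

section \<open>Real powers of positive definite operators\<close>

lemma posdef_spec_within:
  assumes "posdef A"
  obtains m M where "0 < m" "m \<le> M" "spec_within m M A"
proof -
  obtain m where m: "m > 0" "m *\<^sub>R 1 \<preceq> A" and A: "selfadjoint A"
    using assms by (auto simp: posdef_iff)
  have "A \<preceq> max m (norm A) *\<^sub>R 1"
    unfolding loewner_le_def
  proof
    fix v :: l2
    have "norm A * (norm v)\<^sup>2 \<le> max m (norm A) * (norm v)\<^sup>2" by (intro mult_right_mono) auto
    then show "inner v (A \<cdot> v) \<le> inner v ((max m (norm A) *\<^sub>R 1) \<cdot> v)"
      using loewner_le_norm[of A] by (auto simp: loewner_le_def power2_norm_eq_inner intro: order_trans)
  qed
  then show thesis using m A by (intro that[of m "max m (norm A)"]) (auto simp: spec_within_def)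
qed

lemma powr_op_rel:
  assumes "0 < m" "spec_within m M A"
  shows "fun_calc_rel A {m..M} (\<lambda>x. x powr s) (powr_op A s)"
  unfolding powr_op_def using assms by (intro fun_calc_rel_exists continuous_intros) auto

lemma powr_op_add:
  assumes "posdef A"
  shows "powr_op A s * powr_op A t = powr_op A (s + t)"
proof -
  obtain m M where m: "0 < m" "spec_within m M A" using posdef_spec_within[OF assms] by metis
  have "fun_calc_rel A {m..M} (\<lambda>x. x powr s * x powr t) (powr_op A s * powr_op A t)"
    using m by (intro fun_calc_rel_mult powr_op_rel continuous_intros) auto
  then have "fun_calc_rel A {m..M} (\<lambda>x. x powr (s + t)) (powr_op A s * powr_op A t)"
    by (rule fun_calc_rel_cong) (simp add: powr_add)
  then show ?thesis using fun_calc_eq[OF m(2)] by (simp add: powr_op_def)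
qed

lemma powr_op_0: assumes "posdef A" shows "powr_op A 0 = 1"
proof -
  obtain m M where m: "0 < m" "spec_within m M A" using posdef_spec_within[OF assms] by metis
  have "fun_calc_rel A {m..M} (\<lambda>x. x powr 0) (poly_op [:1:] A)"
    using fun_calc_rel_poly by (rule fun_calc_rel_cong) (use m in auto)
  then show ?thesis using fun_calc_eq[OF m(2)] by (simp add: powr_op_def)
qed

lemma powr_op_1: assumes "posdef A" shows "powr_op A 1 = A"
proof -
  obtain m M where m: "0 < m" "spec_within m M A" using posdef_spec_within[OF assms] by metis
  have "fun_calc_rel A {m..M} (\<lambda>x. x powr 1) (poly_op [:0, 1:] A)"
    using fun_calc_rel_poly by (rule fun_calc_rel_cong) (use m in auto)
  then show ?thesis using fun_calc_eq[OF m(2)] by (simp add: powr_op_def poly_op_linear)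
qed

lemma spec_within_one: "spec_within 1 1 1"
  by (simp add: spec_within_def)

lemma powr_op_one [simp]: "powr_op 1 s = 1"
proof -
  have "fun_calc_rel 1 {1..1} (\<lambda>x. x powr s) (poly_op [:1:] 1)"
    using fun_calc_rel_poly by (rule fun_calc_rel_cong) auto
  then show ?thesis using fun_calc_eq[OF spec_within_one] by (simp add: powr_op_def)
qed

lemma selfadjoint_powr_op: assumes "posdef A" shows "selfadjoint (powr_op A s)"
proof -
  obtain m M where m: "0 < m" "spec_within m M A" using posdef_spec_within[OF assms] by metis
  then show ?thesis using fun_calc_rel_selfadjoint[OF _ powr_op_rel[OF m]] by (simp add: spec_within_def)
qed

lemma powr_op_cancel:
  assumes "posdef A"
  shows "powr_op A s * powr_op A (- s) = 1" "powr_op A (- s) * powr_op A s = 1"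
  using assms by (simp_all add: powr_op_add powr_op_0)

lemma posdef_powr_op: assumes "posdef A" shows "posdef (powr_op A s)"
proof -
  have "posdef (powr_op A (s / 2) * 1 * powr_op A (s / 2))"
    by (rule posdef_conj[OF posdef_one selfadjoint_powr_op[OF assms] powr_op_cancel(2)[OF assms]])
  then show ?thesis using assms by (simp add: powr_op_add)
qed

text \<open>Since \<open>A^t = A^s A^(t - s)\<close>, only exponents near 0 matter, and there
  \<open>|x^h - 1| \<le> exp (|h| L) - 1\<close> uniformly on \<open>{m..M}\<close>, where
  \<open>L\<close> bounds \<open>|ln x|\<close>.\<close>

lemma powr_op_tendsto:
  assumes A: "posdef A" and t: "t \<longlonglongrightarrow> s"
  shows "(\<lambda>n. powr_op A (t n)) \<longlonglongrightarrow> powr_op A s"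
proof -
  obtain m M where m: "0 < m" "m \<le> M" "spec_within m M A" using posdef_spec_within[OF A] by metis
  define L where "L = max \<bar>ln m\<bar> \<bar>ln M\<bar>"
  have bound: "norm (powr_op A h - 1) \<le> exp (\<bar>h\<bar> * L) - 1" for h
  proof (rule fun_calc_rel_norm_le[OF m(3)])
    show "fun_calc_rel A {m..M} (\<lambda>x. x powr h - 1) (powr_op A h - 1)"
      using fun_calc_rel_diff[OF powr_op_rel[OF m(1,3)] fun_calc_rel_poly[of A _ "[:1:]"]] by simp
    fix x assume x: "x \<in> {m..M}"
    then have "ln m \<le> ln x" "ln x \<le> ln M" using m(1) by auto
    then have "\<bar>ln x\<bar> \<le> L" by (auto simp: L_def)
    then have "\<bar>h * ln x\<bar> \<le> \<bar>h\<bar> * L" unfolding abs_mult by (intro mult_left_mono) auto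
    moreover have "\<bar>exp u - 1\<bar> \<le> exp \<bar>u\<bar> - 1" for u :: real
    proof (cases "u \<ge> 0")
      case False
      have "0 \<le> (exp u - 1)\<^sup>2" by simp
      \<comment> \<open>For negative \<open>u\<close> the claim is exactly this inequality.\<close>
      then have "2 \<le> exp u + exp (- u)"
        using exp_gt_zero[of u] by (simp add: exp_minus power2_eq_square field_simps)
      then show ?thesis using False by (simp add: abs_if)
    qed simp
    ultimately show "\<bar>x powr h - 1\<bar> \<le> exp (\<bar>h\<bar> * L) - 1"
      using x m(1) unfolding powr_def by (smt (verit) atLeastAtMost_iff exp_le_cancel_iff)
  qed
  have "(\<lambda>n. powr_op A (t n - s) - 1) \<longlonglongrightarrow> 0"
  proof (rule Lim_null_comparison[OF always_eventually])
    show "\<forall>n. norm (powr_op A (t n - s) - 1) \<le> exp (\<bar>t n - s\<bar> * L) - 1" using bound by blast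
    have "(\<lambda>n. exp (\<bar>t n - s\<bar> * L) - 1) \<longlonglongrightarrow> exp (\<bar>s - s\<bar> * L) - 1"
      by (intro tendsto_intros t)
    then show "(\<lambda>n. exp (\<bar>t n - s\<bar> * L) - 1) \<longlonglongrightarrow> 0" by simp
  qed
  then have "(\<lambda>n. powr_op A s * (powr_op A (t n - s) - 1) + powr_op A s) \<longlonglongrightarrow> powr_op A s * 0 + powr_op A s"
    by (intro tendsto_intros)
  then show ?thesis using A by (simp add: algebra_simps powr_op_add)
qed


section \<open>Weighted geometric means\<close>

lemma powr_op_inverse:
  assumes "posdef X"
  shows "X * powr_op X (-1) = 1" "powr_op X (-1) * X = 1"
  using powr_op_cancel[OF assms, of 1] by (simp_all add: powr_op_1 assms)

lemma powr_op_inverse_eqI: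
  assumes "posdef X" "X * Y = 1"
  shows "powr_op X (-1) = Y"
  by (metis assms mult.assoc mult.left_neutral mult.right_neutral powr_op_inverse(2))

lemma powr_op_half_sq:
  assumes "posdef X"
  shows "powr_op X (1/2) * powr_op X (1/2) = X" "powr_op X (-1/2) * powr_op X (-1/2) = powr_op X (-1)"
    "powr_op X (1/2) * powr_op X (-1/2) = 1" "powr_op X (-1/2) * powr_op X (1/2) = 1"
  using assms by (simp_all add: powr_op_add powr_op_1 powr_op_0)

lemma mult_cancel_left_assoc: "A * B = 1 \<Longrightarrow> A * (B * C) = (C :: bop)"
  by (metis mult.assoc mult.left_neutral)

lemma posdef_wgm_middle:
  assumes "posdef A" "posdef B"
  shows "posdef (powr_op A (-1/2) * B * powr_op A (-1/2))"
  by (rule posdef_conj[OF assms(2) selfadjoint_powr_op[OF assms(1)] powr_op_half_sq(3)[OF assms(1)]])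

lemma posdef_wgm:
  assumes "posdef A" "posdef B"
  shows "posdef (wgm t A B)"
  unfolding wgm_def
  by (rule posdef_conj[OF posdef_powr_op[OF posdef_wgm_middle[OF assms]]
        selfadjoint_powr_op[OF assms(1)] powr_op_half_sq(4)[OF assms(1)]])

lemma wgm_0: "posdef A \<Longrightarrow> posdef B \<Longrightarrow> wgm 0 A B = A"
  unfolding wgm_def by (simp only: powr_op_0[OF posdef_wgm_middle] mult.right_neutral powr_op_half_sq)

lemma wgm_1:
  assumes "posdef A" "posdef B"
  shows "wgm 1 A B = B"
  unfolding wgm_def powr_op_1[OF posdef_wgm_middle[OF assms]]
  by (simp only: mult.assoc powr_op_half_sq[OF assms(1)] mult.right_neutral
      mult_cancel_left_assoc[OF powr_op_half_sq(3)[OF assms(1)]])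

lemma wgm_self:
  assumes "posdef A"
  shows "wgm t A A = A"
proof -
  let ?R = "powr_op A (1/2)" and ?S = "powr_op A (-1/2)"
  have "?S * A * ?S = ?S * (?R * ?R) * ?S" by (simp only: powr_op_half_sq(1)[OF assms])
  also have "\<dots> = (?S * ?R) * (?R * ?S)" by (simp only: mult.assoc)
  finally have "?S * A * ?S = 1" by (simp only: powr_op_half_sq[OF assms] mult.right_neutral)
  then show ?thesis unfolding wgm_def by (simp only: powr_op_one mult.right_neutral powr_op_half_sq[OF assms])
qed

lemma wgm_tendsto:
  assumes "posdef A" "posdef B" "t \<longlonglongrightarrow> s"
  shows "(\<lambda>n. wgm (t n) A B) \<longlonglongrightarrow> wgm s A B"
  unfolding wgm_def by (intro tendsto_intros powr_op_tendsto posdef_wgm_middle assms)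

text \<open>Inversion reverses the order, so \<open>powr_op X (-1)\<close> may be replaced by the
  smaller \<open>powr_op U (-1)\<close>. Conjugation with \<open>V = U^(-1/2)\<close> turns the
  hypothesis into \<open>(V Z V)^2 \<preceq> (V W V)^2\<close>; take square roots and undo the
  conjugation.\<close>

lemma riccati_mono:
  assumes X: "posdef X" and U: "posdef U" and Z: "posdef Z" and W: "posdef W"
    and "X \<preceq> U" "Z * powr_op X (-1) * Z \<preceq> W * powr_op U (-1) * W"
  shows "Z \<preceq> W"
proof -
  let ?V = "powr_op U (-1/2)" and ?S = "powr_op U (1/2)"
  have V: "selfadjoint ?V" and S: "selfadjoint ?S" using U by (simp_all add: selfadjoint_powr_op)
  have "powr_op U (-1) \<preceq> powr_op X (-1)"
    by (rule inverse_antitone[OF X U assms(5)]) (simp_all add: powr_op_inverse X U)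
  then have "Z * powr_op U (-1) * Z \<preceq> Z * powr_op X (-1) * Z"
    by (rule loewner_conj[OF _ posdef_selfadjoint[OF Z]])
  also note assms(6)
  finally have "?V * (Z * powr_op U (-1) * Z) * ?V \<preceq> ?V * (W * powr_op U (-1) * W) * ?V"
    by (rule loewner_conj[OF _ V])
  then have le: "(?V * Z * ?V) * (?V * Z * ?V) \<preceq> (?V * W * ?V) * (?V * W * ?V)"
    unfolding powr_op_half_sq(2)[OF U, symmetric] by (simp only: mult.assoc)
  have "?V * Z * ?V \<preceq> ?V * W * ?V"
    by (rule loewner_sqrt_mono[OF selfadjoint_conj[OF V posdef_selfadjoint[OF Z]]
          posdef_conj[OF W V powr_op_half_sq(3)[OF U]] le])
  then have "?S * (?V * Z * ?V) * ?S \<preceq> ?S * (?V * W * ?V) * ?S" by (rule loewner_conj[OF _ S])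
  then show ?thesis
    by (simp only: mult.assoc powr_op_half_sq[OF U] mult.right_neutral
        mult_cancel_left_assoc[OF powr_op_half_sq(3)[OF U]])
qed

lemma riccati_unique:
  assumes "posdef X" "posdef Z" "posdef W" "Z * powr_op X (-1) * Z = W * powr_op X (-1) * W"
  shows "Z = W"
  using riccati_mono[OF assms(1,1,2,3)] riccati_mono[OF assms(1,1,3,2)] assms(4)
  by (intro loewner_antisym posdef_selfadjoint assms(2,3)) simp_all

text \<open>With \<open>riccati_unique\<close> this characterizes the midpoint mean by an equation,
  from which symmetry, the midpoint law and scaling are obtained by checking candidates.\<close>

lemma wgm_half_riccati:
  assumes X: "posdef X" and Y: "posdef Y"
  shows "wgm (1/2) X Y * powr_op X (-1) * wgm (1/2) X Y = Y"
proof -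
  let ?R = "powr_op X (1/2)" and ?S = "powr_op X (-1/2)"
  define C where "C = ?S * Y * ?S"
  have C: "powr_op C (1/2) * powr_op C (1/2) = C"
    unfolding C_def by (rule powr_op_half_sq[OF posdef_wgm_middle[OF assms]])
  have "wgm (1/2) X Y * powr_op X (-1) * wgm (1/2) X Y
      = ?R * (powr_op C (1/2) * (powr_op C (1/2) * ?R))"
    unfolding wgm_def powr_op_half_sq(2)[OF X, symmetric] C_def[symmetric]
    by (simp only: mult.assoc mult_cancel_left_assoc[OF powr_op_half_sq(3)[OF X]]
        mult_cancel_left_assoc[OF powr_op_half_sq(4)[OF X]])
  also have "\<dots> = ?R * (C * ?R)" by (metis C mult.assoc)
  also have "\<dots> = Y"
    unfolding C_def by (simp only: mult.assoc powr_op_half_sq[OF X] mult.right_neutral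
        mult_cancel_left_assoc[OF powr_op_half_sq(3)[OF X]])
  finally show ?thesis .
qed

lemma wgm_half_eqI:
  assumes "posdef X" "posdef Y" "posdef Z" "Z * powr_op X (-1) * Z = Y"
  shows "wgm (1/2) X Y = Z"
  using assms by (rule_tac riccati_unique[of X]) (simp_all only: posdef_wgm wgm_half_riccati)

text \<open>Inverting \<open>Z X^(-1) Z = Y\<close> on one side gives \<open>Z Y^(-1) Z = X\<close>,
  the same equation with the roles exchanged.\<close>

lemma wgm_half_commute:
  assumes X: "posdef X" and Y: "posdef Y"
  shows "wgm (1/2) X Y = wgm (1/2) Y X"
proof -
  define Z where "Z = wgm (1/2) X Y"
  have Z: "posdef Z" unfolding Z_def using assms by (rule posdef_wgm)
  let ?Yi = "powr_op Y (-1)" and ?Xi = "powr_op X (-1)" and ?Zi = "powr_op Z (-1)"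
  have YZ: "Z * ?Xi * Z = Y" unfolding Z_def using assms by (rule wgm_half_riccati)
  have "Z * (?Xi * (Z * ?Yi)) = 1"
    using powr_op_inverse(1)[OF Y] by (simp only: YZ[symmetric] mult.assoc) 
  then have "?Xi * (Z * ?Yi) = ?Zi"
    using powr_op_inverse_eqI[OF Z] by metis
  then have "Z * ?Yi = X * ?Zi"
    using mult_cancel_left_assoc[OF powr_op_inverse(1)[OF X]] by metis
  then have "Z * ?Yi * Z = X"
    using powr_op_inverse(2)[OF Z] by (simp add: mult.assoc)
  then show ?thesis using wgm_half_eqI[OF Y X Z] by (simp add: Z_def)
qed

text \<open>All means of \<open>A\<close> and \<open>B\<close> have the form \<open>R C^x R\<close>
  with the same \<open>R = A^(1/2)\<close> and \<open>C\<close>, so the Riccati equation reduces to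
  the exponents: \<open>(s + t)/2 - s + (s + t)/2 = t\<close>.\<close>

lemma wgm_midpoint:
  assumes A: "posdef A" and B: "posdef B"
  shows "wgm ((s + t) / 2) A B = wgm (1/2) (wgm s A B) (wgm t A B)"
proof -
  let ?R = "powr_op A (1/2)" and ?S = "powr_op A (-1/2)"
  define C where "C = ?S * B * ?S"
  have C: "posdef C" unfolding C_def by (rule posdef_wgm_middle[OF assms])
  have pow: "powr_op C x * (powr_op C y * D) = powr_op C (x + y) * D" for x y D
    by (simp add: powr_op_add[OF C, symmetric] mult.assoc)
  have w: "wgm x A B = ?R * powr_op C x * ?R" for x unfolding wgm_def C_def ..
  note cancel = mult.assoc mult_cancel_left_assoc[OF powr_op_half_sq(3)[OF A]]
        mult_cancel_left_assoc[OF powr_op_half_sq(4)[OF A]]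
  have "wgm s A B * (?S * powr_op C (- s) * ?S) = 1"
    unfolding w by (simp only: cancel pow)
      (simp add: powr_op_0[OF C] powr_op_half_sq[OF A, simplified])
  then have inv: "powr_op (wgm s A B) (-1) = ?S * powr_op C (- s) * ?S"
    by (rule powr_op_inverse_eqI[OF posdef_wgm[OF assms]])
  have "wgm ((s + t) / 2) A B * powr_op (wgm s A B) (-1) * wgm ((s + t) / 2) A B = wgm t A B"
    unfolding inv unfolding w by (simp only: cancel pow) (simp add: field_simps)
  then show ?thesis
    by (rule wgm_half_eqI[OF posdef_wgm[OF assms] posdef_wgm[OF assms] posdef_wgm[OF assms], symmetric])
qed

lemma posdef_scaleR:
  assumes "posdef A" "c > 0"
  shows "posdef (c *\<^sub>R A)"
proof -
  obtain \<gamma> where "\<gamma> > 0" "\<gamma> *\<^sub>R 1 \<preceq> A" "selfadjoint A" using assms by (auto simp: posdef_iff)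
  then show ?thesis unfolding posdef_iff using assms(2) loewner_scaleR[of "\<gamma> *\<^sub>R 1" A c]
    by (intro conjI exI[of _ "c * \<gamma>"] selfadjoint_scaleR) auto
qed

text \<open>\<open>sqrt (a * b)\<close> times the mean of \<open>U\<close> and \<open>V\<close>
  solves the Riccati equation of \<open>a U\<close> and \<open>b V\<close>, so
  \<open>riccati_mono\<close> applies with these upper bounds.\<close>

lemma wgm_half_scaled_mono:
  assumes "posdef X" "posdef Y" "posdef U" "posdef V" "a > 0" "b > 0"
    and le: "X \<preceq> a *\<^sub>R U" "Y \<preceq> b *\<^sub>R V"
  shows "wgm (1/2) X Y \<preceq> sqrt (a * b) *\<^sub>R wgm (1/2) U V"
proof (rule riccati_mono[of X "a *\<^sub>R U"])
  let ?W = "wgm (1/2) U V"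
  have "powr_op (a *\<^sub>R U) (-1) = (1 / a) *\<^sub>R powr_op U (-1)"
    using assms by (intro powr_op_inverse_eqI posdef_scaleR) (simp_all add: powr_op_inverse)
  then have "(sqrt (a * b) *\<^sub>R ?W) * powr_op (a *\<^sub>R U) (-1) * (sqrt (a * b) *\<^sub>R ?W)
      = b *\<^sub>R (?W * powr_op U (-1) * ?W)"
    using assms(5,6) by simp
  also have "?W * powr_op U (-1) * ?W = V" using assms by (simp only: wgm_half_riccati)
  finally show "wgm (1/2) X Y * powr_op X (-1) * wgm (1/2) X Y
      \<preceq> (sqrt (a * b) *\<^sub>R ?W) * powr_op (a *\<^sub>R U) (-1) * (sqrt (a * b) *\<^sub>R ?W)"
    using assms by (simp only: wgm_half_riccati)
qed (use assms in \<open>simp_all add: posdef_wgm posdef_scaleR\<close>)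

text \<open>An odd numerator \<open>2 j + 1\<close> is the midpoint of the neighbours
  \<open>j / 2^n\<close> and \<open>(j + 1) / 2^n\<close> of the previous level. The constants
  \<open>a^(1 - x) b^x\<close> obey the same midpoint rule, so they reproduce themselves.\<close>

lemma wgm_scaled_mono_dyadic:
  assumes "posdef A" "posdef B" "posdef C" "posdef D" "a > 0" "b > 0"
    and le: "A \<preceq> a *\<^sub>R C" "B \<preceq> b *\<^sub>R D"
  shows "k \<le> 2 ^ n \<Longrightarrow> wgm (real k / 2 ^ n) A B
    \<preceq> (a powr (1 - real k / 2 ^ n) * b powr (real k / 2 ^ n)) *\<^sub>R wgm (real k / 2 ^ n) C D"
proof (induction n arbitrary: k)
  case 0
  then have "k = 0 \<or> k = 1" by auto
  then show ?case using assms by (auto simp: wgm_0 wgm_1)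
next
  case (Suc n)
  show ?case
  proof (cases "even k")
    case True
    then obtain j where "k = 2 * j" by blast
    then show ?thesis using Suc.IH[of j] Suc.prems by simp
  next
    case False
    then obtain j where j: "k = 2 * j + 1" by (metis oddE)
    define s t where "s = real j / 2 ^ n" and "t = real (j + 1) / 2 ^ n"
    have st: "real k / 2 ^ Suc n = (s + t) / 2" by (simp add: j s_def t_def field_simps)
    define c where "c x = a powr (1 - x) * b powr x" for x
    have c: "c x > 0" for x using assms by (simp add: c_def)
    have "wgm s A B \<preceq> c s *\<^sub>R wgm s C D" "wgm t A B \<preceq> c t *\<^sub>R wgm t C D"
      unfolding s_def t_def c_def using Suc.IH[of j] Suc.IH[of "j + 1"] Suc.prems j by simp_all
    then have "wgm (1/2) (wgm s A B) (wgm t A B)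
        \<preceq> sqrt (c s * c t) *\<^sub>R wgm (1/2) (wgm s C D) (wgm t C D)"
      using assms c by (intro wgm_half_scaled_mono posdef_wgm) auto
    moreover have "sqrt (c s * c t) = c ((s + t) / 2)"
    proof (rule real_sqrt_unique)
      have "c ((s + t) / 2) = exp ((1 - (s + t) / 2) * ln a + (s + t) / 2 * ln b)"
        "c s = exp ((1 - s) * ln a + s * ln b)" "c t = exp ((1 - t) * ln a + t * ln b)"
        using assms(5,6) by (simp_all add: c_def powr_def exp_add)
      then show "(c ((s + t) / 2))\<^sup>2 = c s * c t"
        by (simp add: power2_eq_square flip: exp_add) (simp add: field_simps)
    qed (use c in \<open>simp add: less_imp_le\<close>)
    ultimately show ?thesis
      using assms unfolding st by (simp add: wgm_midpoint c_def)
  qed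
qed

lemma wgm_scaled_mono:
  assumes "posdef A" "posdef B" "posdef C" "posdef D" "a > 0" "b > 0"
    and le: "A \<preceq> a *\<^sub>R C" "B \<preceq> b *\<^sub>R D" and t: "0 \<le> t" "t \<le> 1"
  shows "wgm t A B \<preceq> (a powr (1 - t) * b powr t) *\<^sub>R wgm t C D"
proof -
  \<comment> \<open>Dyadic points \<open>k n / 2^n\<close> below \<open>t\<close>, at distance at
    most \<open>2^(-n)\<close>.\<close>
  define k where "k n = nat \<lfloor>t * 2 ^ n\<rfloor>" for n
  have k: "real (k n) \<le> t * 2 ^ n" "t * 2 ^ n - 1 \<le> real (k n)" for n
    using t(1) by (auto simp: k_def le_nat_floor)
  have le1: "real (k n) \<le> 2 ^ n" for n
  proof -
    have "t * 2 ^ n \<le> 1 * 2 ^ n" by (intro mult_right_mono t) simp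
    then show ?thesis using k(1)[of n] by linarith
  qed
  define u where "u n = real (k n) / 2 ^ n" for n
  have lim: "u \<longlonglongrightarrow> t"
  proof (rule tendsto_sandwich[OF always_eventually always_eventually])
    have "t - (1/2) ^ n \<le> u n \<and> u n \<le> t" for n
    proof
      have "t - (1/2) ^ n = (t * 2 ^ n - 1) / 2 ^ n" by (simp add: power_one_over field_simps)
      also have "\<dots> \<le> u n" unfolding u_def using k(2) by (rule divide_right_mono) simp
      finally show "t - (1/2) ^ n \<le> u n" .
      show "u n \<le> t" using k(1)[of n] by (simp add: u_def pos_divide_le_eq)
    qed
    then show "\<forall>n. t - (1/2) ^ n \<le> u n" "\<forall>n. u n \<le> t" by auto
    have "(\<lambda>n. t - (1/2) ^ n) \<longlonglongrightarrow> t - 0" by (intro tendsto_intros LIMSEQ_realpow_zero) auto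
    then show "(\<lambda>n. t - (1/2) ^ n) \<longlonglongrightarrow> t" by simp
  qed simp
  show ?thesis
  proof (rule loewner_limit)
    show "(\<lambda>n. wgm (u n) A B) \<longlonglongrightarrow> wgm t A B"
      using assms lim by (intro wgm_tendsto)
    show "(\<lambda>n. (a powr (1 - u n) * b powr u n) *\<^sub>R wgm (u n) C D)
        \<longlonglongrightarrow> (a powr (1 - t) * b powr t) *\<^sub>R wgm t C D"
      using assms lim by (intro tendsto_intros wgm_tendsto) auto
    show "wgm (u n) A B \<preceq> (a powr (1 - u n) * b powr u n) *\<^sub>R wgm (u n) C D" for n
      unfolding u_def
    proof (rule wgm_scaled_mono_dyadic)
      show "k n \<le> 2 ^ n" using le1[of n] by (metis of_nat_le_iff of_nat_numeral of_nat_power)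
    qed (use assms in auto)
  qed
qed

text \<open>\<open>thompson r A B\<close> says that the Thompson distance of \<open>A\<close> and \<open>B\<close> is at most \<open>r\<close>.\<close>

definition thompson :: "real \<Rightarrow> bop \<Rightarrow> bop \<Rightarrow> bool"
  where "thompson r A B \<longleftrightarrow> A \<preceq> exp r *\<^sub>R B \<and> B \<preceq> exp r *\<^sub>R A"

lemma thompson_refl [simp]: "thompson 0 A A"
  by (simp add: thompson_def)

lemma thompson_trans:
  assumes "thompson r A B" "thompson q B C"
  shows "thompson (r + q) A C"
proof -
  have "A \<preceq> exp r *\<^sub>R B" using assms by (simp add: thompson_def)
  also have "exp r *\<^sub>R B \<preceq> exp r *\<^sub>R exp q *\<^sub>R C"
    using assms by (intro loewner_scaleR) (auto simp: thompson_def)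
  finally have 1: "A \<preceq> exp (r + q) *\<^sub>R C" by (simp add: exp_add)
  have "C \<preceq> exp q *\<^sub>R B" using assms by (simp add: thompson_def)
  also have "exp q *\<^sub>R B \<preceq> exp q *\<^sub>R exp r *\<^sub>R A"
    using assms by (intro loewner_scaleR) (auto simp: thompson_def)
  finally show ?thesis using 1 by (simp add: thompson_def exp_add mult.commute)
qed

lemma thompson_mono:
  assumes "thompson r A B" "r \<le> q" "posdef A" "posdef B"
  shows "thompson q A B"
  using assms loewner_scaleR_mono[of _ "exp r" "exp q"] unfolding thompson_def
  by (meson exp_le_cancel_iff loewner_trans)

lemma thompson_wgm:
  assumes "posdef A" "posdef B" "posdef C" "posdef D" "0 \<le> t" "t \<le> 1"
    and "thompson r A C" "thompson q B D"
  shows "thompson ((1 - t) * r + t * q) (wgm t A B) (wgm t C D)"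
proof -
  have e: "exp r powr (1 - t) * exp q powr t = exp ((1 - t) * r + t * q)"
    by (simp add: powr_def exp_add)
  show ?thesis using assms
      wgm_scaled_mono[of A B C D "exp r" "exp q" t] wgm_scaled_mono[of C D A B "exp r" "exp q" t]
    unfolding thompson_def e by simp
qed

lemma thompson_limit:
  assumes "X \<longlonglongrightarrow> A" "Y \<longlonglongrightarrow> B" "\<And>n. thompson r (X n) (Y n)"
  shows "thompson r A B"
  using assms loewner_limit[OF assms(1) tendsto_scaleR[OF tendsto_const assms(2)], of "exp r"]
    loewner_limit[OF assms(2) tendsto_scaleR[OF tendsto_const assms(1)], of "exp r"]
  by (auto simp: thompson_def)

lemma thompson_exists:
  assumes "posdef A" "posdef B"
  obtains r where "r \<ge> 0" "thompson r A B"
proof -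
  have *: "\<exists>c>0. A \<preceq> c *\<^sub>R B" if B: "posdef B" for A B
  proof -
    obtain \<gamma> where g: "\<gamma> > 0" "\<gamma> *\<^sub>R 1 \<preceq> B" using B by (auto simp: posdef_iff)
    let ?c = "(norm A + 1) / \<gamma>"
    have "A \<preceq> norm A *\<^sub>R 1" by (rule loewner_le_norm)
    also have "\<dots> \<preceq> (norm A + 1) *\<^sub>R 1" by (rule loewner_scaleR_mono[OF posdef_one]) simp
    also have "\<dots> = ?c *\<^sub>R \<gamma> *\<^sub>R 1" using g(1) by simp
    also have "\<dots> \<preceq> ?c *\<^sub>R B" using g by (intro loewner_scaleR) auto
    finally show ?thesis using g(1) by (intro exI[of _ ?c]) (simp add: add_nonneg_pos)
  qed
  obtain c d where cd: "c > 0" "A \<preceq> c *\<^sub>R B" "d > 0" "B \<preceq> d *\<^sub>R A"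
    using *[OF assms(2), of A] *[OF assms(1), of B] by blast
  define r where "r = max 0 (max (ln c) (ln d))"
  have "ln c \<le> r" "ln d \<le> r" by (auto simp: r_def)
  then have "c \<le> exp r" "d \<le> exp r"
    using cd by (metis exp_le_cancel_iff exp_ln)+
  then have "thompson r A B"
    unfolding thompson_def
    using loewner_trans[OF cd(2) loewner_scaleR_mono[OF assms(2)]]
      loewner_trans[OF cd(4) loewner_scaleR_mono[OF assms(1)]] by blast
  then show thesis by (intro that[of r]) (simp_all add: r_def)
qed

lemma norm_le_of_loewner:
  assumes "posdef X" "X \<preceq> c *\<^sub>R Y" "c \<ge> 0"
  shows "norm X \<le> c * norm Y"
proof (rule norm_selfadjoint_le)
  fix v
  have "inner v (X \<cdot> v) \<le> c * inner v (Y \<cdot> v)" using assms(2) by (simp add: loewner_le_def)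
  also have "\<dots> \<le> c * (norm Y * norm v * norm v)"
    using inner_bop_le[of v Y v] assms(3) by (intro mult_left_mono) auto
  finally show "\<bar>inner v (X \<cdot> v)\<bar> \<le> c * norm Y * (norm v)\<^sup>2"
    using posdef_pos[OF assms(1), of v] by (simp add: power2_eq_square mult_ac)
qed (use assms in \<open>simp_all add: posdef_selfadjoint\<close>)

text \<open>\<open>A - B \<preceq> (exp r - 1) B\<close>, and likewise with \<open>A\<close> and
  \<open>B\<close> exchanged. On norm-bounded sets convergence in the Thompson metric therefore
  implies norm convergence.\<close>

lemma norm_diff_le_thompson:
  assumes "posdef A" "posdef B" "thompson r A B" "r \<ge> 0"
  shows "norm (A - B) \<le> (exp r - 1) * max (norm A) (norm B)"
proof (rule norm_selfadjoint_le)
  let ?c = "max (norm A) (norm B)"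
  show "selfadjoint (A - B)" using assms by (intro selfadjoint_diff posdef_selfadjoint)
  show "0 \<le> (exp r - 1) * ?c" using assms(4) by (simp add: le_max_iff_disj)
  fix v :: l2
  have e: "0 \<le> exp r - 1" using assms(4) by simp
  have c: "inner v (X \<cdot> v) \<le> ?c * (norm v)\<^sup>2" if "norm X \<le> ?c" for X
    using loewner_trans[OF loewner_le_norm loewner_scaleR_mono[OF posdef_one that]]
    by (simp add: loewner_le_def power2_norm_eq_inner)
  have "inner v (A \<cdot> v) \<le> exp r * inner v (B \<cdot> v)" "inner v (B \<cdot> v) \<le> exp r * inner v (A \<cdot> v)"
    using assms(3) by (simp_all add: thompson_def loewner_le_def)
  then have "inner v (A \<cdot> v) - inner v (B \<cdot> v) \<le> (exp r - 1) * inner v (B \<cdot> v)"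
    "inner v (B \<cdot> v) - inner v (A \<cdot> v) \<le> (exp r - 1) * inner v (A \<cdot> v)"
    by (simp_all add: algebra_simps)
  then show "\<bar>inner v ((A - B) \<cdot> v)\<bar> \<le> (exp r - 1) * ?c * (norm v)\<^sup>2"
    using mult_left_mono[OF c[of A] e] mult_left_mono[OF c[of B] e]
    by (simp add: inner_diff_right abs_le_iff mult.assoc)
qed


section \<open>Compact operators and matrices\<close>

text \<open>In a complete space a compact closure means total boundedness. The closure disappears
  because a cover by balls of radius \<open>e / 2\<close> extends to the closure with closed balls,
  which fit into balls of radius \<open>e\<close>.\<close>

lemma compact_op_iff:
  "compact_op K \<longleftrightarrow> (\<forall>e>0. \<exists>F. finite F \<and> bop_apply K ` cball 0 1 \<subseteq> (\<Union>x\<in>F. ball x e))"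
    (is "_ \<longleftrightarrow> (\<forall>e>0. ?P e)")
proof
  assume "compact_op K"
  then have "\<forall>e>0. \<exists>F. finite F \<and> closure (bop_apply K ` cball 0 1) \<subseteq> (\<Union>x\<in>F. ball x e)"
    unfolding compact_op_def compact_eq_totally_bounded by simp
  then show "\<forall>e>0. ?P e"
    using subset_trans[OF closure_subset] by (elim all_forward imp_forward ex_forward conj_forward)
next
  assume P: "\<forall>e>0. ?P e"
  show "compact_op K"
    unfolding compact_op_def compact_eq_totally_bounded
  proof (intro conjI allI impI)
    show "complete (closure (bop_apply K ` cball 0 1))" by (simp add: complete_eq_closed)
    fix e :: real assume e: "0 < e"
    then obtain F where F: "finite F" "bop_apply K ` cball 0 1 \<subseteq> (\<Union>x\<in>F. ball x (e / 2))"
      using P half_gt_zero by metis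
    have "closure (bop_apply K ` cball 0 1) \<subseteq> (\<Union>x\<in>F. cball x (e / 2))"
    proof (rule closure_minimal)
      have "(\<Union>x\<in>F. ball x (e / 2)) \<subseteq> (\<Union>x\<in>F. cball x (e / 2))" by (intro UN_mono) auto
      then show "bop_apply K ` cball 0 1 \<subseteq> (\<Union>x\<in>F. cball x (e / 2))" using F(2) by (rule_tac subset_trans)
    qed (use F(1) in \<open>simp add: closed_UN\<close>)
    also have "\<dots> \<subseteq> (\<Union>x\<in>F. ball x e)" using e by (intro UN_mono) (auto simp: subset_eq)
    finally show "\<exists>F. finite F \<and> closure (bop_apply K ` cball 0 1) \<subseteq> (\<Union>x\<in>F. ball x e)"
      using F(1) by blast
  qed
qed

lemma image_cball_subset_iff:
  "bop_apply K ` cball 0 1 \<subseteq> (\<Union>x\<in>F. ball x e) \<longleftrightarrow>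
    (\<forall>v. norm v \<le> 1 \<longrightarrow> (\<exists>x\<in>F. norm (K \<cdot> v - x) < e))"
  by (auto simp: subset_eq dist_norm norm_minus_commute)

lemma compact_opD:
  assumes "compact_op K" "e > 0"
  shows "\<exists>F. finite F \<and> (\<forall>v. norm v \<le> 1 \<longrightarrow> (\<exists>x\<in>F. norm (K \<cdot> v - x) < e))"
  using assms by (simp only: compact_op_iff image_cball_subset_iff)

lemma compact_opI:
  assumes "\<And>e. e > 0 \<Longrightarrow> \<exists>F. finite F \<and> (\<forall>v. norm v \<le> 1 \<longrightarrow> (\<exists>x\<in>F. norm (K \<cdot> v - x) < e))"
  shows "compact_op K"
  unfolding compact_op_iff image_cball_subset_iff by (intro allI impI assms)

lemma compact_op_0: "compact_op 0"
  by (rule compact_opI) (auto intro!: exI[of _ "{0}"])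

lemma compact_op_add:
  assumes "compact_op K" "compact_op L"
  shows "compact_op (K + L)"
proof (rule compact_opI)
  fix e :: real assume "e > 0"
  then have e: "e / 2 > 0" by simp
  obtain F where F: "finite F" "\<And>v. norm v \<le> 1 \<Longrightarrow> \<exists>x\<in>F. norm (K \<cdot> v - x) < e / 2"
    using compact_opD[OF assms(1) e] by blast
  obtain G where G: "finite G" "\<And>v. norm v \<le> 1 \<Longrightarrow> \<exists>x\<in>G. norm (L \<cdot> v - x) < e / 2"
    using compact_opD[OF assms(2) e] by blast
  have "\<exists>z\<in>(\<lambda>(x, y). x + y) ` (F \<times> G). norm ((K + L) \<cdot> v - z) < e" if v: "norm v \<le> 1" for v
  proof -
    obtain x y where xy: "x \<in> F" "norm (K \<cdot> v - x) < e / 2" "y \<in> G" "norm (L \<cdot> v - y) < e / 2"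
      using F(2)[OF v] G(2)[OF v] by blast
    then have "norm ((K + L) \<cdot> v - (x + y)) < e"
      using norm_triangle_ineq[of "K \<cdot> v - x" "L \<cdot> v - y"] by (simp add: algebra_simps)
    then show ?thesis using xy by force
  qed
  then show "\<exists>H. finite H \<and> (\<forall>v. norm v \<le> 1 \<longrightarrow> (\<exists>x\<in>H. norm ((K + L) \<cdot> v - x) < e))"
    using F(1) G(1) by (intro exI[of _ "(\<lambda>(x, y). x + y) ` (F \<times> G)"]) auto
qed

lemma compact_op_mult_left:
  assumes "compact_op K"
  shows "compact_op (B * K)"
proof (rule compact_opI)
  fix e :: real assume e: "e > 0"
  define c where "c = norm B + 1"
  have c: "c > 0" "norm B \<le> c" by (simp_all add: c_def add_nonneg_pos)
  obtain F where F: "finite F" "\<And>v. norm v \<le> 1 \<Longrightarrow> \<exists>x\<in>F. norm (K \<cdot> v - x) < e / c"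
    using compact_opD[OF assms, of "e / c"] divide_pos_pos[OF e c(1)] by blast
  have "\<exists>z\<in>bop_apply B ` F. norm ((B * K) \<cdot> v - z) < e" if v: "norm v \<le> 1" for v
  proof -
    obtain x where x: "x \<in> F" "norm (K \<cdot> v - x) < e / c" using F(2)[OF v] by blast
    have "norm ((B * K) \<cdot> v - B \<cdot> x) \<le> norm B * norm (K \<cdot> v - x)"
      using norm_bop_apply[of B "K \<cdot> v - x"] by simp
    also have "\<dots> \<le> c * norm (K \<cdot> v - x)" using c by (intro mult_right_mono) auto
    also have "\<dots> < e" using x c by (simp add: pos_less_divide_eq mult.commute)
    finally show ?thesis using x by blast
  qed
  then show "\<exists>F. finite F \<and> (\<forall>v. norm v \<le> 1 \<longrightarrow> (\<exists>x\<in>F. norm ((B * K) \<cdot> v - x) < e))"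
    using F(1) by (intro exI[of _ "bop_apply B ` F"]) auto
qed

lemma compact_op_mult_right:
  assumes "compact_op K"
  shows "compact_op (K * B)"
proof (rule compact_opI)
  fix e :: real assume e: "e > 0"
  define c where "c = norm B + 1"
  have c: "c > 0" "norm B \<le> c" by (simp_all add: c_def add_nonneg_pos)
  obtain F where F: "finite F" "\<And>v. norm v \<le> 1 \<Longrightarrow> \<exists>x\<in>F. norm (K \<cdot> v - x) < e / c"
    using compact_opD[OF assms, of "e / c"] divide_pos_pos[OF e c(1)] by blast
  have "\<exists>z\<in>scaleR c ` F. norm ((K * B) \<cdot> v - z) < e" if v: "norm v \<le> 1" for v
  proof -
    have "norm (B \<cdot> v) \<le> c * 1"
    proof -
      have "norm B * norm v \<le> c * 1" using c v by (intro mult_mono) auto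
      then show ?thesis using norm_bop_apply[of B v] by linarith
    qed
    then have "norm ((1 / c) *\<^sub>R (B \<cdot> v)) \<le> 1" using c by (simp add: pos_divide_le_eq)
    then obtain x where x: "x \<in> F" "norm (K \<cdot> ((1 / c) *\<^sub>R (B \<cdot> v)) - x) < e / c" using F(2) by blast
    have "(K * B) \<cdot> v - c *\<^sub>R x = c *\<^sub>R (K \<cdot> ((1 / c) *\<^sub>R (B \<cdot> v)) - x)"
      using c by (simp add: scaleR_diff_right)
    then have "norm ((K * B) \<cdot> v - c *\<^sub>R x) = c * norm (K \<cdot> ((1 / c) *\<^sub>R (B \<cdot> v)) - x)"
      using c by (simp only: norm_scaleR abs_of_pos)
    also have "\<dots> < e" using x c by (simp add: pos_less_divide_eq mult.commute)
    finally show ?thesis using x by blast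
  qed
  then show "\<exists>F. finite F \<and> (\<forall>v. norm v \<le> 1 \<longrightarrow> (\<exists>x\<in>F. norm ((K * B) \<cdot> v - x) < e))"
    using F(1) by (intro exI[of _ "scaleR c ` F"]) auto
qed

lemma compact_op_scaleC: "compact_op K \<Longrightarrow> compact_op (scaleC_bop c K)"
proof -
  have "scaleC_bop c K = scaleC_bop c 1 * K" by (rule bop_eqI) simp
  then show "compact_op K \<Longrightarrow> compact_op (scaleC_bop c K)" by (simp add: compact_op_mult_left)
qed

lemma compact_op_limit:
  assumes "X \<longlonglongrightarrow> K" "\<And>n. compact_op (X n)"
  shows "compact_op K"
proof (rule compact_opI)
  fix e :: real assume "e > 0"
  then have e: "e / 2 > 0" by simp
  obtain n where n: "norm (X n - K) < e / 2" using LIMSEQ_D[OF assms(1) e] by blast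
  obtain F where F: "finite F" "\<And>v. norm v \<le> 1 \<Longrightarrow> \<exists>x\<in>F. norm (X n \<cdot> v - x) < e / 2"
    using compact_opD[OF assms(2) e] by blast
  have "\<exists>z\<in>F. norm (K \<cdot> v - z) < e" if v: "norm v \<le> 1" for v
  proof -
    obtain x where x: "x \<in> F" "norm (X n \<cdot> v - x) < e / 2" using F(2)[OF v] by blast
    have "norm ((X n - K) \<cdot> v) \<le> norm (X n - K) * norm v" by (rule norm_bop_apply)
    also have "\<dots> \<le> norm (X n - K)" using v by (simp add: mult_left_le)
    finally have "norm (K \<cdot> v - X n \<cdot> v) < e / 2" using n by (simp add: norm_minus_commute)
    then have "norm (K \<cdot> v - x) < e"
      using norm_triangle_ineq[of "K \<cdot> v - X n \<cdot> v" "X n \<cdot> v - x"] x by simp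
    then show ?thesis using x by blast
  qed
  then show "\<exists>F. finite F \<and> (\<forall>v. norm v \<le> 1 \<longrightarrow> (\<exists>x\<in>F. norm (K \<cdot> v - x) < e))"
    using F(1) by blast
qed

section \<open>Operators and their matrices\<close>

lemma l2_nth_sum: "l2_nth (\<Sum>j\<in>J. f j) i = (\<Sum>j\<in>J. l2_nth (f j) i)"
  by (induction J rule: infinite_finite_induct) auto

lemma l2_expansion: "(\<lambda>n. \<Sum>j<n. scaleC_l2 (l2_nth y j) (l2_unit j)) \<longlonglongrightarrow> y"
proof -
  let ?S = "\<lambda>n. \<Sum>j<n. scaleC_l2 (l2_nth y j) (l2_unit j)"
  have nth: "l2_nth (?S n) i = (if i < n then l2_nth y i else 0)" for n i
  proof -
    have "l2_nth (?S n) i = (\<Sum>j<n. if i = j then l2_nth y j else 0)"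
      unfolding l2_nth_sum by (intro sum.cong) (auto simp: l2_unit.rep_eq)
    then show ?thesis by (simp add: sum.delta')
  qed
  have s: "summable (\<lambda>i. (cmod (l2_nth y i))\<^sup>2)" using l2_nth[of y] by simp
  have "(norm (?S n - y))\<^sup>2 = (\<Sum>i. (cmod (l2_nth y (i + n)))\<^sup>2)" for n
  proof -
    have "(norm (?S n - y))\<^sup>2 = (\<Sum>i. (cmod (l2_nth (?S n - y) (i + n)))\<^sup>2)
        + (\<Sum>i<n. (cmod (l2_nth (?S n - y) i))\<^sup>2)"
      unfolding l2_norm_sq using l2_nth[of "?S n - y"] by (intro suminf_split_initial_segment) simp
    then show ?thesis by (simp add: nth)
  qed
  moreover have "(\<lambda>n. \<Sum>i. (cmod (l2_nth y (i + n)))\<^sup>2) \<longlonglongrightarrow> 0"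
    using suminf_exist_split2[OF s] by simp
  ultimately have "(\<lambda>n. (norm (?S n - y))\<^sup>2) \<longlonglongrightarrow> 0" by simp
  then have "(\<lambda>n. sqrt ((norm (?S n - y))\<^sup>2)) \<longlonglongrightarrow> sqrt 0" by (rule tendsto_real_sqrt)
  then have "(\<lambda>n. norm (?S n - y)) \<longlonglongrightarrow> 0" by simp
  then show ?thesis by (simp add: tendsto_norm_zero_iff LIM_zero_iff)
qed

lemma bop_apply_expansion: "(\<lambda>n. \<Sum>j<n. scaleC_l2 (l2_nth y j) (A \<cdot> l2_unit j)) \<longlonglongrightarrow> A \<cdot> y"
  using bounded_linear.tendsto[OF bounded_linear_bop_apply l2_expansion, of A y]
  by (simp add: linear_sum[OF linear_bop_apply] bop_apply_scaleC)

lemma bop_eqI_entries: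
  assumes "\<And>i j. l2_nth (A \<cdot> l2_unit j) i = l2_nth (B \<cdot> l2_unit j) i"
  shows "A = B"
proof (rule bop_eqI)
  fix v
  have "A \<cdot> l2_unit j = B \<cdot> l2_unit j" for j using assms by (intro l2_eqI)
  then have "(\<lambda>n. \<Sum>j<n. scaleC_l2 (l2_nth v j) (A \<cdot> l2_unit j)) \<longlonglongrightarrow> B \<cdot> v"
    using bop_apply_expansion[of v B] by simp
  with bop_apply_expansion[of v A] show "A \<cdot> v = B \<cdot> v" by (rule LIMSEQ_unique)
qed

lemma scaleC_l2_zero [simp]: "scaleC_l2 c 0 = 0"
  by (rule l2_eqI) simp

text \<open>An iterated sum of compact discs, one for each vector. Coordinates of vectors in the
  unit ball have modulus at most 1, so this catches the image of the ball under an operator with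
  finitely many nonzero columns.\<close>

lemma compact_lin_combs:
  fixes n :: nat
  shows "\<exists>S. compact S \<and> (\<forall>c. (\<forall>j<n. cmod (c j) \<le> 1) \<longrightarrow> (\<Sum>j<n. scaleC_l2 (c j) (w j)) \<in> S)"
proof (induction n)
  case 0
  then show ?case by (intro exI[of _ "{0}"]) auto
next
  case (Suc n)
  then obtain S where S: "compact S" "\<And>c. (\<forall>j<n. cmod (c j) \<le> 1) \<Longrightarrow> (\<Sum>j<n. scaleC_l2 (c j) (w j)) \<in> S"
    by blast
  have "bounded_linear (\<lambda>z. scaleC_l2 z (w n))"
    by (rule bounded_linear_intro[of _ "norm (w n)"])
      (auto intro!: l2_eqI simp: algebra_simps norm_scaleC_l2 scaleR_conv_of_real)
  then have "compact ((\<lambda>z. scaleC_l2 z (w n)) ` cball 0 1)"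
    by (intro compact_continuous_image linear_continuous_on) auto
  then have "compact {x + y |x y. x \<in> S \<and> y \<in> (\<lambda>z. scaleC_l2 z (w n)) ` cball 0 1}"
    by (rule compact_sums[OF S(1)])
  moreover have "(\<Sum>j<Suc n. scaleC_l2 (c j) (w j))
      \<in> {x + y |x y. x \<in> S \<and> y \<in> (\<lambda>z. scaleC_l2 z (w n)) ` cball 0 1}"
    if c: "\<forall>j<Suc n. cmod (c j) \<le> 1" for c
  proof -
    have "(\<Sum>j<n. scaleC_l2 (c j) (w j)) \<in> S" using S(2) c by simp
    moreover have "scaleC_l2 (c n) (w n) \<in> (\<lambda>z. scaleC_l2 z (w n)) ` cball 0 1" using c by simp
    ultimately show ?thesis unfolding sum.lessThan_Suc by blast
  qed
  ultimately show ?case by (intro exI[of _ "{x + y |x y. x \<in> S \<and> y \<in> (\<lambda>z. scaleC_l2 z (w n)) ` cball 0 1}"]) simp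
qed

lemma compact_op_finite_columns:
  assumes "\<And>j. j \<ge> n \<Longrightarrow> D \<cdot> l2_unit j = 0"
  shows "compact_op D"
proof -
  have D: "D \<cdot> y = (\<Sum>j<n. scaleC_l2 (l2_nth y j) (D \<cdot> l2_unit j))" for y
  proof -
    have "(\<Sum>j<N. scaleC_l2 (l2_nth y j) (D \<cdot> l2_unit j))
        = (\<Sum>j<n. scaleC_l2 (l2_nth y j) (D \<cdot> l2_unit j))" if "N \<ge> n" for N
    proof (rule sum.mono_neutral_right)
      show "\<forall>j\<in>{..<N} - {..<n}. scaleC_l2 (l2_nth y j) (D \<cdot> l2_unit j) = 0" by (simp add: assms)
    qed (use that in auto)
    then have "(\<lambda>N. \<Sum>j<N. scaleC_l2 (l2_nth y j) (D \<cdot> l2_unit j))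
        \<longlonglongrightarrow> (\<Sum>j<n. scaleC_l2 (l2_nth y j) (D \<cdot> l2_unit j))"
      by (rule tendsto_eventually[OF eventually_sequentiallyI])
    with bop_apply_expansion[of y D] show ?thesis by (rule LIMSEQ_unique)
  qed
  obtain S where S: "compact S"
    "\<And>c. (\<forall>j<n. cmod (c j) \<le> 1) \<Longrightarrow> (\<Sum>j<n. scaleC_l2 (c j) (D \<cdot> l2_unit j)) \<in> S"
    using compact_lin_combs[of n "\<lambda>j. D \<cdot> l2_unit j"] by blast
  have "D \<cdot> y \<in> S" if "norm y \<le> 1" for y
    unfolding D[of y] using S(2) order_trans[OF cmod_l2_nth_le that] by blast
  then have "bop_apply D ` cball 0 1 \<subseteq> S" by auto
  then have "closure (bop_apply D ` cball 0 1) \<subseteq> S"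
    using S(1) by (intro closure_minimal compact_imp_closed)
  then show ?thesis unfolding compact_op_def
    using compact_Int_closed[OF S(1) closed_closure, of "bop_apply D ` cball 0 1"]
    by (simp add: inf.absorb2)
qed

text \<open>The form is tested with \<open>x = r / C\<close>, where \<open>r\<close> is the image of
  \<open>y\<close>. Its value is then \<open>R / C\<close>, and the scale \<open>1 / C\<close>
  leaves only half of \<open>R / C\<close> on the right, so it can be absorbed.\<close>

lemma matrix_bound:
  fixes m :: "nat \<Rightarrow> nat \<Rightarrow> complex"
  assumes C: "C > 0"
    and form: "\<And>n x y. cmod (\<Sum>i<n. \<Sum>j<n. cnj (x i) * m i j * y j)
      \<le> C * ((\<Sum>i<n. (cmod (x i))\<^sup>2) + (\<Sum>i<n. (cmod (y i))\<^sup>2)) / 2"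
  shows "(\<Sum>i<n. (cmod (\<Sum>j<n. m i j * y j))\<^sup>2) \<le> C\<^sup>2 * (\<Sum>j<n. (cmod (y j))\<^sup>2)"
proof -
  define r where "r i = (\<Sum>j<n. m i j * y j)" for i
  define R where "R = (\<Sum>i<n. (cmod (r i))\<^sup>2)"
  have R0: "R \<ge> 0" by (simp add: R_def sum_nonneg)
  have "(\<Sum>i<n. \<Sum>j<n. cnj (of_real (1 / C) * r i) * m i j * y j)
      = (\<Sum>i<n. of_real (1 / C) * (r i * cnj (r i)))"
  proof (rule sum.cong)
    fix i
    have "(\<Sum>j<n. cnj (of_real (1 / C) * r i) * m i j * y j) = cnj (of_real (1 / C) * r i) * r i"
      unfolding r_def[of i] by (simp only: sum_distrib_left mult.assoc)
    then show "(\<Sum>j<n. cnj (of_real (1 / C) * r i) * m i j * y j) = of_real (1 / C) * (r i * cnj (r i))"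
      by (simp add: mult_ac)
  qed simp
  also have "\<dots> = of_real (1 / C * R)"
    unfolding R_def of_real_mult of_real_sum complex_norm_square by (simp add: sum_distrib_left)
  finally have eq: "(\<Sum>i<n. \<Sum>j<n. cnj (of_real (1 / C) * r i) * m i j * y j) = of_real (1 / C * R)" .
  have "R / C \<le> C * (R / C\<^sup>2 + (\<Sum>j<n. (cmod (y j))\<^sup>2)) / 2"
    using form[where n = n and x = "\<lambda>i. of_real (1 / C) * r i" and y = y] C R0 unfolding eq norm_of_real
    by (simp add: norm_mult norm_divide power_mult_distrib power_divide R_def sum_divide_distrib)
  also have "\<dots> = (R / C) / 2 + C * (\<Sum>j<n. (cmod (y j))\<^sup>2) / 2"
    using C by (simp add: field_simps power2_eq_square)
  finally have "R / C \<le> C * (\<Sum>j<n. (cmod (y j))\<^sup>2)" by simp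
  then have "R \<le> C * (C * (\<Sum>j<n. (cmod (y j))\<^sup>2))" using C by (simp add: pos_divide_le_eq mult.commute)
  then show ?thesis by (simp add: R_def r_def power2_eq_square mult.assoc)
qed

text \<open>A bound for the forms of all finite sections suffices to build the operator. It already
  makes each row square-summable: a section applied to the conjugate of its own row \<open>i\<close>
  has entry \<open>S\<close>, the squared length of that row, whence
  \<open>S^2 \<le> C^2 S\<close>.\<close>

lemma bop_of_matrix:
  fixes m :: "nat \<Rightarrow> nat \<Rightarrow> complex"
  assumes C: "C > 0"
    and form: "\<And>n x y. cmod (\<Sum>i<n. \<Sum>j<n. cnj (x i) * m i j * y j)
      \<le> C * ((\<Sum>i<n. (cmod (x i))\<^sup>2) + (\<Sum>i<n. (cmod (y i))\<^sup>2)) / 2"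
  obtains A where "\<And>i j. l2_nth (A \<cdot> l2_unit j) i = m i j" "norm A \<le> C"
proof -
  note bound = matrix_bound[OF assms]
  have row: "summable (\<lambda>j. (cmod (m i j))\<^sup>2)" for i
  proof (rule bounded_imp_summable)
    fix n
    \<comment> \<open>Large enough for the section to contain row \<open>i\<close> and the columns
      up to \<open>n\<close>.\<close>
    define N where "N = Suc (max i n)"
    define S where "S = (\<Sum>j<N. (cmod (m i j))\<^sup>2)"
    have S0: "S \<ge> 0" by (simp add: S_def sum_nonneg)
    have "(\<Sum>j<N. m i j * cnj (m i j)) = of_real S"
      unfolding S_def of_real_sum complex_norm_square ..
    then have "S\<^sup>2 = (cmod (\<Sum>j<N. m i j * cnj (m i j)))\<^sup>2" by simp
    also have "\<dots> \<le> (\<Sum>k<N. (cmod (\<Sum>j<N. m k j * cnj (m i j)))\<^sup>2)"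
      by (rule member_le_sum) (auto simp: N_def)
    also have "\<dots> \<le> C\<^sup>2 * S" using bound[where n = N and y = "\<lambda>j. cnj (m i j)"] by (simp add: S_def)
    finally have "S * S \<le> C\<^sup>2 * S" by (simp add: power2_eq_square)
    then have "S \<le> C\<^sup>2" using S0 by (cases "S = 0") (simp_all only: mult_le_cancel_right, auto)
    moreover have "(\<Sum>j\<le>n. (cmod (m i j))\<^sup>2) \<le> S"
      unfolding S_def by (rule sum_mono2) (auto simp: N_def)
    ultimately show "(\<Sum>j\<le>n. (cmod (m i j))\<^sup>2) \<le> C\<^sup>2" by simp
  qed simp
  have sm: "summable (\<lambda>j. m i j * l2_nth y j)" for i y
    using summable_cmod_mult[OF row[of i], of "l2_nth y"] l2_nth[of y]
    by (rule_tac summable_norm_cancel) (simp add: norm_mult)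
  define f where "f y i = (\<Sum>j. m i j * l2_nth y j)" for y i
  \<comment> \<open>The number \<open>N\<close> of rows stays fixed while the length
    \<open>n\<close> of the inner sums tends to infinity; for \<open>n \<ge> N\<close> these rows
    belong to the section of size \<open>n\<close>.\<close>
  have part: "(\<Sum>i<N. (cmod (f y i))\<^sup>2) \<le> C\<^sup>2 * (norm y)\<^sup>2" for y N
  proof (rule LIMSEQ_le_const2)
    show "(\<lambda>n. \<Sum>i<N. (cmod (\<Sum>j<n. m i j * l2_nth y j))\<^sup>2) \<longlonglongrightarrow> (\<Sum>i<N. (cmod (f y i))\<^sup>2)"
      unfolding f_def by (intro tendsto_intros summable_LIMSEQ sm)
    have "(\<Sum>i<N. (cmod (\<Sum>j<n. m i j * l2_nth y j))\<^sup>2) \<le> C\<^sup>2 * (norm y)\<^sup>2" if "n \<ge> N" for n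
    proof -
      have "(\<Sum>i<N. (cmod (\<Sum>j<n. m i j * l2_nth y j))\<^sup>2)
          \<le> (\<Sum>i<n. (cmod (\<Sum>j<n. m i j * l2_nth y j))\<^sup>2)"
        by (rule sum_mono2) (use that in auto)
      also have "\<dots> \<le> C\<^sup>2 * (\<Sum>j<n. (cmod (l2_nth y j))\<^sup>2)" by (rule bound)
      also have "\<dots> \<le> C\<^sup>2 * (norm y)\<^sup>2" by (intro mult_left_mono sum_le_l2_norm_sq) auto
      finally show ?thesis .
    qed
    then show "\<exists>n0. \<forall>n\<ge>n0. (\<Sum>i<N. (cmod (\<Sum>j<n. m i j * l2_nth y j))\<^sup>2) \<le> C\<^sup>2 * (norm y)\<^sup>2" by blast
  qed
  have fs: "summable (\<lambda>i. (cmod (f y i))\<^sup>2)" for y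
  proof (rule bounded_imp_summable)
    show "(\<Sum>i\<le>n. (cmod (f y i))\<^sup>2) \<le> C\<^sup>2 * (norm y)\<^sup>2" for n
      using part[where N = "Suc n" and y = y] by (simp only: lessThan_Suc_atMost)
  qed simp
  define g where "g y = Abs_l2 (f y)" for y
  have g: "l2_nth (g y) i = f y i" for y i using fs by (simp add: g_def Abs_l2_inverse)
  have gn: "norm (g y) \<le> norm y * C" for y
  proof (rule power2_le_imp_le)
    have "(norm (g y))\<^sup>2 \<le> C\<^sup>2 * (norm y)\<^sup>2"
      unfolding l2_norm_sq[of "g y"] g by (rule suminf_le_const[OF fs part])
    then show "(norm (g y))\<^sup>2 \<le> (norm y * C)\<^sup>2" by (simp add: power_mult_distrib mult.commute)
  qed (use C in simp)
  have gC: "g (scaleC_l2 c x) = scaleC_l2 c (g x)" for c x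
    by (rule l2_eqI) (simp add: g f_def mult.left_commute suminf_mult[OF sm])
  have "bounded_linear g"
  proof (rule bounded_linear_intro[OF _ _ gn])
    show "g (x + y) = g x + g y" for x y
      by (rule l2_eqI) (simp add: g f_def suminf_add[OF sm sm] distrib_left)
    show "g (r *\<^sub>R x) = r *\<^sub>R g x" for r x by (simp add: scaleR_l2_def gC)
  qed
  then have A: "bop_apply (Abs_bop g) = g" using gC by (intro Abs_bop_inverse) auto
  show thesis
  proof (rule that[of "Abs_bop g"])
    show "norm (Abs_bop g) \<le> C" using gn C by (intro norm_bop_le) (auto simp: A mult.commute)
    fix i j
    have "(\<Sum>k. m i k * l2_nth (l2_unit j) k) = (\<Sum>k\<in>{j}. m i k * l2_nth (l2_unit j) k)"
      by (rule suminf_finite) (auto simp: l2_unit.rep_eq)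
    then show "l2_nth (Abs_bop g \<cdot> l2_unit j) i = m i j"
      by (simp add: A g f_def l2_unit.rep_eq)
  qed
qed


section \<open>Toeplitz operators\<close>

lemma C_2pi_iff: "a \<in> C_2pi \<longleftrightarrow> continuous_on {0..2*pi} a \<and> a 0 = a (2*pi)"
  by (simp add: C_2pi_def)

lemma C_2pi_continuous: "a \<in> C_2pi \<Longrightarrow> continuous_on {0..2*pi} a"
  by (simp add: C_2pi_def)

lemma C_2pi_const [simp]: "(\<lambda>_. c) \<in> C_2pi"
  by (simp add: C_2pi_def)

lemma C_2pi_cis: "(\<lambda>t. cis (of_int k * t)) \<in> C_2pi"
  using cis_multiple_2pi[of "of_int k"] by (auto simp: C_2pi_iff mult_ac intro!: continuous_intros)

lemma C_2pi_mult: "a \<in> C_2pi \<Longrightarrow> b \<in> C_2pi \<Longrightarrow> (\<lambda>t. a t * b t) \<in> C_2pi"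
  and C_2pi_add: "a \<in> C_2pi \<Longrightarrow> b \<in> C_2pi \<Longrightarrow> (\<lambda>t. a t + b t) \<in> C_2pi"
  and C_2pi_diff: "a \<in> C_2pi \<Longrightarrow> b \<in> C_2pi \<Longrightarrow> (\<lambda>t. a t - b t) \<in> C_2pi"
  by (auto simp: C_2pi_iff intro!: continuous_intros)

lemma C_2pi_bounded:
  assumes "a \<in> C_2pi"
  obtains M where "M > 0" "\<And>t. t \<in> {0..2*pi} \<Longrightarrow> cmod (a t) \<le> M"
proof -
  have "bounded (a ` {0..2*pi})"
    by (intro compact_imp_bounded compact_continuous_image C_2pi_continuous assms) auto
  then show thesis unfolding bounded_pos by (auto intro: that)
qed

lemma has_integral_cis:
  "((\<lambda>t. cis (of_int k * t)) has_integral (if k = 0 then 2 * pi else 0)) {0..2*pi}"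
proof (cases "k = 0")
  case True
  then show ?thesis using has_integral_const_real[of "1 :: complex" 0 "2 * pi"]
    by (simp add: scaleR_conv_of_real)
next
  case False
  define F where "F z = exp (\<i> * of_int k * z) / (\<i> * of_int k)" for z :: complex
  have cis: "cis (of_int k * t) = exp (\<i> * of_int k * of_real t)" for t
    by (simp add: cis_conv_exp mult_ac)
  have "((\<lambda>t. F (of_real t)) has_vector_derivative cis (of_int k * t)) (at t within {0..2*pi})" for t
    unfolding F_def cis
    by (rule has_vector_derivative_real_field) (use False in \<open>auto intro!: derivative_eq_intros\<close>)
  then have "((\<lambda>t. cis (of_int k * t)) has_integral (F (of_real (2*pi)) - F (of_real 0))) {0..2*pi}"
    by (intro fundamental_theorem_of_calculus) auto
  moreover have "F (of_real (2*pi)) = F (of_real 0)"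
    unfolding F_def cis[symmetric] using C_2pi_cis[of k] by (simp add: C_2pi_iff)
  ultimately show ?thesis using False by simp
qed

lemma fourier_coeff_cis:
  "fourier_coeff (\<lambda>t. cis (of_int k * t)) m = (if k = m then 1 else 0)"
proof -
  have "(\<lambda>t. cis (of_int k * t) * cis (- (of_int m * t))) = (\<lambda>t. cis (of_int (k - m) * t))"
    by (simp add: cis_mult algebra_simps)
  then show ?thesis using integral_unique[OF has_integral_cis[of "k - m"]]
    by (simp add: fourier_coeff_def)
qed

lemma fourier_coeff_mult_cis:
  "fourier_coeff (\<lambda>t. a t * cis (of_int k * t)) m = fourier_coeff a (m - k)"
proof -
  have "(\<lambda>t. a t * cis (of_int k * t) * cis (- (of_int m * t)))
      = (\<lambda>t. a t * cis (- (of_int (m - k) * t)))"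
    by (simp add: cis_mult algebra_simps)
  then show ?thesis by (simp add: fourier_coeff_def)
qed

lemma fourier_integrable:
  assumes "continuous_on {0..2*pi} a"
  shows "(\<lambda>t. a t * cis (- (of_int k * t))) integrable_on {0..2*pi}"
  using assms by (intro integrable_continuous_interval continuous_intros)

lemma fourier_coeff_add:
  assumes "continuous_on {0..2*pi} a" "continuous_on {0..2*pi} b"
  shows "fourier_coeff (\<lambda>t. a t + b t) k = fourier_coeff a k + fourier_coeff b k"
  using Henstock_Kurzweil_Integration.integral_add[OF fourier_integrable[OF assms(1)]
      fourier_integrable[OF assms(2)], of k k]
  by (simp add: fourier_coeff_def distrib_right add_divide_distrib)

lemma fourier_coeff_diff:
  assumes "continuous_on {0..2*pi} a" "continuous_on {0..2*pi} b"
  shows "fourier_coeff (\<lambda>t. a t - b t) k = fourier_coeff a k - fourier_coeff b k"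
  using Henstock_Kurzweil_Integration.integral_diff[OF fourier_integrable[OF assms(1)]
      fourier_integrable[OF assms(2)], of k k]
  by (simp add: fourier_coeff_def left_diff_distrib diff_divide_distrib)

lemma fourier_coeff_scale: "fourier_coeff (\<lambda>t. c * a t) k = c * fourier_coeff a k"
  by (simp add: fourier_coeff_def mult.assoc)

text \<open>The sign of the frequencies fits the matrix entry
  \<open>fourier_coeff a (j - i)\<close>: with it the form of the matrix is the integral of
  \<open>a\<close> against \<open>cnj (trigsum n x)\<close> times
  \<open>trigsum n y\<close>.\<close>

definition trigsum :: "nat \<Rightarrow> (nat \<Rightarrow> complex) \<Rightarrow> real \<Rightarrow> complex"
  where "trigsum n x t = (\<Sum>i<n. x i * cis (- (real i * t)))"

lemma continuous_on_trigsum [continuous_intros]: "continuous_on S (trigsum n x)"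
  unfolding trigsum_def[abs_def] by (intro continuous_intros)

lemma toeplitz_form:
  assumes "continuous_on {0..2*pi} a"
  shows "((\<lambda>t. a t * cnj (trigsum n x t) * trigsum n y t) has_integral
    2 * pi * (\<Sum>i<n. \<Sum>j<n. cnj (x i) * fourier_coeff a (int j - int i) * y j)) {0..2*pi}"
proof -
  have hi: "((\<lambda>t. a t * cis (- (of_int k * t))) has_integral 2 * pi * fourier_coeff a k) {0..2*pi}" for k
    using integrable_integral[OF fourier_integrable[OF assms, of k]] by (simp add: fourier_coeff_def)
  have "((\<lambda>t. \<Sum>i<n. \<Sum>j<n. (cnj (x i) * y j) * (a t * cis (- (of_int (int j - int i) * t)))) has_integral
     (\<Sum>i<n. \<Sum>j<n. (cnj (x i) * y j) * (2 * pi * fourier_coeff a (int j - int i)))) {0..2*pi}"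
    by (intro has_integral_sum has_integral_mult_right hi finite_lessThan)
  moreover have "(\<lambda>t. \<Sum>i<n. \<Sum>j<n. (cnj (x i) * y j) * (a t * cis (- (of_int (int j - int i) * t))))
      = (\<lambda>t. a t * cnj (trigsum n x t) * trigsum n y t)"
  proof
    fix t
    have X: "cnj (trigsum n x t) = (\<Sum>i<n. cnj (x i) * cis (real i * t))"
      by (simp add: trigsum_def cis_cnj)
    have "a t * cnj (trigsum n x t) * trigsum n y t
        = (\<Sum>i<n. \<Sum>j<n. a t * ((cnj (x i) * cis (real i * t)) * (y j * cis (- (real j * t)))))"
      unfolding mult.assoc[of "a t"] X unfolding trigsum_def sum_product unfolding sum_distrib_left ..
    also have "\<dots> = (\<Sum>i<n. \<Sum>j<n. (cnj (x i) * y j) * (a t * cis (- (of_int (int j - int i) * t))))"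
    proof (intro sum.cong refl)
      fix i j
      have "cis (- (of_int (int j - int i) * t)) = cis (real i * t) * cis (- (real j * t))"
        by (simp add: cis_mult algebra_simps)
      then show "a t * ((cnj (x i) * cis (real i * t)) * (y j * cis (- (real j * t))))
          = (cnj (x i) * y j) * (a t * cis (- (of_int (int j - int i) * t)))"
        by (simp only: mult_ac)
    qed
    finally show "(\<Sum>i<n. \<Sum>j<n. (cnj (x i) * y j) * (a t * cis (- (of_int (int j - int i) * t))))
        = a t * cnj (trigsum n x t) * trigsum n y t" ..
  qed
  moreover have "(\<Sum>i<n. \<Sum>j<n. (cnj (x i) * y j) * (2 * pi * fourier_coeff a (int j - int i)))
      = 2 * pi * (\<Sum>i<n. \<Sum>j<n. cnj (x i) * fourier_coeff a (int j - int i) * y j)"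
    by (simp add: sum_distrib_left mult_ac)
  ultimately show ?thesis by simp
qed

text \<open>This is \<open>toeplitz_form\<close> for the symbol 1, whose matrix is the
  identity.\<close>

lemma parseval_trigsum:
  "((\<lambda>t. (cmod (trigsum n x t))\<^sup>2) has_integral 2 * pi * (\<Sum>i<n. (cmod (x i))\<^sup>2)) {0..2*pi}"
proof -
  have fc: "fourier_coeff (\<lambda>_. 1) k = (if k = 0 then 1 else 0)" for k
    using fourier_coeff_cis[of 0 k] by simp
  have "(\<Sum>i<n. \<Sum>j<n. cnj (x i) * fourier_coeff (\<lambda>_. 1) (int j - int i) * x j)
      = (\<Sum>i<n. \<Sum>j<n. if i = j then cnj (x i) * x i else 0)"
    by (intro sum.cong refl) (auto simp: fc)
  also have "\<dots> = of_real (\<Sum>i<n. (cmod (x i))\<^sup>2)"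
    unfolding of_real_sum complex_norm_square by (simp add: sum.delta' mult.commute)
  finally have "((\<lambda>t. 1 * cnj (trigsum n x t) * trigsum n x t) has_integral
      of_real (2 * pi * (\<Sum>i<n. (cmod (x i))\<^sup>2))) {0..2*pi}"
    using toeplitz_form[of "\<lambda>_. 1" n x x] by simp
  from has_integral_linear[OF this bounded_linear_Re]
  have "((\<lambda>t. Re (trigsum n x t * cnj (trigsum n x t))) has_integral
      2 * pi * (\<Sum>i<n. (cmod (x i))\<^sup>2)) {0..2*pi}"
    by (simp add: o_def mult.commute)
  then show ?thesis unfolding complex_norm_square[symmetric] by simp
qed

text \<open>The form of a section is an integral, bounded by \<open>M\<close> times the mean of the
  squared norms of the two trigonometric sums. That is the hypothesis of
  \<open>bop_of_matrix\<close>, which gives existence and the norm bound; uniqueness in the definite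
  description holds because entries determine an operator.\<close>

lemma toeplitz_spec:
  assumes a: "a \<in> C_2pi" and M: "M > 0" "\<And>t. t \<in> {0..2*pi} \<Longrightarrow> cmod (a t) \<le> M"
  shows "l2_nth (toeplitz a \<cdot> l2_unit j) i = fourier_coeff a (int j - int i)" (is ?entry)
    and "norm (toeplitz a) \<le> M"
proof -
  have "cmod (\<Sum>i<n. \<Sum>j<n. cnj (x i) * fourier_coeff a (int j - int i) * y j)
      \<le> M * ((\<Sum>i<n. (cmod (x i))\<^sup>2) + (\<Sum>i<n. (cmod (y i))\<^sup>2)) / 2" (is "cmod ?S \<le> ?R") for n x y
  proof -
    let ?X = "trigsum n x" and ?Y = "trigsum n y"
    have "cmod (2 * pi * ?S) \<le> M / 2 * (2 * pi * (\<Sum>i<n. (cmod (x i))\<^sup>2) + 2 * pi * (\<Sum>i<n. (cmod (y i))\<^sup>2))"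
    proof -
      have i1: "((\<lambda>t. a t * cnj (?X t) * ?Y t) has_integral 2 * pi * ?S) {0..2*pi}"
        by (rule toeplitz_form[OF C_2pi_continuous[OF a]])
      have i2: "((\<lambda>t. M / 2 * ((cmod (?X t))\<^sup>2 + (cmod (?Y t))\<^sup>2)) has_integral
          M / 2 * (2 * pi * (\<Sum>i<n. (cmod (x i))\<^sup>2) + 2 * pi * (\<Sum>i<n. (cmod (y i))\<^sup>2))) {0..2*pi}"
        by (intro has_integral_mult_right has_integral_add parseval_trigsum)
      have "norm (integral {0..2*pi} (\<lambda>t. a t * cnj (?X t) * ?Y t))
          \<le> integral {0..2*pi} (\<lambda>t. M / 2 * ((cmod (?X t))\<^sup>2 + (cmod (?Y t))\<^sup>2))"
      proof (rule Henstock_Kurzweil_Integration.integral_norm_bound_integral)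
        fix t :: real assume t: "t \<in> {0..2*pi}"
        have "cmod (a t * cnj (?X t) * ?Y t) \<le> M * (cmod (?X t) * cmod (?Y t))"
          using M(2)[OF t] by (simp add: norm_mult mult.assoc mult_right_mono)
        also have "\<dots> \<le> M * (((cmod (?X t))\<^sup>2 + (cmod (?Y t))\<^sup>2) / 2)"
          using sum_squares_bound[of "cmod (?X t)" "cmod (?Y t)"] M(1) by (intro mult_left_mono) auto
        finally show "cmod (a t * cnj (?X t) * ?Y t) \<le> M / 2 * ((cmod (?X t))\<^sup>2 + (cmod (?Y t))\<^sup>2)"
          by simp
      qed (use i1 i2 in blast)+
      then show ?thesis unfolding integral_unique[OF i1] integral_unique[OF i2] .
    qed
    also have "\<dots> = 2 * pi * ?R" by (simp add: algebra_simps)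
    finally show ?thesis by (simp add: norm_mult)
  qed
  from bop_of_matrix[OF M(1) this] obtain A
    where A: "\<And>i j. l2_nth (A \<cdot> l2_unit j) i = fourier_coeff a (int j - int i)" "norm A \<le> M" by blast
  have "toeplitz a = A"
    unfolding toeplitz_def using A(1) by (intro the_equality) (auto intro: bop_eqI_entries)
  then show ?entry "norm (toeplitz a) \<le> M" using A by auto
qed

lemma toeplitz_entry:
  assumes "a \<in> C_2pi"
  shows "l2_nth (toeplitz a \<cdot> l2_unit j) i = fourier_coeff a (int j - int i)"
proof -
  obtain M where "M > 0" "\<And>t. t \<in> {0..2*pi} \<Longrightarrow> cmod (a t) \<le> M" using C_2pi_bounded[OF assms] by blast
  then show ?thesis by (rule toeplitz_spec(1)[OF assms])
qed

lemma toeplitz_cong: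
  assumes "\<And>t. t \<in> {0..2*pi} \<Longrightarrow> a t = b t"
  shows "toeplitz a = toeplitz b"
proof -
  have "fourier_coeff a = fourier_coeff b"
    unfolding fourier_coeff_def
    by (intro ext arg_cong[where f = "\<lambda>z. z / _"] Henstock_Kurzweil_Integration.integral_cong) (simp add: assms)
  then show ?thesis by (simp add: toeplitz_def)
qed

lemma toeplitz_add:
  assumes "a \<in> C_2pi" "b \<in> C_2pi"
  shows "toeplitz (\<lambda>t. a t + b t) = toeplitz a + toeplitz b"
  by (rule bop_eqI_entries)
    (simp add: toeplitz_entry assms C_2pi_add fourier_coeff_add C_2pi_continuous)

lemma toeplitz_diff:
  assumes "a \<in> C_2pi" "b \<in> C_2pi"
  shows "toeplitz (\<lambda>t. a t - b t) = toeplitz a - toeplitz b"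
  by (rule bop_eqI_entries)
    (simp add: toeplitz_entry assms C_2pi_diff fourier_coeff_diff C_2pi_continuous)

lemma toeplitz_scale:
  assumes "a \<in> C_2pi"
  shows "toeplitz (\<lambda>t. c * a t) = scaleC_bop c (toeplitz a)"
  by (rule bop_eqI_entries)
    (simp add: toeplitz_entry assms C_2pi_mult fourier_coeff_scale)

lemma toeplitz_const: "toeplitz (\<lambda>_. of_real c) = c *\<^sub>R 1"
proof (rule bop_eqI_entries)
  fix i j
  have "fourier_coeff (\<lambda>_. complex_of_real c) k = of_real c * (if k = 0 then 1 else 0)" for k
    using fourier_coeff_cis[of 0 k] fourier_coeff_scale[of "of_real c" "\<lambda>_. 1" k] by simp
  then show "l2_nth (toeplitz (\<lambda>_. of_real c) \<cdot> l2_unit j) i = l2_nth ((c *\<^sub>R 1) \<cdot> l2_unit j) i"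
    by (simp add: toeplitz_entry l2_unit.rep_eq)
qed

lemma toeplitz_tendsto:
  assumes "\<And>n. b n \<in> C_2pi" "a \<in> C_2pi" "uniform_limit {0..2*pi} b a sequentially"
  shows "(\<lambda>n. toeplitz (b n)) \<longlonglongrightarrow> toeplitz a"
proof (rule LIMSEQ_I)
  fix e :: real assume e: "e > 0"
  have "\<forall>\<^sub>F n in sequentially. norm (toeplitz (b n) - toeplitz a) < e"
    using uniform_limitD[OF assms(3) half_gt_zero[OF e]]
  proof eventually_elim
    case (elim n)
    have "norm (toeplitz (\<lambda>t. b n t - a t)) \<le> e / 2"
      using elim e by (intro toeplitz_spec(2) C_2pi_diff assms) (auto simp: dist_norm intro: less_imp_le)
    then show ?case using e by (simp add: toeplitz_diff assms)
  qed
  then show "\<exists>N. \<forall>n\<ge>N. norm (toeplitz (b n) - toeplitz a) < e" by (simp add: eventually_sequentially)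
qed

section \<open>Density of trigonometric polynomials\<close>

inductive trigpoly :: "(real \<Rightarrow> complex) \<Rightarrow> bool"
  where
    cis: "trigpoly (\<lambda>t. cis (of_int k * t))"
  | scale: "trigpoly f \<Longrightarrow> trigpoly (\<lambda>t. c * f t)"
  | add: "trigpoly f \<Longrightarrow> trigpoly g \<Longrightarrow> trigpoly (\<lambda>t. f t + g t)"

lemma trigpoly_C_2pi: "trigpoly f \<Longrightarrow> f \<in> C_2pi"
  by (induction rule: trigpoly.induct) (simp_all add: C_2pi_cis C_2pi_mult C_2pi_add)

lemma trigpoly_const: "trigpoly (\<lambda>_. c)"
  using trigpoly.scale[OF trigpoly.cis[of 0], of c] by simp

lemma trigpoly_mult:
  assumes "trigpoly f" "trigpoly g"
  shows "trigpoly (\<lambda>t. f t * g t)"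
  using assms(1)
proof induction
  case (cis k)
  show ?case using assms(2)
  proof induction
    case (cis l)
    have "(\<lambda>t. cis (of_int k * t) * cis (of_int l * t)) = (\<lambda>t. cis (of_int (k + l) * t))"
      by (simp add: cis_mult algebra_simps)
    then show ?case using trigpoly.cis by metis
  next
    case (scale f c)
    then show ?case using trigpoly.scale[OF scale.IH, of c] by (simp add: mult.left_commute)
  next
    case (add f g)
    then show ?case using trigpoly.add[OF add.IH] by (simp add: distrib_left)
  qed
next
  case (scale f c)
  then show ?case using trigpoly.scale[OF scale.IH, of c] by (simp add: mult.assoc)
next
  case (add f g)
  then show ?case using trigpoly.add[OF add.IH] by (simp add: distrib_right)
qed

text \<open>A real-linear functional on the plane is fixed by its values at 1 and
  \<open>\<i>\<close>, so on the circle it is a combination of \<open>cos\<close> and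
  \<open>sin\<close>, hence of \<open>cis t\<close> and \<open>cis (- t)\<close>.\<close>

lemma trigpoly_real_polynomial_cis:
  assumes "real_polynomial_function f"
  shows "trigpoly (\<lambda>t. complex_of_real (f (cis t)))"
  using assms
proof induction
  case (linear f)
  have "f (cis t) = cos t * f 1 + sin t * f \<i>" for t
  proof -
    have "cis t = cos t *\<^sub>R 1 + sin t *\<^sub>R \<i>" by (simp add: complex_eq_iff)
    then show ?thesis using linear
      by (simp add: linear_add linear_scale bounded_linear.linear)
  qed
  then have "(\<lambda>t. complex_of_real (f (cis t)))
      = (\<lambda>t. (of_real (f 1) / 2 + of_real (f \<i>) / (2 * \<i>)) * cis (of_int 1 * t)
          + (of_real (f 1) / 2 - of_real (f \<i>) / (2 * \<i>)) * cis (of_int (-1) * t))"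
    by (auto simp: complex_eq_iff fun_eq_iff field_simps)
  then show ?case by (simp only:) (intro trigpoly.intros)
next
  case (const c)
  show ?case by (rule trigpoly_const)
next
  case (add f g)
  show ?case unfolding of_real_add by (rule trigpoly.add[OF add.IH])
next
  case (mult f g)
  show ?case unfolding of_real_mult by (rule trigpoly_mult[OF mult.IH])
qed

text \<open>The symbol is transported to a function \<open>F\<close> on the unit circle, where
  Stone-Weierstrass applies; polynomials in the coordinates of \<open>cis t\<close> are
  trigonometric polynomials.\<close>

lemma trigpoly_dense:
  assumes a: "a \<in> C_2pi" and e: "e > 0"
  obtains f where "trigpoly f" "\<And>t. t \<in> {0..2*pi} \<Longrightarrow> cmod (a t - f t) < e"
proof -
  define F where "F z = a (SOME t. t \<in> {0..2*pi} \<and> cis t = z)" for z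
  have F: "F (cis t) = a t" if t: "t \<in> {0..2*pi}" for t
  proof -
    define s where "s = (SOME s. s \<in> {0..2*pi} \<and> cis s = cis t)"
    have s: "s \<in> {0..2*pi}" "cis s = cis t"
      using someI[of "\<lambda>s. s \<in> {0..2*pi} \<and> cis s = cis t" t] t by (auto simp: s_def)
    then have "cos s = cos t" "sin s = sin t" by (auto simp: complex_eq_iff)
    then obtain n :: int where "s = t + 2 * pi * n" using sin_cos_eq_iff[of s t] by blast
    then have n: "s - t = 2 * pi * n" by simp
    \<comment> \<open>Two parameters of the same point are equal or are the two endpoints, where the
      values of \<open>a\<close> agree; so the choice in \<open>F\<close> does not matter.\<close>
    have "\<bar>s - t\<bar> \<le> 2 * pi" using s(1) t by auto
    then have "\<bar>real_of_int n\<bar> \<le> 1" unfolding n by (simp add: abs_mult)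
    then have "n = 0 \<or> n = 1 \<or> n = -1" by linarith
    then have "s - t = 0 \<or> s - t = 2 * pi \<or> s - t = - (2 * pi)" unfolding n by force
    then have "s = t \<or> s = 2 * pi \<and> t = 0 \<or> s = 0 \<and> t = 2 * pi"
      using s(1) t unfolding atLeastAtMost_iff by linarith
    then have "a s = a t" using a by (auto simp: C_2pi_iff)
    then show ?thesis by (simp add: F_def s_def)
  qed
  have sph: "sphere 0 1 = cis ` {0..2*pi}"
  proof (intro equalityI subsetI)
    fix z :: complex assume "z \<in> sphere 0 1"
    then have "z = cis (Arg2pi z)" using Arg2pi_eq[of z] by (simp add: cis_conv_exp)
    then show "z \<in> cis ` {0..2*pi}" using Arg2pi_ge_0[of z] Arg2pi_lt_2pi[of z] by force
  qed auto
  \<comment> \<open>Preimages of closed sets under \<open>F\<close> are images under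
    \<open>cis\<close> of compact subsets of the interval, hence closed.\<close>
  have "continuous_on (sphere 0 1) F"
    unfolding continuous_on_closed_vimage[OF closed_sphere]
  proof (intro allI impI)
    fix B :: "complex set" assume "closed B"
    have eq: "F -` B \<inter> sphere 0 1 = cis ` ({0..2*pi} \<inter> a -` B)"
    proof (intro equalityI subsetI)
      fix z assume z: "z \<in> F -` B \<inter> sphere 0 1"
      then obtain t where "t \<in> {0..2*pi}" "z = cis t" unfolding sph by blast
      then show "z \<in> cis ` ({0..2*pi} \<inter> a -` B)" using z F by simp
    next
      fix z assume "z \<in> cis ` ({0..2*pi} \<inter> a -` B)"
      then obtain t where "t \<in> {0..2*pi}" "a t \<in> B" "z = cis t" by blast
      then show "z \<in> F -` B \<inter> sphere 0 1" using F by simp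
    qed
    have "closed ({0..2*pi} \<inter> a -` B)"
      using continuous_closed_preimage[OF C_2pi_continuous[OF a] _ \<open>closed B\<close>] by simp
    then have "compact ({0..2*pi} \<inter> ({0..2*pi} \<inter> a -` B))" by (rule compact_Int_closed[OF compact_Icc])
    then have "compact ({0..2*pi} \<inter> a -` B)" by (simp only: Int_left_absorb)
    moreover have "continuous_on ({0..2*pi} \<inter> a -` B) cis"
      by (rule continuous_on_cis[OF continuous_on_id])
    ultimately have "compact (cis ` ({0..2*pi} \<inter> a -` B))" by (rule_tac compact_continuous_image)
    then show "closed (F -` B \<inter> sphere 0 1)" unfolding eq by (rule compact_imp_closed)
  qed
  from Stone_Weierstrass_polynomial_function[OF compact_sphere this e]
  obtain g where g: "polynomial_function g" "\<And>z. z \<in> sphere 0 1 \<Longrightarrow> cmod (F z - g z) < e"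
    by (elim exE conjE) blast
  have poly: "real_polynomial_function (\<lambda>z. L (g z))" if "bounded_linear L" for L :: "complex \<Rightarrow> real"
    using g(1) that by (simp add: polynomial_function_def o_def)
  have "trigpoly (\<lambda>t. of_real (Re (g (cis t))) + \<i> * of_real (Im (g (cis t))))"
    by (rule trigpoly.add[OF trigpoly_real_polynomial_cis[OF poly[OF bounded_linear_Re]]
          trigpoly.scale[OF trigpoly_real_polynomial_cis[OF poly[OF bounded_linear_Im]]]])
  then have "trigpoly (\<lambda>t. g (cis t))" by (simp add: complex_eq[symmetric])
  moreover have "cmod (a t - g (cis t)) < e" if "t \<in> {0..2*pi}" for t
    using g(2)[of "cis t"] F[OF that] by simp
  ultimately show thesis by (rule that)
qed

lemma trigpoly_approx_seq:
  assumes "a \<in> C_2pi"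
  obtains f where "\<And>n. trigpoly (f n)" "uniform_limit {0..2*pi} f a sequentially"
proof -
  have "\<exists>f. trigpoly f \<and> (\<forall>t\<in>{0..2*pi}. cmod (a t - f t) < inverse (real (Suc n)))" for n
    by (rule trigpoly_dense[OF assms, of "inverse (real (Suc n))"]) auto
  then obtain f where f: "\<And>n. trigpoly (f n)"
    "\<And>n t. t \<in> {0..2*pi} \<Longrightarrow> cmod (a t - f n t) < inverse (real (Suc n))" by metis
  have "uniform_limit {0..2*pi} f a sequentially"
    using f(2) by (intro uniform_limit_inverse_Suc) (simp add: dist_norm norm_minus_commute)
  with f(1) show thesis by (rule that)
qed

text \<open>The second factor maps unit vector \<open>j\<close> to unit vector \<open>j - k\<close>
  whenever \<open>j \<ge> k\<close>, and on such columns the two terms agree since entries depend on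
  index differences only. At most \<open>nat k\<close> columns survive.\<close>

lemma compact_toeplitz_mult_cis:
  assumes a: "a \<in> C_2pi"
  shows "compact_op (toeplitz a * toeplitz (\<lambda>t. cis (of_int k * t)) - toeplitz (\<lambda>t. a t * cis (of_int k * t)))"
proof (rule compact_op_finite_columns)
  fix j assume "j \<ge> nat k"
  then have j: "k \<le> int j" by simp
  have "toeplitz (\<lambda>t. cis (of_int k * t)) \<cdot> l2_unit j = l2_unit (nat (int j - k))"
    by (rule l2_eqI) (use j in \<open>auto simp: toeplitz_entry C_2pi_cis fourier_coeff_cis l2_unit.rep_eq\<close>)
  moreover have "toeplitz a \<cdot> l2_unit (nat (int j - k)) = toeplitz (\<lambda>t. a t * cis (of_int k * t)) \<cdot> l2_unit j"
  proof (rule l2_eqI)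
    fix i
    have eq: "int j - k - int i = int j - int i - k" by simp
    show "l2_nth (toeplitz a \<cdot> l2_unit (nat (int j - k))) i
        = l2_nth (toeplitz (\<lambda>t. a t * cis (of_int k * t)) \<cdot> l2_unit j) i"
      using j by (simp add: toeplitz_entry C_2pi_cis C_2pi_mult a fourier_coeff_mult_cis) (simp only: eq)
  qed
  ultimately show "(toeplitz a * toeplitz (\<lambda>t. cis (of_int k * t)) -
      toeplitz (\<lambda>t. a t * cis (of_int k * t))) \<cdot> l2_unit j = 0" by simp
qed

lemma compact_toeplitz_mult_trigpoly:
  assumes a: "a \<in> C_2pi" and "trigpoly b"
  shows "compact_op (toeplitz a * toeplitz b - toeplitz (\<lambda>t. a t * b t))"
  using assms(2)
proof induction
  case (cis k)
  show ?case by (rule compact_toeplitz_mult_cis[OF a])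
next
  case (scale f c)
  have f: "f \<in> C_2pi" by (rule trigpoly_C_2pi[OF scale.hyps])
  have "toeplitz (\<lambda>t. a t * (c * f t)) = scaleC_bop c (toeplitz (\<lambda>t. a t * f t))"
    using toeplitz_scale[OF C_2pi_mult[OF a f], of c] by (simp add: mult.left_commute)
  moreover have "toeplitz a * scaleC_bop c (toeplitz f) - scaleC_bop c (toeplitz (\<lambda>t. a t * f t))
     = scaleC_bop c (toeplitz a * toeplitz f - toeplitz (\<lambda>t. a t * f t))"
    by (rule bop_eqI) (simp add: bop_apply_scaleC scaleC_l2_diff)
  ultimately show ?case
    using compact_op_scaleC[OF scale.IH, of c] by (simp add: toeplitz_scale[OF f])
next
  case (add f g)
  have fg: "f \<in> C_2pi" "g \<in> C_2pi" using add.hyps by (auto intro: trigpoly_C_2pi)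
  have "toeplitz (\<lambda>t. a t * (f t + g t)) = toeplitz (\<lambda>t. a t * f t) + toeplitz (\<lambda>t. a t * g t)"
    using toeplitz_add[OF C_2pi_mult[OF a fg(1)] C_2pi_mult[OF a fg(2)]] by (simp add: distrib_left)
  then show ?case
    using compact_op_add[OF add.IH] by (simp add: toeplitz_add[OF fg] algebra_simps)
qed

text \<open>Approximating only the right factor suffices: the difference depends continuously on
  \<open>b\<close> in the supremum norm, and compactness survives norm limits.\<close>

lemma compact_toeplitz_mult:
  assumes a: "a \<in> C_2pi" and b: "b \<in> C_2pi"
  shows "compact_op (toeplitz a * toeplitz b - toeplitz (\<lambda>t. a t * b t))"
proof -
  obtain f where f: "\<And>n. trigpoly (f n)" "uniform_limit {0..2*pi} f b sequentially"
    using trigpoly_approx_seq[OF b] by blast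
  have fC: "f n \<in> C_2pi" for n using f(1) by (rule trigpoly_C_2pi)
  have "uniform_limit {0..2*pi} (\<lambda>n t. a t * f n t) (\<lambda>t. a t * b t) sequentially"
    using f(2) C_2pi_continuous[OF a] C_2pi_continuous[OF b]
    by (intro uniform_lim_mult uniform_limit_const compact_imp_bounded compact_continuous_image) auto
  then have "(\<lambda>n. toeplitz a * toeplitz (f n) - toeplitz (\<lambda>t. a t * f n t))
      \<longlonglongrightarrow> toeplitz a * toeplitz b - toeplitz (\<lambda>t. a t * b t)"
    using f(2) fC a b by (intro tendsto_intros toeplitz_tendsto C_2pi_mult)
  then show ?thesis by (rule compact_op_limit) (rule compact_toeplitz_mult_trigpoly[OF a f(1)])
qed


section \<open>Symbols\<close>

lemma cinner_add_left: "cinner (x + y) z = cinner x z + cinner y z"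
  using suminf_add[OF summable_cinner[of x z] summable_cinner[of y z]]
  by (simp add: cinner.rep_eq distrib_right)

lemma cinner_add_right: "cinner x (y + z) = cinner x y + cinner x z"
  using suminf_add[OF summable_cinner[of x y] summable_cinner[of x z]]
  by (simp add: cinner.rep_eq distrib_left)

lemma cinner_scaleC_left: "cinner (scaleC_l2 c x) y = cnj c * cinner x y"
  using suminf_mult[OF summable_cinner[of x y], of "cnj c"]
  by (simp add: cinner.rep_eq mult.assoc)

lemma cinner_commute: "cnj (cinner x y) = cinner y x"
  using bounded_linear.suminf[OF bounded_linear_cnj summable_cinner[of x y]]
  by (simp add: cinner.rep_eq mult.commute)

text \<open>Real and imaginary parts are bounded separately, whence the crude factor 2; it serves
  only to show that a limit is zero.\<close>

lemma cmod_cinner_le: "cmod (cinner x y) \<le> 2 * norm x * norm y"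
proof -
  have "cmod (cinner x y) \<le> \<bar>Re (cinner x y)\<bar> + \<bar>Im (cinner x y)\<bar>" by (rule cmod_le)
  also have "\<dots> \<le> norm x * norm y + norm x * norm (scaleC_l2 \<i> y)"
    unfolding Re_cinner Im_cinner abs_minus_cancel by (intro add_mono Cauchy_Schwarz_ineq2)
  finally show ?thesis by (simp add: norm_scaleC_l2)
qed

definition shifted :: "nat \<Rightarrow> (nat \<Rightarrow> complex) \<Rightarrow> nat \<Rightarrow> l2"
  where "shifted m c n = (\<Sum>i<m. scaleC_l2 (c i) (l2_unit (i + n)))"

lemma cinner_shifted: "cinner (shifted m c n) y = (\<Sum>i<m. cnj (c i) * l2_nth y (i + n))"
proof (induction m)
  case 0
  then show ?case by (simp add: shifted_def cinner.rep_eq)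
next
  case (Suc m)
  then show ?case
    by (simp add: shifted_def cinner_add_left cinner_scaleC_left cinner_l2_unit)
qed

lemma l2_nth_shifted: "i < m \<Longrightarrow> l2_nth (shifted m c n) (i + n) = c i"
proof -
  assume "i < m"
  have "l2_nth (shifted m c n) (i + n) = (\<Sum>j<m. if i = j then c j else 0)"
    unfolding shifted_def l2_nth_sum by (intro sum.cong) (auto simp: l2_unit.rep_eq)
  then show ?thesis using \<open>i < m\<close> by (simp add: sum.delta')
qed

lemma norm_shifted_sq: "(norm (shifted m c n))\<^sup>2 = (\<Sum>i<m. (cmod (c i))\<^sup>2)"
proof -
  have "cinner (shifted m c n) (shifted m c n) = (\<Sum>i<m. cnj (c i) * c i)"
    unfolding cinner_shifted by (intro sum.cong) (simp_all add: l2_nth_shifted)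
  also have "\<dots> = of_real (\<Sum>i<m. (cmod (c i))\<^sup>2)"
    unfolding of_real_sum complex_norm_square by (simp add: mult.commute)
  finally have "Re (cinner (shifted m c n) (shifted m c n)) = (\<Sum>i<m. (cmod (c i))\<^sup>2)" by simp
  then show ?thesis by (simp add: Re_cinner power2_norm_eq_inner)
qed

text \<open>The offset \<open>n\<close> cancels in the index difference, so the Toeplitz form is
  constant along the shifts.\<close>

lemma cinner_toeplitz_shifted:
  assumes "a \<in> C_2pi"
  shows "cinner (shifted m c n) (toeplitz a \<cdot> shifted m c n)
    = (\<Sum>i<m. \<Sum>j<m. cnj (c i) * fourier_coeff a (int j - int i) * c j)"
  unfolding cinner_shifted
  by (subst shifted_def)
    (simp add: linear_sum[OF linear_bop_apply] bop_apply_scaleC l2_nth_sum toeplitz_entry assms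
      sum_distrib_left mult_ac)

text \<open>The shifted vectors stay in a ball, whose image under \<open>E\<close> is covered by
  small balls around finitely many points \<open>x\<close>. The inner product of the shifted vector
  with each \<open>x\<close> tends to zero, since coordinates of \<open>x\<close> do, and finitely
  many such limits are uniform.\<close>

lemma cinner_compact_shifted:
  assumes E: "compact_op E"
  shows "(\<lambda>n. cinner (shifted m c n) (E \<cdot> shifted m c n)) \<longlonglongrightarrow> 0"
proof (rule LIMSEQ_I)
  fix e :: real assume e: "e > 0"
  define R where "R = sqrt (\<Sum>i<m. (cmod (c i))\<^sup>2) + 1"
  have R: "R > 0" "norm (shifted m c n) \<le> R" for n
    unfolding R_def norm_shifted_sq[of m c n, symmetric] by (simp_all add: add_nonneg_pos)
  \<comment> \<open>Chosen so that \<open>2 * R * d = e / (2 * R)\<close>: the error of the net and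
    the inner product with the net point then share \<open>e\<close> equally. The summand 1 in
    \<open>R\<close> keeps it positive when all \<open>c i\<close> vanish.\<close>
  define d where "d = e / (4 * R\<^sup>2)"
  have d: "d > 0" using e R(1) by (simp add: d_def)
  obtain F where F: "finite F" "\<And>v. norm v \<le> 1 \<Longrightarrow> \<exists>x\<in>F. norm (E \<cdot> v - x) < d"
    using compact_opD[OF E d] by blast
  have lim: "(\<lambda>n. cinner (shifted m c n) x) \<longlonglongrightarrow> 0" for x
  proof -
    have "(\<lambda>n. l2_nth x n) \<longlonglongrightarrow> 0"
    proof -
      have "(\<lambda>n. (cmod (l2_nth x n))\<^sup>2) \<longlonglongrightarrow> 0" 
        by (rule summable_LIMSEQ_zero) (use l2_nth[of x] in simp)
      then have "(\<lambda>n. sqrt ((cmod (l2_nth x n))\<^sup>2)) \<longlonglongrightarrow> sqrt 0" by (rule tendsto_real_sqrt)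
      then show ?thesis by (simp add: tendsto_norm_zero_iff)
    qed
    then have "(\<lambda>n. l2_nth x (i + n)) \<longlonglongrightarrow> 0" for i
      using LIMSEQ_ignore_initial_segment[of _ 0 i] by (simp add: add.commute)
    then have "(\<lambda>n. \<Sum>i<m. cnj (c i) * l2_nth x (i + n)) \<longlonglongrightarrow> (\<Sum>i<m. cnj (c i) * 0)"
      by (intro tendsto_intros)
    then show ?thesis by (simp add: cinner_shifted)
  qed
  have "\<forall>\<^sub>F n in sequentially. cmod (cinner (shifted m c n) x) < e / (2 * R)" for x
    using e R(1) tendstoD[OF lim[of x], of "e / (2 * R)"] by (simp add: dist_norm)
  then have "\<forall>\<^sub>F n in sequentially. \<forall>x\<in>F. cmod (cinner (shifted m c n) x) < e / (2 * R)"
    using F(1) by (simp add: eventually_ball_finite)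
  then have "\<forall>\<^sub>F n in sequentially. cmod (cinner (shifted m c n) (E \<cdot> shifted m c n)) < e"
  proof eventually_elim
    case (elim n)
    let ?u = "shifted m c n"
    define w where "w = E \<cdot> ((1 / R) *\<^sub>R ?u)"
    have "norm ((1 / R) *\<^sub>R ?u) \<le> 1" using R by (simp add: pos_divide_le_eq)
    then obtain x where x: "x \<in> F" "norm (w - x) < d" using F(2) unfolding w_def by blast
    have "E \<cdot> ?u = scaleC_l2 (of_real R) (x + (w - x))"
      using R(1) by (simp add: w_def flip: scaleR_l2_def)
    then have "cinner ?u (E \<cdot> ?u) = of_real R * (cinner ?u x + cinner ?u (w - x))"
      by (simp only: cinner_scaleC_right cinner_add_right)
    then have "cmod (cinner ?u (E \<cdot> ?u)) = R * cmod (cinner ?u x + cinner ?u (w - x))"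
      using R(1) by (simp add: norm_mult)
    also have "\<dots> \<le> R * (cmod (cinner ?u x) + cmod (cinner ?u (w - x)))"
      using R(1) by (intro mult_left_mono norm_triangle_ineq) auto
    also have "cmod (cinner ?u (w - x)) \<le> 2 * R * d"
    proof -
      have "2 * norm ?u * norm (w - x) \<le> 2 * R * d" using R x d by (intro mult_mono) auto
      then show ?thesis using cmod_cinner_le[of ?u "w - x"] by linarith
    qed
    also have "2 * R * d = e / (2 * R)" using R(1) by (simp add: d_def power2_eq_square)
    finally have "cmod (cinner ?u (E \<cdot> ?u)) \<le> R * (cmod (cinner ?u x) + e / (2 * R))" using R(1) by simp
    also have "\<dots> < R * (e / (2 * R) + e / (2 * R))"
      using elim x(1) R(1) by (intro mult_strict_left_mono add_strict_right_mono) auto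
    also have "\<dots> = e" using R(1) by simp
    finally show ?case .
  qed
  then show "\<exists>N. \<forall>n\<ge>N. norm (cinner (shifted m c n) (E \<cdot> shifted m c n) - 0) < e"
    by (simp add: eventually_sequentially)
qed

text \<open>The shifts tend weakly to zero, so the compact part does not contribute in the limit.\<close>

lemma toeplitz_form_lower:
  assumes A: "selfadjoint A" and g: "\<And>v. \<gamma> * (norm v)\<^sup>2 \<le> inner v (A \<cdot> v)"
    and a: "a \<in> C_2pi" and E: "compact_op (A - toeplitz a)"
  defines "S c m \<equiv> (\<Sum>i<m. \<Sum>j<m. cnj (c i) * fourier_coeff a (int j - int i) * c j)"
  shows "Im (S c m) = 0" "Re (S c m) \<ge> \<gamma> * (\<Sum>i<m. (cmod (c i))\<^sup>2)"
proof -
  let ?u = "shifted m c"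
  have "cinner (?u n) (A \<cdot> ?u n) = S c m + cinner (?u n) ((A - toeplitz a) \<cdot> ?u n)" for n
    unfolding S_def cinner_toeplitz_shifted[OF a, symmetric, of c m n] cinner_add_right[symmetric] by simp
  then have lim: "(\<lambda>n. cinner (?u n) (A \<cdot> ?u n)) \<longlonglongrightarrow> S c m"
    using tendsto_add[OF tendsto_const cinner_compact_shifted[OF E]] by simp
  have "Im (cinner v (A \<cdot> v)) = 0" for v
  proof -
    have "cnj (cinner v (A \<cdot> v)) = cinner v (A \<cdot> v)"
      using A cinner_commute[of v "A \<cdot> v"] by (simp add: selfadjoint_def)
    from arg_cong[OF this, of Im] show ?thesis by simp
  qed
  then show "Im (S c m) = 0"
    using tendsto_Im[OF lim] by (simp add: LIMSEQ_const_iff)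
  show "Re (S c m) \<ge> \<gamma> * (\<Sum>i<m. (cmod (c i))\<^sup>2)"
  proof (rule LIMSEQ_le_const[OF tendsto_Re[OF lim]], intro exI allI impI)
    fix n
    show "\<gamma> * (\<Sum>i<m. (cmod (c i))\<^sup>2) \<le> Re (cinner (?u n) (A \<cdot> ?u n))"
      using g[of "?u n"] by (simp add: norm_shifted_sq Re_cinner)
  qed
qed

lemma trigsum_shift:
  "cis (- (real d * t)) * trigsum n c t = trigsum (n + d) (\<lambda>i. if i < d then 0 else c (i - d)) t"
proof (induction n)
  case 0
  then show ?case by (simp add: trigsum_def)
next
  case (Suc n)
  have "cis (- (real d * t)) * cis (- (real n * t)) = cis (- (real (n + d) * t))"
    by (simp add: cis_mult algebra_simps)
  then show ?case using Suc by (simp add: trigsum_def distrib_left mult.left_commute)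
qed

lemma trigsum_pad:
  "n \<le> m \<Longrightarrow> trigsum n c t = trigsum m (\<lambda>i. if i < n then c i else 0) t"
  unfolding trigsum_def by (rule sum.mono_neutral_cong_left) auto

lemma trigsum_add: "trigsum n c t + trigsum n d t = trigsum n (\<lambda>i. c i + d i) t"
  by (simp add: trigsum_def sum.distrib distrib_right)

text \<open>A factor \<open>cis (N t)\<close> with the largest frequency \<open>N\<close> moves all
  frequencies into the one-sided range of \<open>trigsum\<close>. It has modulus 1, so the squared
  modulus of \<open>f\<close>, which is what the forms see, is that of a
  \<open>trigsum\<close>.\<close>

lemma trigpoly_eq_trigsum:
  assumes "trigpoly f"
  shows "\<exists>(N::int) n c. \<forall>t. f t = cis (of_int N * t) * trigsum n c t"
  using assms
proof induction
  case (cis k)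
  show ?case by (intro exI[of _ k] exI[of _ 1] exI[of _ "\<lambda>_. 1"]) (simp add: trigsum_def)
next
  case (scale f c)
  then obtain N n d where f: "\<And>t. f t = cis (of_int N * t) * trigsum n d t" by blast
  have "c * f t = cis (of_int N * t) * trigsum n (\<lambda>i. c * d i) t" for t
    unfolding f trigsum_def by (simp add: sum_distrib_left mult_ac)
  then show ?case by blast
next
  case (add f g)
  obtain N1 n1 c1 where f: "\<And>t. f t = cis (of_int N1 * t) * trigsum n1 c1 t" using add.IH by blast
  obtain N2 n2 c2 where g: "\<And>t. g t = cis (of_int N2 * t) * trigsum n2 c2 t" using add.IH by blast
  define N where "N = max N1 N2"
  have sh: "\<exists>n' c'. \<forall>t. cis (of_int M * t) * trigsum n c t = cis (of_int N * t) * trigsum n' c' t"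
    if "M \<le> N" for M n c
  proof -
    have "cis (of_int M * t) = cis (of_int N * t) * cis (- (real (nat (N - M)) * t))" for t
      using that by (simp add: cis_mult algebra_simps)
    then have "cis (of_int M * t) * trigsum n c t = cis (of_int N * t)
        * trigsum (n + nat (N - M)) (\<lambda>i. if i < nat (N - M) then 0 else c (i - nat (N - M))) t" for t
      by (simp only: trigsum_shift[symmetric] mult.assoc)
    then show ?thesis by (intro exI allI)
  qed
  have NN: "N1 \<le> N" "N2 \<le> N" by (simp_all add: N_def)
  obtain n1' c1' where
    f': "\<And>t. cis (of_int N1 * t) * trigsum n1 c1 t = cis (of_int N * t) * trigsum n1' c1' t"
    using sh[OF NN(1), of n1 c1] by (elim exE) simp
  obtain n2' c2' where
    g': "\<And>t. cis (of_int N2 * t) * trigsum n2 c2 t = cis (of_int N * t) * trigsum n2' c2' t"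
    using sh[OF NN(2), of n2 c2] by (elim exE) simp
  let ?n = "max n1' n2'"
  have "f t + g t = cis (of_int N * t)
      * trigsum ?n (\<lambda>i. (if i < n1' then c1' i else 0) + (if i < n2' then c2' i else 0)) t" for t
    unfolding f g f' g' trigsum_add[symmetric] trigsum_pad[OF max.cobounded1, of n1' c1' t n2', symmetric]
      trigsum_pad[OF max.cobounded2, of n2' c2' t n1', symmetric] by (rule distrib_left[symmetric])
  then show ?case by (intro exI allI)
qed

text \<open>The integral with \<open>a\<close> is \<open>2 * pi\<close> times the Toeplitz form of
  the coefficients, the one with \<open>\<gamma>\<close> comes from Parseval, and
  \<open>toeplitz_form_lower\<close> compares the two.\<close>

lemma symbol_form_trigpoly:
  assumes A: "selfadjoint A" and g: "\<And>v. \<gamma> * (norm v)\<^sup>2 \<le> inner v (A \<cdot> v)"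
    and a: "a \<in> C_2pi" and E: "compact_op (A - toeplitz a)" and f: "trigpoly f"
  shows "\<exists>r\<ge>0. ((\<lambda>t. (a t - of_real \<gamma>) * (f t * cnj (f t))) has_integral of_real r) {0..2*pi}"
proof -
  obtain N n c where fc: "\<And>t. f t = cis (of_int N * t) * trigsum n c t"
    using trigpoly_eq_trigsum[OF f] by blast
  let ?S = "\<Sum>i<n. \<Sum>j<n. cnj (c i) * fourier_coeff a (int j - int i) * c j"
  let ?X = "trigsum n c"
  have ff: "f t * cnj (f t) = of_real ((cmod (?X t))\<^sup>2)" for t
    unfolding complex_norm_square[symmetric] by (simp add: fc norm_mult)
  have i1: "((\<lambda>t. a t * cnj (?X t) * ?X t) has_integral 2 * pi * ?S) {0..2*pi}"
    by (rule toeplitz_form[OF C_2pi_continuous[OF a]])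
  have i2: "((\<lambda>t. of_real \<gamma> * of_real ((cmod (?X t))\<^sup>2)) has_integral
      of_real \<gamma> * complex_of_real (2 * pi * (\<Sum>i<n. (cmod (c i))\<^sup>2))) {0..2*pi}"
    by (intro has_integral_mult_right has_integral_of_real parseval_trigsum)
  define r where "r = 2 * pi * (Re ?S - \<gamma> * (\<Sum>i<n. (cmod (c i))\<^sup>2))"
  note S = toeplitz_form_lower[OF A g a E, of c n]
  have "r \<ge> 0" using S(2) by (simp add: r_def)
  moreover have "?S = of_real (Re ?S)" using S(1) by (simp add: complex_eq_iff)
  then have "2 * pi * ?S - of_real \<gamma> * complex_of_real (2 * pi * (\<Sum>i<n. (cmod (c i))\<^sup>2)) = of_real r"
    by (simp add: r_def algebra_simps complex_eq_iff)
  then have "((\<lambda>t. a t * cnj (?X t) * ?X t - of_real \<gamma> * of_real ((cmod (?X t))\<^sup>2)) has_integral of_real r) {0..2*pi}"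
    using has_integral_diff[OF i1 i2] by simp
  then have "((\<lambda>t. (a t - of_real \<gamma>) * (f t * cnj (f t))) has_integral of_real r) {0..2*pi}"
    unfolding ff by (rule has_integral_eq[rotated]) (simp add: complex_norm_square algebra_simps del: of_real_power)
  ultimately show ?thesis by blast
qed

text \<open>A nonnegative \<open>h\<close> is the squared modulus of \<open>sqrt h\<close>.
  Approximating \<open>sqrt h\<close> instead of \<open>h\<close> keeps the approximants of the form
  \<open>f * cnj f\<close>, for which the sign is known.\<close>

lemma symbol_form_nonneg:
  fixes h :: "real \<Rightarrow> real"
  assumes A: "selfadjoint A" and g: "\<And>v. \<gamma> * (norm v)\<^sup>2 \<le> inner v (A \<cdot> v)"
    and a: "a \<in> C_2pi" and E: "compact_op (A - toeplitz a)"
    and h: "continuous_on {0..2*pi} h" "\<And>t. h t \<ge> 0" "h 0 = h (2*pi)"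
  shows "\<exists>r\<ge>0. ((\<lambda>t. (a t - of_real \<gamma>) * of_real (h t)) has_integral of_real r) {0..2*pi}"
proof -
  define s where "s t = complex_of_real (sqrt (h t))" for t
  have s: "s \<in> C_2pi" unfolding C_2pi_iff s_def using h by (auto intro!: continuous_intros)
  obtain f where f: "\<And>n. trigpoly (f n)" "uniform_limit {0..2*pi} f s sequentially"
    using trigpoly_approx_seq[OF s] by blast
  have fC: "continuous_on {0..2*pi} (f n)" for n
    using trigpoly_C_2pi[OF f(1)] by (rule C_2pi_continuous)
  have bdd: "bounded (k ` {0..2*pi})" if "continuous_on {0..2*pi} k" for k :: "real \<Rightarrow> complex"
    using that by (intro compact_imp_bounded compact_continuous_image) auto
  have cs: "continuous_on {0..2*pi} s" by (rule C_2pi_continuous[OF s])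
  have ca: "continuous_on {0..2*pi} (\<lambda>t. a t - of_real \<gamma>)"
    using C_2pi_continuous[OF a] by (intro continuous_intros)
  have fcnj: "uniform_limit {0..2*pi} (\<lambda>n t. cnj (f n t)) (\<lambda>t. cnj (s t)) sequentially"
    using f(2) unfolding uniform_limit_iff dist_norm complex_cnj_diff[symmetric] complex_mod_cnj .
  have "uniform_limit {0..2*pi} (\<lambda>n t. (a t - of_real \<gamma>) * (f n t * cnj (f n t)))
      (\<lambda>t. (a t - of_real \<gamma>) * (s t * cnj (s t))) sequentially"
    by (rule uniform_lim_mult[OF uniform_limit_const
          uniform_lim_mult[OF f(2) fcnj bdd[OF cs] bdd[OF continuous_on_cnj[OF cs]]]
          bdd[OF ca] bdd[OF continuous_on_mult[OF cs continuous_on_cnj[OF cs]]]])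
  moreover have "continuous_on {0..2*pi} (\<lambda>t. (a t - of_real \<gamma>) * (f n t * cnj (f n t)))" for n
    by (rule continuous_on_mult[OF ca continuous_on_mult[OF fC continuous_on_cnj[OF fC]]])
  ultimately obtain I J where I: "\<And>n. ((\<lambda>t. (a t - of_real \<gamma>) * (f n t * cnj (f n t))) has_integral I n) {0..2*pi}"
      and J: "((\<lambda>t. (a t - of_real \<gamma>) * (s t * cnj (s t))) has_integral J) {0..2*pi}" "I \<longlonglongrightarrow> J"
    by (rule uniform_limit_integral) auto
  have In: "Im (I n) = 0 \<and> Re (I n) \<ge> 0" for n
  proof -
    obtain r where r: "r \<ge> 0"
      "((\<lambda>t. (a t - of_real \<gamma>) * (f n t * cnj (f n t))) has_integral of_real r) {0..2*pi}"
      using symbol_form_trigpoly[OF A g a E f(1)[of n]] by (elim exE conjE)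
    from has_integral_unique[OF I[of n] r(2)] show ?thesis using r(1) by simp
  qed
  have ImJ: "Im J = 0" using tendsto_Im[OF J(2)] by (simp add: In LIMSEQ_const_iff)
  moreover have "Re J \<ge> 0" using In by (intro LIMSEQ_le_const[OF tendsto_Re[OF J(2)]]) auto
  moreover have "s t * cnj (s t) = of_real (h t)" for t
    using h(2)[of t] by (simp add: s_def flip: of_real_mult)
  moreover have "of_real (Re J) = J" using ImJ by (simp add: complex_eq_iff)
  ultimately show ?thesis using J(1) by (intro exI[of _ "Re J"]) simp
qed

text \<open>The test function is the negative part \<open>h\<close> of \<open>b\<close>: then
  \<open>b h = - h^2\<close>, so the continuous function \<open>h^2\<close> has integral zero and
  vanishes.\<close>

lemma nonneg_of_integrals:
  fixes b :: "real \<Rightarrow> real"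
  assumes b: "continuous_on {0..2*pi} b" "b 0 = b (2*pi)"
    and pos: "\<And>h. \<lbrakk>continuous_on {0..2*pi} h; \<And>t. h t \<ge> 0; h 0 = h (2*pi)\<rbrakk>
      \<Longrightarrow> \<exists>r\<ge>0. ((\<lambda>t. b t * h t) has_integral r) {0..2*pi}"
    and t: "t \<in> {0..2*pi}"
  shows "b t \<ge> 0"
proof -
  define h where "h t = max 0 (- b t)" for t
  have ch: "continuous_on {0..2*pi} h" unfolding h_def[abs_def] using b(1) by (intro continuous_intros)
  obtain r where r: "r \<ge> 0" "((\<lambda>t. b t * h t) has_integral r) {0..2*pi}"
    using pos[OF ch] b(2) by (auto simp: h_def)
  have "(\<lambda>t. - (b t * h t)) = (\<lambda>t. (h t)\<^sup>2)" by (auto simp: h_def max_def power2_eq_square)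
  with has_integral_neg[OF r(2)] have "((\<lambda>t. (h t)\<^sup>2) has_integral - r) {0..2*pi}"
    by simp
  then have "integral {0..2*pi} (\<lambda>t. (h t)\<^sup>2) = - r" by (rule integral_unique)
  moreover have "integral {0..2*pi} (\<lambda>t. (h t)\<^sup>2) \<ge> 0"
    using ch by (intro Henstock_Kurzweil_Integration.integral_nonneg integrable_continuous_interval continuous_intros) auto
  ultimately have "integral {0..2*pi} (\<lambda>t. (h t)\<^sup>2) = 0" using r(1) by simp
  moreover have "continuous_on {0..2*pi} (\<lambda>t. (h t)\<^sup>2)" using ch by (intro continuous_intros)
  ultimately have "\<forall>t\<in>{0..2*pi}. (h t)\<^sup>2 = 0" using integral_eq_0_iff[of 0 "2*pi" "\<lambda>t. (h t)\<^sup>2"] by simp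
  then have "h t = 0" using t by simp
  then show ?thesis by (simp add: h_def max_def split: if_splits)
qed

lemma symbol_lower_bound:
  assumes A: "selfadjoint A" and g: "\<And>v. \<gamma> * (norm v)\<^sup>2 \<le> inner v (A \<cdot> v)"
    and a: "a \<in> C_2pi" and E: "compact_op (A - toeplitz a)" and t: "t \<in> {0..2*pi}"
  shows "Im (a t) = 0" "Re (a t) \<ge> \<gamma>"
proof -
  have ca: "continuous_on {0..2*pi} a" "a 0 = a (2*pi)" using a by (auto simp: C_2pi_iff)
  note form = symbol_form_nonneg[OF A g a E]
  have 1: "Re (a t) - \<gamma> \<ge> 0"
  proof (rule nonneg_of_integrals[of "\<lambda>t. Re (a t) - \<gamma>", OF _ _ _ t])
    fix h :: "real \<Rightarrow> real"
    assume h: "continuous_on {0..2*pi} h" "\<And>t. h t \<ge> 0" "h 0 = h (2*pi)"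
    obtain r where r: "r \<ge> 0" "((\<lambda>t. (a t - of_real \<gamma>) * of_real (h t)) has_integral of_real r) {0..2*pi}"
      using form[OF h] by (elim exE conjE)
    from has_integral_linear[OF r(2) bounded_linear_Re] r(1)
    show "\<exists>r\<ge>0. ((\<lambda>t. (Re (a t) - \<gamma>) * h t) has_integral r) {0..2*pi}"
      by (intro exI[of _ r]) (simp add: o_def)
  qed (use ca in \<open>auto intro!: continuous_intros\<close>)
  \<comment> \<open>The values in \<open>form\<close> are real, so \<open>Im a\<close> integrates to
    zero against every test function, and both signs of \<open>c\<close> are admissible.\<close>
  have im: "c * Im (a t) \<ge> 0" for c
  proof (rule nonneg_of_integrals[of "\<lambda>t. c * Im (a t)", OF _ _ _ t])
    fix h :: "real \<Rightarrow> real"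
    assume h: "continuous_on {0..2*pi} h" "\<And>t. h t \<ge> 0" "h 0 = h (2*pi)"
    obtain r where "((\<lambda>t. (a t - of_real \<gamma>) * of_real (h t)) has_integral of_real r) {0..2*pi}"
      using form[OF h] by (elim exE conjE)
    from has_integral_mult_right[OF has_integral_linear[OF this bounded_linear_Im], of c]
    show "\<exists>r\<ge>0. ((\<lambda>t. c * Im (a t) * h t) has_integral r) {0..2*pi}"
      by (intro exI[of _ 0]) (simp add: o_def mult.assoc)
  qed (use ca in \<open>auto intro!: continuous_intros\<close>)
  show "Im (a t) = 0" "Re (a t) \<ge> \<gamma>" using 1 im[of 1] im[of "-1"] by auto
qed

section \<open>Calculus of symbols\<close>

definition has_symbol :: "(real \<Rightarrow> complex) \<Rightarrow> bop \<Rightarrow> bool"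
  where "has_symbol a A \<longleftrightarrow> a \<in> C_2pi \<and> compact_op (A - toeplitz a)"

lemma has_symbol_const: "has_symbol (\<lambda>_. of_real c) (c *\<^sub>R 1)"
  by (simp add: has_symbol_def toeplitz_const compact_op_0)

lemma has_symbol_add:
  assumes "has_symbol a A" "has_symbol b B"
  shows "has_symbol (\<lambda>t. a t + b t) (A + B)"
proof -
  have eq: "A + B - toeplitz (\<lambda>t. a t + b t) = (A - toeplitz a) + (B - toeplitz b)"
    using assms by (simp add: has_symbol_def toeplitz_add)
  have "compact_op (A + B - toeplitz (\<lambda>t. a t + b t))"
    unfolding eq using assms by (simp add: has_symbol_def compact_op_add)
  then show ?thesis using assms by (simp add: has_symbol_def C_2pi_add)
qed

lemma has_symbol_mult:
  assumes "has_symbol a A" "has_symbol b B"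
  shows "has_symbol (\<lambda>t. a t * b t) (A * B)"
proof -
  have eq: "A * B - toeplitz (\<lambda>t. a t * b t) = (A - toeplitz a) * B + toeplitz a * (B - toeplitz b)
      + (toeplitz a * toeplitz b - toeplitz (\<lambda>t. a t * b t))"
    by (simp add: algebra_simps)
  have "compact_op (A * B - toeplitz (\<lambda>t. a t * b t))"
    unfolding eq using assms
    by (intro compact_op_add compact_op_mult_left compact_op_mult_right compact_toeplitz_mult)
      (simp_all add: has_symbol_def)
  then show ?thesis using assms by (simp add: has_symbol_def C_2pi_mult)
qed

lemma has_symbol_cong:
  assumes "has_symbol a A" "\<And>t. t \<in> {0..2*pi} \<Longrightarrow> a t = b t"
  shows "has_symbol b A"
  using assms toeplitz_cong[of a b] continuous_on_cong[of "{0..2*pi}" "{0..2*pi}" a b]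
  by (auto simp: has_symbol_def C_2pi_iff)

lemma has_symbol_limit:
  assumes "\<And>n. has_symbol (b n) (X n)" "a \<in> C_2pi" "uniform_limit {0..2*pi} b a sequentially"
    and "X \<longlonglongrightarrow> L"
  shows "has_symbol a L"
proof -
  have "(\<lambda>n. X n - toeplitz (b n)) \<longlonglongrightarrow> L - toeplitz a"
    using assms by (intro tendsto_diff toeplitz_tendsto) (auto simp: has_symbol_def)
  then have "compact_op (L - toeplitz a)"
    by (rule compact_op_limit) (use assms(1) in \<open>simp add: has_symbol_def\<close>)
  then show ?thesis using assms(2) by (simp add: has_symbol_def)
qed

lemma has_symbol_poly_op:
  fixes a :: "real \<Rightarrow> real"
  assumes A: "has_symbol (\<lambda>t. of_real (a t)) A"
  shows "has_symbol (\<lambda>t. of_real (poly q (a t))) (poly_op q A)"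
proof (induction q)
  case 0
  show ?case using has_symbol_const[of 0] by simp
next
  case (pCons c q)
  show ?case
    using has_symbol_add[OF has_symbol_const[of c] has_symbol_mult[OF A pCons.IH]]
    by (simp add: poly_op_pCons)
qed

text \<open>One sequence of polynomials converges to \<open>f\<close> on an interval containing the
  values of the symbol, and at \<open>A\<close> to \<open>B\<close>; \<open>has_symbol_limit\<close>
  combines both limits.\<close>

lemma has_symbol_fun_calc:
  fixes a :: "real \<Rightarrow> real"
  assumes A: "has_symbol (\<lambda>t. of_real (a t)) A" and B: "fun_calc_rel A {m..M} f B"
    and f: "continuous_on {m..M} f" and a: "\<And>t. t \<in> {0..2*pi} \<Longrightarrow> a t \<in> {m..M}"
  shows "has_symbol (\<lambda>t. of_real (f (a t))) B"
proof -
  obtain q where q: "uniform_limit {m..M} (\<lambda>n. poly (q n)) f sequentially"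
    "(\<lambda>n. poly_op (q n) A) \<longlonglongrightarrow> B"
    using B by (auto simp: fun_calc_rel_def)
  show ?thesis
  proof (rule has_symbol_limit[OF has_symbol_poly_op[OF A] _ _ q(2)])
    have "continuous_on {0..2*pi} (\<lambda>t. Re (complex_of_real (a t)))"
      using A by (intro continuous_on_Re) (auto simp: has_symbol_def C_2pi_iff)
    then have "continuous_on {0..2*pi} (\<lambda>t. f (a t))"
      using a by (intro continuous_on_compose2[OF f]) auto
    moreover have "a 0 = a (2*pi)" using A by (simp add: has_symbol_def C_2pi_iff)
    ultimately show "(\<lambda>t. of_real (f (a t))) \<in> C_2pi"
      by (simp add: C_2pi_iff continuous_on_of_real)
    show "uniform_limit {0..2*pi} (\<lambda>n t. of_real (poly (q n) (a t))) (\<lambda>t. complex_of_real (f (a t))) sequentially"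
    proof (rule uniform_limitI)
      fix e :: real assume "e > 0"
      from uniform_limitD[OF q(1) this]
      show "\<forall>\<^sub>F n in sequentially. \<forall>t\<in>{0..2*pi}. dist (complex_of_real (poly (q n) (a t))) (complex_of_real (f (a t))) < e"
        by eventually_elim (use a in \<open>simp add: dist_of_real\<close>)
    qed
  qed
qed

definition pos_symbol :: "(real \<Rightarrow> real) \<Rightarrow> bop \<Rightarrow> bool"
  where "pos_symbol a A \<longleftrightarrow> has_symbol (\<lambda>t. of_real (a t)) A \<and> (\<forall>t\<in>{0..2*pi}. a t > 0)"

lemma pos_symbol_of_posdef:
  assumes "posdef A" "has_symbol a A"
  shows "pos_symbol (\<lambda>t. Re (a t)) A" "\<And>t. t \<in> {0..2*pi} \<Longrightarrow> a t = of_real (Re (a t))"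
proof -
  obtain \<gamma> where A: "selfadjoint A" and g: "\<gamma> > 0" "\<And>v. \<gamma> * (norm v)\<^sup>2 \<le> inner v (A \<cdot> v)"
    using assms(1) by (auto simp: posdef_def Re_cinner)
  have a: "a \<in> C_2pi" "compact_op (A - toeplitz a)" using assms(2) by (auto simp: has_symbol_def)
  note low = symbol_lower_bound[OF A g(2) a]
  show re: "a t = of_real (Re (a t))" if "t \<in> {0..2*pi}" for t
    using low(1)[OF that] by (simp add: complex_eq_iff)
  have "has_symbol (\<lambda>t. of_real (Re (a t))) A" using assms(2) re by (rule has_symbol_cong)
  moreover have "Re (a t) > 0" if "t \<in> {0..2*pi}" for t using low(2)[OF that] g(1) by linarith
  ultimately show "pos_symbol (\<lambda>t. Re (a t)) A" by (simp add: pos_symbol_def)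
qed

lemma pos_symbol_cong:
  assumes "pos_symbol a A" "\<And>t. t \<in> {0..2*pi} \<Longrightarrow> a t = b t"
  shows "pos_symbol b A"
  using assms has_symbol_cong[of "\<lambda>t. of_real (a t)" A "\<lambda>t. of_real (b t)"]
  by (auto simp: pos_symbol_def)

lemma pos_symbol_mult:
  assumes "pos_symbol a A" "pos_symbol b B"
  shows "pos_symbol (\<lambda>t. a t * b t) (A * B)"
  using assms has_symbol_mult[of "\<lambda>t. of_real (a t)" A "\<lambda>t. of_real (b t)" B]
  by (simp add: pos_symbol_def)

lemma pos_symbol_powr_op:
  assumes A: "posdef A" and a: "pos_symbol a A"
  shows "pos_symbol (\<lambda>t. a t powr s) (powr_op A s)"
proof -
  obtain m M where m: "0 < m" "m \<le> M" "spec_within m M A" using posdef_spec_within[OF A] by metis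
  have "continuous_on {0..2*pi} (\<lambda>t. Re (complex_of_real (a t)))"
    using a by (intro continuous_on_Re) (auto simp: pos_symbol_def has_symbol_def C_2pi_iff)
  then have ca: "continuous_on {0..2*pi} a" by simp
  obtain t0 where t0: "t0 \<in> {0..2*pi}" "\<And>t. t \<in> {0..2*pi} \<Longrightarrow> a t0 \<le> a t"
    using continuous_attains_inf[OF compact_Icc _ ca] by (auto simp: not_le)
  obtain t1 where t1: "t1 \<in> {0..2*pi}" "\<And>t. t \<in> {0..2*pi} \<Longrightarrow> a t \<le> a t1"
    using continuous_attains_sup[OF compact_Icc _ ca] by (auto simp: not_le)
  \<comment> \<open>The interval that bounds \<open>A\<close> is widened to contain the range of the
    symbol too; its lower end stays positive, so \<open>powr\<close> remains continuous
    there.\<close>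
  define l u where "l = min m (a t0)" and "u = max M (a t1)"
  have l: "0 < l" using m(1) a t0(1) by (simp add: l_def pos_symbol_def)
  have "spec_within l u A"
    using m(3) loewner_scaleR_mono[OF posdef_one, of l m] loewner_scaleR_mono[OF posdef_one, of M u]
    by (auto simp: spec_within_def l_def u_def intro: loewner_trans)
  then have "fun_calc_rel A {l..u} (\<lambda>x. x powr s) (powr_op A s)" by (rule powr_op_rel[OF l])
  then have "has_symbol (\<lambda>t. of_real (a t powr s)) (powr_op A s)"
  proof (rule has_symbol_fun_calc[rotated])
    show "continuous_on {l..u} (\<lambda>x. x powr s)" using l by (intro continuous_intros) auto
    show "a t \<in> {l..u}" if "t \<in> {0..2*pi}" for t
      using t0(2)[OF that] t1(2)[OF that] by (auto simp: l_def u_def)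
  qed (use a in \<open>simp add: pos_symbol_def\<close>)
  then show ?thesis using a by (auto simp: pos_symbol_def)
qed

lemma pos_symbol_wgm:
  assumes A: "posdef A" "pos_symbol a A" and B: "posdef B" "pos_symbol b B"
  shows "pos_symbol (\<lambda>t. a t powr (1 - s) * b t powr s) (wgm s A B)"
proof -
  note half = pos_symbol_powr_op[OF A, of "1/2"] and mhalf = pos_symbol_powr_op[OF A, of "-1/2"]
  have "pos_symbol (\<lambda>t. a t powr (1/2) * (a t powr (-1/2) * b t * a t powr (-1/2)) powr s * a t powr (1/2))
      (wgm s A B)"
    unfolding wgm_def
    by (intro pos_symbol_mult pos_symbol_powr_op posdef_wgm_middle half mhalf A B)
  then show ?thesis
  proof (rule pos_symbol_cong)
    fix t assume t: "t \<in> {0..2*pi}"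
    have "a t > 0" "b t > 0" using A B t by (auto simp: pos_symbol_def)
    then show "a t powr (1/2) * (a t powr (-1/2) * b t * a t powr (-1/2)) powr s * a t powr (1/2)
        = a t powr (1 - s) * b t powr s"
      by (simp add: powr_def ln_mult exp_add[symmetric] flip: exp_diff) (simp add: field_simps)
  qed
qed


section \<open>The NBMP iteration\<close>

text \<open>The reindexing behind \<open>omit\<close>, a bijection onto the indices other than
  \<open>i\<close>, through which sums, products and multisets of a shortened tuple are
  rewritten.\<close>

definition skip :: "nat \<Rightarrow> nat \<Rightarrow> nat"
  where "skip i j = (if j < i then j else Suc j)"

lemma omit_eq_comp_skip: "omit i A = A \<circ> skip i"
  by (auto simp: omit_def skip_def)

lemma skip_bij:
  assumes "i \<in> {1..Suc n}"
  shows "bij_betw (skip i) {1..n} ({1..Suc n} - {i})"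
  by (rule bij_betwI[where g = "\<lambda>j. if j < i then j else j - 1"])
    (use assms in \<open>auto simp: skip_def split: if_splits\<close>)

lemma skip_mem: "j \<in> {1..n} \<Longrightarrow> i \<in> {1..Suc n} \<Longrightarrow> skip i j \<in> {1..Suc n} - {i}"
  by (auto simp: skip_def)

lemma mset_omit:
  assumes "i \<in> {1..Suc n}"
  shows "add_mset (A i) (image_mset (omit i A) (mset_set {1..n})) = image_mset A (mset_set {1..Suc n})"
proof -
  have "image_mset (omit i A) (mset_set {1..n}) = image_mset A (image_mset (skip i) (mset_set {1..n}))"
    by (simp add: omit_eq_comp_skip multiset.map_comp)
  also have "image_mset (skip i) (mset_set {1..n}) = mset_set ({1..Suc n} - {i})"
    using skip_bij[OF assms] image_mset_mset_set[of "skip i" "{1..n}"] by (simp add: bij_betw_def)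
  finally show ?thesis
    using mset_set.remove[OF _ assms] by simp
qed

lemma omit_mem:
  assumes "i \<in> {1..Suc n}" "j \<in> {1..n}" "\<And>k. k \<in> {1..Suc n} \<Longrightarrow> P (A k)"
  shows "P (omit i A j)"
  using assms by (auto simp: omit_def)

text \<open>The invariant of the induction on the number of operators: positivity, symmetry,
  nonexpansiveness with equal weights, idempotence, and the rule for symbols. Symmetry is phrased
  with multisets; it then also says that only the entries \<open>1, ..., n\<close> count, and single
  entries can be cancelled by \<open>add_mset\<close>.\<close>

definition good_mean :: "nat \<Rightarrow> ((nat \<Rightarrow> bop) \<Rightarrow> bop) \<Rightarrow> bool"
  where "good_mean n M \<longleftrightarrow>
    (\<forall>A. (\<forall>i\<in>{1..n}. posdef (A i)) \<longrightarrow> posdef (M A)) \<and>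
    (\<forall>A B. (\<forall>i\<in>{1..n}. posdef (A i)) \<longrightarrow>
      image_mset A (mset_set {1..n}) = image_mset B (mset_set {1..n}) \<longrightarrow> M A = M B) \<and>
    (\<forall>A B r. (\<forall>i\<in>{1..n}. posdef (A i) \<and> posdef (B i) \<and> thompson (r i) (A i) (B i)) \<longrightarrow>
      thompson ((\<Sum>i=1..n. r i) / n) (M A) (M B)) \<and>
    (\<forall>A X. posdef X \<longrightarrow> (\<forall>i\<in>{1..n}. A i = X) \<longrightarrow> M A = X) \<and>
    (\<forall>A a. (\<forall>i\<in>{1..n}. posdef (A i) \<and> pos_symbol (a i) (A i)) \<longrightarrow>
      pos_symbol (\<lambda>t. (\<Prod>i=1..n. a i t) powr (1 / n)) (M A))"

lemma mset_eq_posdef: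
  assumes "image_mset A (mset_set {1..n}) = image_mset B (mset_set {1..(n::nat)})"
    and "\<forall>i\<in>{1..n}. posdef (A i)"
  shows "\<forall>i\<in>{1..n}. posdef (B i)"
proof -
  have "A ` {1..n} = B ` {1..n}"
    using arg_cong[OF assms(1), of set_mset] by simp
  then show ?thesis using assms(2) by (metis imageE imageI)
qed

lemma good_mean_2: "good_mean 2 (\<lambda>A. wgm (1/2) (A 1) (A 2))"
proof -
  have 12: "{1..2::nat} = {1, 2}" by auto
  show ?thesis
    unfolding good_mean_def
  proof (intro conjI allI impI)
    fix A :: "nat \<Rightarrow> bop" assume "\<forall>i\<in>{1..2::nat}. posdef (A i)"
    then show "posdef (wgm (1/2) (A 1) (A 2))" by (intro posdef_wgm) auto
  next
    fix A B :: "nat \<Rightarrow> bop"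
    assume A: "\<forall>i\<in>{1..2::nat}. posdef (A i)"
      and eq: "image_mset A (mset_set {1..2::nat}) = image_mset B (mset_set {1..2::nat})"
    have "{#A 1, A 2#} = {#B 1, B 2#}" using eq unfolding 12 by simp
    then have "A 1 = B 1 \<and> A 2 = B 2 \<or> A 1 = B 2 \<and> A 2 = B 1"
      by (auto simp: add_eq_conv_ex)
    then show "wgm (1/2) (A 1) (A 2) = wgm (1/2) (B 1) (B 2)"
      using A wgm_half_commute[of "A 1" "A 2"] by auto
  next
    fix A B :: "nat \<Rightarrow> bop" and r
    assume AB: "\<forall>i\<in>{1..2::nat}. posdef (A i) \<and> posdef (B i) \<and> thompson (r i) (A i) (B i)"
    have "thompson ((1 - 1/2) * r 1 + 1/2 * r 2) (wgm (1/2) (A 1) (A 2)) (wgm (1/2) (B 1) (B 2))"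
      using AB by (intro thompson_wgm) auto
    then show "thompson ((\<Sum>i=1..2. r i) / real 2) (wgm (1/2) (A 1) (A 2)) (wgm (1/2) (B 1) (B 2))"
      unfolding 12 by (simp add: add_divide_distrib)
  next
    fix A :: "nat \<Rightarrow> bop" and X assume "posdef X" "\<forall>i\<in>{1..2::nat}. A i = X"
    then show "wgm (1/2) (A 1) (A 2) = X" using wgm_self by auto
  next
    fix A :: "nat \<Rightarrow> bop" and a :: "nat \<Rightarrow> real \<Rightarrow> real"
    assume Aa: "\<forall>i\<in>{1..2::nat}. posdef (A i) \<and> pos_symbol (a i) (A i)"
    have "pos_symbol (\<lambda>t. a 1 t powr (1 - 1/2) * a 2 t powr (1/2)) (wgm (1/2) (A 1) (A 2))"
      using Aa by (intro pos_symbol_wgm) auto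
    then show "pos_symbol (\<lambda>t. (\<Prod>i=1..2. a i t) powr (1 / real 2)) (wgm (1/2) (A 1) (A 2))"
    proof (rule pos_symbol_cong)
      fix t assume "t \<in> {0..2*pi}"
      then have "a 1 t > 0" "a 2 t > 0" using Aa by (auto simp: pos_symbol_def)
      then show "a 1 t powr (1 - 1/2) * a 2 t powr (1/2) = (\<Prod>i=1..2. a i t) powr (1 / real 2)"
        unfolding 12 by (simp add: powr_mult)
    qed
  qed
qed

section \<open>One step of the iteration for \<open>n + 1\<close> operators\<close>

locale mean_step =
  fixes n :: nat and M :: "(nat \<Rightarrow> bop) \<Rightarrow> bop" and s :: real
  assumes n: "n \<ge> 2" and good: "good_mean n M" and s_def: "s = real n / (real n + 1)"
begin

lemmas good' = good[unfolded good_mean_def]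

lemma M_posdef: "(\<And>i. i \<in> {1..n} \<Longrightarrow> posdef (A i)) \<Longrightarrow> posdef (M A)"
  by (rule good'[THEN conjunct1, rule_format])

lemma M_mset:
  "\<lbrakk>\<And>i. i \<in> {1..n} \<Longrightarrow> posdef (A i);
    image_mset A (mset_set {1..n}) = image_mset B (mset_set {1..n})\<rbrakk> \<Longrightarrow> M A = M B"
  by (rule good'[THEN conjunct2, THEN conjunct1, rule_format])

lemma M_thompson:
  "\<lbrakk>\<And>i. i \<in> {1..n} \<Longrightarrow> posdef (A i); \<And>i. i \<in> {1..n} \<Longrightarrow> posdef (B i);
    \<And>i. i \<in> {1..n} \<Longrightarrow> thompson (r i) (A i) (B i)\<rbrakk> \<Longrightarrow> thompson ((\<Sum>i=1..n. r i) / n) (M A) (M B)"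
  by (rule good'[THEN conjunct2, THEN conjunct2, THEN conjunct1, rule_format]) blast

lemma M_idem: "\<lbrakk>posdef X; \<And>i. i \<in> {1..n} \<Longrightarrow> A i = X\<rbrakk> \<Longrightarrow> M A = X"
  by (rule good'[THEN conjunct2, THEN conjunct2, THEN conjunct2, THEN conjunct1, rule_format])

lemma M_symbol:
  "\<lbrakk>\<And>i. i \<in> {1..n} \<Longrightarrow> posdef (A i); \<And>i. i \<in> {1..n} \<Longrightarrow> pos_symbol (a i) (A i)\<rbrakk>
    \<Longrightarrow> pos_symbol (\<lambda>t. (\<Prod>i=1..n. a i t) powr (1 / n)) (M A)"
  by (rule good'[THEN conjunct2, THEN conjunct2, THEN conjunct2, THEN conjunct2, rule_format]) blast

lemma s01: "0 \<le> s" "s \<le> 1"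
  by (simp_all add: s_def field_simps)

text \<open>The reason for the NBMP weights: the entry \<open>A i\<close> taken directly and each
  entry inside the mean of the others receive the same weight \<open>1 / (n + 1)\<close>.\<close>

lemma s_simps: "1 - s = 1 / (real n + 1)" "s * (x / real n) = x / (real n + 1)"
  using n by (simp_all add: s_def field_simps)

definition step :: "(nat \<Rightarrow> bop) \<Rightarrow> nat \<Rightarrow> bop"
  where "step A i = wgm s (A i) (M (omit i A))"

definition posdefs :: "(nat \<Rightarrow> bop) \<Rightarrow> bool"
  where "posdefs A \<longleftrightarrow> (\<forall>i\<in>{1..Suc n}. posdef (A i))"

lemma posdefs_omit: "posdefs A \<Longrightarrow> i \<in> {1..Suc n} \<Longrightarrow> j \<in> {1..n} \<Longrightarrow> posdef (omit i A j)"
  using omit_mem[of i n j posdef A] by (simp add: posdefs_def)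

lemma posdef_step:
  assumes A: "posdefs A" and i: "i \<in> {1..Suc n}"
  shows "posdef (A i)" "posdef (M (omit i A))" "posdef (step A i)"
proof -
  show 1: "posdef (A i)" using A i by (simp only: posdefs_def)
  show 2: "posdef (M (omit i A))" by (rule M_posdef[OF posdefs_omit[OF A i]])
  show "posdef (step A i)" unfolding step_def by (rule posdef_wgm[OF 1 2])
qed

lemma posdefs_step: "posdefs A \<Longrightarrow> posdefs (step A)"
  unfolding posdefs_def[of "step A"] by (intro ballI posdef_step(3))

lemma sum_omit:
  fixes r :: "nat \<Rightarrow> real"
  assumes "i \<in> {1..Suc n}"
  shows "(\<Sum>j=1..n. omit i r j) = (\<Sum>j\<in>{1..Suc n} - {i}. r j)"
  using sum.reindex_bij_betw[OF skip_bij[OF assms], of r] by (simp add: omit_eq_comp_skip)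

lemma thompson_M_omit:
  assumes A: "posdefs A" "posdefs B" and i: "i \<in> {1..Suc n}"
    and r: "\<And>j. j \<in> {1..Suc n} - {i} \<Longrightarrow> thompson (r j) (A j) (B j)"
  shows "thompson ((\<Sum>j\<in>{1..Suc n} - {i}. r j) / n) (M (omit i A)) (M (omit i B))"
  unfolding sum_omit[OF i, symmetric]
proof (rule M_thompson)
  fix j assume j: "j \<in> {1..n}"
  show "posdef (omit i A j)" "posdef (omit i B j)" using posdefs_omit A i j by auto
  have "skip i j \<in> {1..Suc n} - {i}" by (rule skip_mem[OF j i])
  then show "thompson (omit i r j) (omit i A j) (omit i B j)"
    using r by (simp add: omit_eq_comp_skip)
qed

lemma step_thompson:
  assumes A: "posdefs A" "posdefs B" and i: "i \<in> {1..Suc n}"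
    and r: "\<And>j. j \<in> {1..Suc n} \<Longrightarrow> thompson (r j) (A j) (B j)"
  shows "thompson ((\<Sum>j=1..Suc n. r j) / (n + 1)) (step A i) (step B i)"
proof -
  let ?R = "\<Sum>j\<in>{1..Suc n} - {i}. r j"
  have "thompson ((1 - s) * r i + s * (?R / n)) (step A i) (step B i)"
    unfolding step_def
    by (rule thompson_wgm[OF posdef_step(1,2)[OF A(1) i] posdef_step(1,2)[OF A(2) i] s01 r[OF i]
          thompson_M_omit[OF A i]]) (simp add: r)
  moreover have "(1 - s) * r i + s * (?R / n) = (\<Sum>j=1..Suc n. r j) / (n + 1)"
  proof -
    have "(\<Sum>j=1..Suc n. r j) = r i + ?R" by (rule sum.remove) (use i in auto)
    then show ?thesis by (simp only: s_simps) (simp add: add_divide_distrib add.commute)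
  qed
  ultimately show ?thesis by simp
qed

text \<open>The direct arguments contribute \<open>(1 - s) d = d / (n + 1)\<close>. The means of the
  tuples without \<open>i\<close> and without \<open>j\<close> have distance at most
  \<open>d / n\<close>, because up to order one tuple arises from the other by changing a single
  entry; with weight \<open>s\<close> this is again \<open>d / (n + 1)\<close>.\<close>

lemma step_diameter:
  assumes A: "posdefs A" and ij: "i \<in> {1..Suc n}" "j \<in> {1..Suc n}"
    and d: "d \<ge> 0" "\<And>i j. \<lbrakk>i \<in> {1..Suc n}; j \<in> {1..Suc n}\<rbrakk> \<Longrightarrow> thompson d (A i) (A j)"
  shows "thompson (2 / (n + 1) * d) (step A i) (step A j)"
proof (cases "i = j")
  case True
  then show ?thesis
    using d(1) thompson_mono[OF thompson_refl _ posdef_step(3)[OF A ij(1)] posdef_step(3)[OF A ij(1)]] by simp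
next
  case False
  define B where "B = A(j := A i)"
  have B: "posdefs B" using A ij by (auto simp: B_def posdefs_def)
  \<comment> \<open>Replacing \<open>A j\<close> by \<open>A i\<close> makes the two tuples with one entry omitted equal up to order.\<close>
  have "add_mset (B i) (image_mset (omit i B) (mset_set {1..n}))
      = add_mset (B j) (image_mset (omit j B) (mset_set {1..n}))"
    using mset_omit[OF ij(1), of B] mset_omit[OF ij(2), of B] by simp
  then have "image_mset (omit i B) (mset_set {1..n}) = image_mset (omit j B) (mset_set {1..n})"
    using False by (simp add: B_def)
  also have "\<dots> = image_mset (omit j A) (mset_set {1..n})"
    by (intro image_mset_cong) (auto simp: B_def omit_def)
  finally have eq: "M (omit i B) = M (omit j A)"
    using posdefs_omit[OF B ij(1)] by (intro M_mset)
  have "thompson ((\<Sum>k\<in>{1..Suc n} - {i}. if k = j then d else 0) / n) (M (omit i A)) (M (omit i B))"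
    by (rule thompson_M_omit[OF A B ij(1)]) (use d ij in \<open>auto simp: B_def\<close>)
  then have "thompson (d / n) (M (omit i A)) (M (omit j A))"
    using False ij eq by (simp add: sum.delta)
  then have "thompson ((1 - s) * d + s * (d / n)) (step A i) (step A j)"
    unfolding step_def
    by (intro thompson_wgm posdef_step[OF A ij(1)] posdef_step[OF A ij(2)] s01 d(2) ij)
  moreover have "(1 - s) * d + s * (d / n) = 2 / (n + 1) * d"
    by (simp only: s_simps) simp
  ultimately show ?thesis by simp
qed

text \<open>By idempotence \<open>A i\<close> is its own mean, so the other mean is compared with
  that of the constant tuple \<open>A i\<close>. This bounds the movement in one step by the
  diameter.\<close>

lemma step_near:
  assumes A: "posdefs A" and i: "i \<in> {1..Suc n}"
    and d: "d \<ge> 0" "\<And>i j. \<lbrakk>i \<in> {1..Suc n}; j \<in> {1..Suc n}\<rbrakk> \<Longrightarrow> thompson d (A i) (A j)"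
  shows "thompson d (A i) (step A i)"
proof -
  note Ai = posdef_step(1)[OF A i]
  have "M (omit i (\<lambda>_. A i)) = A i" by (rule M_idem[OF Ai]) (simp add: omit_def)
  moreover have "thompson ((\<Sum>k\<in>{1..Suc n} - {i}. d) / n) (M (omit i (\<lambda>_. A i))) (M (omit i A))"
    by (rule thompson_M_omit[OF _ A i]) (use Ai i d(2) in \<open>auto simp: posdefs_def\<close>)
  moreover have "(\<Sum>k\<in>{1..Suc n} - {i}. d) / n = d" using i n by simp
  ultimately have "thompson d (A i) (M (omit i A))" by simp
  then have "thompson ((1 - s) * 0 + s * d) (wgm s (A i) (A i)) (step A i)"
    unfolding step_def
    by (rule thompson_wgm[OF Ai Ai Ai posdef_step(2)[OF A i] s01 thompson_refl])
  then have "thompson (s * d) (A i) (step A i)" using wgm_self[OF Ai] by simp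
  moreover have "s * d \<le> d" using s01 d(1) by (simp add: mult_left_le_one_le)
  ultimately show ?thesis by (rule thompson_mono[OF _ _ Ai posdef_step(3)[OF A i]])
qed

section \<open>Convergence of the iterates\<close>

abbreviation iter :: "(nat \<Rightarrow> bop) \<Rightarrow> nat \<Rightarrow> nat \<Rightarrow> bop"
  where "iter \<equiv> mean_iter s M"

lemma iter_Suc: "iter A (Suc k) = step (iter A k)"
  by (simp add: step_def fun_eq_iff)

lemma posdefs_iter: "posdefs A \<Longrightarrow> posdefs (iter A k)"
  by (induction k) (simp_all add: iter_Suc posdefs_step del: mean_iter.simps(2))

lemma iter_posdef: "posdefs A \<Longrightarrow> i \<in> {1..Suc n} \<Longrightarrow> posdef (iter A k i)"
  using posdefs_iter[of A k] by (simp add: posdefs_def)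

lemma diameter_exists:
  assumes A: "posdefs A"
  obtains d where "d \<ge> 0" "\<And>i j. \<lbrakk>i \<in> {1..Suc n}; j \<in> {1..Suc n}\<rbrakk> \<Longrightarrow> thompson d (A i) (A j)"
proof -
  have "\<exists>r. r \<ge> 0 \<and> thompson r (A i) (A j)" if "i \<in> {1..Suc n}" "j \<in> {1..Suc n}" for i j
    by (rule thompson_exists[OF posdef_step(1)[OF A that(1)] posdef_step(1)[OF A that(2)]]) (intro exI conjI)
  then obtain r where r: "\<And>i j. \<lbrakk>i \<in> {1..Suc n}; j \<in> {1..Suc n}\<rbrakk> \<Longrightarrow> r i j \<ge> 0 \<and> thompson (r i j) (A i) (A j)"
    by metis
  \<comment> \<open>The sum of the nonnegative radii dominates each of them.\<close>
  define d where "d = (\<Sum>(i, j)\<in>{1..Suc n} \<times> {1..Suc n}. r i j)"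
  have d: "r i j \<le> d" if "i \<in> {1..Suc n}" "j \<in> {1..Suc n}" for i j
    unfolding d_def using r that
      member_le_sum[of "(i, j)" "{1..Suc n} \<times> {1..Suc n}" "\<lambda>(i, j). r i j"] by auto
  show thesis
  proof (rule that[of d])
    show "d \<ge> 0" unfolding d_def using r by (intro sum_nonneg) auto
    show "thompson d (A i) (A j)" if "i \<in> {1..Suc n}" "j \<in> {1..Suc n}" for i j
      using r[OF that] d[OF that] posdef_step(1)[OF A that(1)] posdef_step(1)[OF A that(2)]
      by (elim conjE, rule_tac thompson_mono)
  qed
qed

text \<open>The contraction factor from \<open>step_diameter\<close>, below 1 because
  \<open>n \<ge> 2\<close>.\<close>

definition q :: real where "q = 2 / (n + 1)"

lemma q01: "0 \<le> q" "q < 1"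
  using n by (simp_all add: q_def)

lemma iter_diameter:
  assumes A: "posdefs A" and ij: "i \<in> {1..Suc n}" "j \<in> {1..Suc n}"
    and d: "d \<ge> 0" "\<And>i j. \<lbrakk>i \<in> {1..Suc n}; j \<in> {1..Suc n}\<rbrakk> \<Longrightarrow> thompson d (A i) (A j)"
  shows "thompson (q ^ k * d) (iter A k i) (iter A k j)"
  using ij
proof (induction k arbitrary: i j)
  case 0
  then show ?case using d by simp
next
  case (Suc k)
  have "thompson (2 / (n + 1) * (q ^ k * d)) (step (iter A k) i) (step (iter A k) j)"
    by (rule step_diameter[OF posdefs_iter[OF A] Suc.prems _ Suc.IH]) (use d(1) q01 in simp_all)
  then show ?case by (simp add: iter_Suc q_def mult.assoc del: mean_iter.simps(2))
qed

text \<open>One step moves an entry by at most the current diameter, and diameters decay like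
  \<open>q^k\<close>; the partial sums of the geometric series appear as
  \<open>(1 - q^m) / (1 - q)\<close>.\<close>

lemma iter_distance:
  assumes A: "posdefs A" and i: "i \<in> {1..Suc n}"
    and d: "d \<ge> 0" "\<And>i j. \<lbrakk>i \<in> {1..Suc n}; j \<in> {1..Suc n}\<rbrakk> \<Longrightarrow> thompson d (A i) (A j)"
  shows "thompson (q ^ k * d / (1 - q)) (iter A k i) (iter A (k + m) i)"
proof -
  have "thompson (q ^ k * d * (1 - q ^ m) / (1 - q)) (iter A k i) (iter A (k + m) i)"
  proof (induction m)
    case 0
    then show ?case by simp
  next
    case (Suc m)
    have "thompson (q ^ (k + m) * d) (iter A (k + m) i) (step (iter A (k + m)) i)"
      by (rule step_near[OF posdefs_iter[OF A] i _ iter_diameter[OF A _ _ d]]) (use d(1) q01 in simp_all)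
    from thompson_trans[OF Suc this]
    have "thompson (q ^ k * d * (1 - q ^ m) / (1 - q) + q ^ (k + m) * d) (iter A k i) (iter A (k + Suc m) i)"
      by (simp only: iter_Suc add_Suc_right)
    moreover have "q ^ k * d * (1 - q ^ m) / (1 - q) + q ^ (k + m) * d = q ^ k * d * (1 - q ^ Suc m) / (1 - q)"
    proof -
      have "q ^ (k + m) * d = q ^ k * d * (q ^ m * (1 - q)) / (1 - q)"
        using q01 by (simp add: power_add)
      then show ?thesis by (simp add: add_divide_distrib[symmetric] algebra_simps)
    qed
    ultimately show ?case by simp
  qed
  moreover have "q ^ k * d * (1 - q ^ m) / (1 - q) \<le> q ^ k * d / (1 - q)"
    using q01 d(1) by (intro divide_right_mono mult_left_le) auto
  ultimately show ?thesis by (rule thompson_mono[OF _ _ iter_posdef[OF A i] iter_posdef[OF A i]])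
qed

lemma iter_converges:
  assumes A: "posdefs A"
  obtains L where "posdef L" "\<And>i. i \<in> {1..Suc n} \<Longrightarrow> (\<lambda>k. iter A k i) \<longlonglongrightarrow> L"
proof -
  obtain d where d: "d \<ge> 0" "\<And>i j. \<lbrakk>i \<in> {1..Suc n}; j \<in> {1..Suc n}\<rbrakk> \<Longrightarrow> thompson d (A i) (A j)"
    using diameter_exists[OF A] by blast
  define D where "D k = q ^ k * d / (1 - q)" for k
  have D0: "D k \<ge> 0" for k using d(1) q01 by (simp add: D_def)
  have D: "thompson (D k) (iter A k i) (iter A (k + m) i)" if "i \<in> {1..Suc n}" for k m i
    unfolding D_def by (rule iter_distance[OF A that d])
  \<comment> \<open>A uniform bound for all iterates, which stay at Thompson distance at most
    \<open>D 0\<close> from \<open>A i\<close>. It is what \<open>norm_diff_le_thompson\<close>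
    needs to yield a Cauchy sequence in norm.\<close>
  define N where "N = exp (D 0) * (\<Sum>i\<in>{1..Suc n}. norm (A i))"
  have N0: "N \<ge> 0" by (simp add: N_def sum_nonneg)
  have N: "norm (iter A k i) \<le> N" if i: "i \<in> {1..Suc n}" for k i
  proof -
    have "iter A k i \<preceq> exp (D 0) *\<^sub>R A i" using D[OF i, of 0 k] by (simp add: thompson_def)
    then have "norm (iter A k i) \<le> exp (D 0) * norm (A i)"
      by (intro norm_le_of_loewner iter_posdef A i) auto
    also have "\<dots> \<le> N" unfolding N_def using i by (intro mult_left_mono member_le_sum) auto
    finally show ?thesis .
  qed
  have "(\<lambda>k. (exp (q ^ k * c) - 1) * N) \<longlonglongrightarrow> (exp (0 * c) - 1) * N" for c
    using q01 by (intro tendsto_intros LIMSEQ_realpow_zero) auto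
  then have small: "(\<lambda>k. (exp (q ^ k * c) - 1) * N) \<longlonglongrightarrow> 0" for c by simp
  have close: "norm (X - Y) \<le> (exp r - 1) * N"
    if "posdef X" "posdef Y" "thompson r X Y" "r \<ge> 0" "norm X \<le> N" "norm Y \<le> N" for X Y r
  proof -
    have "norm (X - Y) \<le> (exp r - 1) * max (norm X) (norm Y)"
      using that by (intro norm_diff_le_thompson)
    also have "\<dots> \<le> (exp r - 1) * N" using that by (intro mult_left_mono) auto
    finally show ?thesis .
  qed
  have "Cauchy (\<lambda>k. iter A k i)" if i: "i \<in> {1..Suc n}" for i
  proof (rule CauchyI')
    fix e :: real assume "0 < e"
    then have "\<exists>k0. \<forall>k\<ge>k0. (exp (q ^ k * (d / (1 - q))) - 1) * N < e"
      using order_tendstoD(2)[OF small[of "d / (1 - q)"], of e] by (simp add: eventually_sequentially)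
    then obtain k0 where k0: "\<And>k. k \<ge> k0 \<Longrightarrow> (exp (q ^ k * (d / (1 - q))) - 1) * N < e" by blast
    have "dist (iter A k i) (iter A m i) < e" if "k \<ge> k0" "k < m" for k m
    proof -
      have "norm (iter A k i - iter A (k + (m - k)) i) \<le> (exp (D k) - 1) * N"
        by (rule close[OF iter_posdef[OF A i] iter_posdef[OF A i] D[OF i] D0 N[OF i] N[OF i]])
      then show ?thesis using k0[OF that(1)] that(2) by (simp add: dist_norm D_def)
    qed
    then show "\<exists>k0. \<forall>k\<ge>k0. \<forall>m>k. dist (iter A k i) (iter A m i) < e" by blast
  qed
  then have "\<exists>L. (\<lambda>k. iter A k i) \<longlonglongrightarrow> L" if "i \<in> {1..Suc n}" for i
    using that Cauchy_convergent_iff convergent_def by blast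
  then obtain L where L: "\<And>i. i \<in> {1..Suc n} \<Longrightarrow> (\<lambda>k. iter A k i) \<longlonglongrightarrow> L i" by metis
  have 1: "1 \<in> {1..Suc n}" by simp
  have "(\<lambda>k. iter A k i) \<longlonglongrightarrow> L 1" if i: "i \<in> {1..Suc n}" for i
  proof -
    have "(\<lambda>k. iter A k i - iter A k 1) \<longlonglongrightarrow> 0"
    proof (rule Lim_null_comparison[OF always_eventually small[of d]], intro allI)
      fix k
      show "norm (iter A k i - iter A k 1) \<le> (exp (q ^ k * d) - 1) * N"
        using d(1) q01
        by (intro close iter_posdef A i 1 iter_diameter[OF A i 1 d] N mult_nonneg_nonneg) auto
    qed
    from tendsto_add[OF this L[OF 1]] show ?thesis by simp
  qed
  moreover have "posdef (L 1)"
  proof -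
    have sa: "selfadjoint (L 1)"
      using L[OF 1] by (rule selfadjoint_limit) (intro posdef_selfadjoint iter_posdef A 1)
    \<comment> \<open>A norm limit could lose the strict lower bound; the finite Thompson distance
      to \<open>A 1\<close> preserves it up to the factor \<open>exp (- D 0)\<close>.\<close>
    have "thompson (D 0) (A 1) (L 1)"
      by (rule thompson_limit[OF tendsto_const L[OF 1]]) (use D[OF 1, of 0] in simp)
    then have "A 1 \<preceq> exp (D 0) *\<^sub>R L 1" by (simp add: thompson_def)
    moreover obtain \<gamma> where g: "\<gamma> > 0" "\<gamma> *\<^sub>R 1 \<preceq> A 1" 
      using posdef_step(1)[OF A 1] unfolding posdef_iff by blast
    ultimately have "\<gamma> *\<^sub>R 1 \<preceq> exp (D 0) *\<^sub>R L 1" by (metis loewner_trans)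
    from loewner_scaleR[OF this, of "exp (- D 0)"]
    have "(exp (- D 0) * \<gamma>) *\<^sub>R 1 \<preceq> L 1" by (simp add: exp_minus)
    then show ?thesis using sa g(1) unfolding posdef_iff by (intro conjI exI[of _ "exp (- D 0) * \<gamma>"]) auto
  qed
  ultimately show thesis using that by blast
qed

section \<open>The common limit as a mean of \<open>n + 1\<close> operators\<close>

definition G :: "(nat \<Rightarrow> bop) \<Rightarrow> bop"
  where "G A = common_limit (Suc n) (iter A)"

lemma G_eqI:
  assumes "\<And>i. i \<in> {1..Suc n} \<Longrightarrow> (\<lambda>k. iter A k i) \<longlonglongrightarrow> L"
  shows "G A = L"
  unfolding G_def common_limit_def
proof (rule the_equality)
  show "\<forall>i\<in>{1..Suc n}. (\<lambda>k. iter A k i) \<longlonglongrightarrow> L" using assms by blast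
  fix K assume "\<forall>i\<in>{1..Suc n}. (\<lambda>k. iter A k i) \<longlonglongrightarrow> K"
  then have "(\<lambda>k. iter A k 1) \<longlonglongrightarrow> K" by simp
  with assms[of 1] show "K = L" by (auto intro: LIMSEQ_unique)
qed

lemma G_limit:
  assumes "posdefs A"
  shows "posdef (G A)" "i \<in> {1..Suc n} \<Longrightarrow> (\<lambda>k. iter A k i) \<longlonglongrightarrow> G A"
proof -
  obtain L where L: "posdef L" "\<And>i. i \<in> {1..Suc n} \<Longrightarrow> (\<lambda>k. iter A k i) \<longlonglongrightarrow> L"
    using iter_converges[OF assms] by blast
  have "G A = L" using L(2) by (rule G_eqI)
  then show "posdef (G A)" "i \<in> {1..Suc n} \<Longrightarrow> (\<lambda>k. iter A k i) \<longlonglongrightarrow> G A" using L by auto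
qed

text \<open>The permutation is carried along the iteration: the full tuples have the same multiset
  and corresponding entries are equal, so the tuples with these entries removed have equal multisets
  and hence equal means.\<close>

lemma iter_permute:
  assumes A: "posdefs A" and p: "p permutes {1..Suc n}"
    and AB: "\<And>i. i \<in> {1..Suc n} \<Longrightarrow> A i = B (p i)" and i: "i \<in> {1..Suc n}"
  shows "iter A k i = iter B k (p i)"
  using i
proof (induction k arbitrary: i)
  case 0
  then show ?case using AB by simp
next
  case (Suc k)
  have pi: "p i \<in> {1..Suc n}" using p Suc.prems by (simp only: permutes_in_image)
  have "image_mset (iter A k) (mset_set {1..Suc n}) = image_mset (iter B k \<circ> p) (mset_set {1..Suc n})"
    using Suc.IH by (intro image_mset_cong) simp
  also have "\<dots> = image_mset (iter B k) (mset_set {1..Suc n})"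
    using permutes_image_mset[OF p] by (simp add: multiset.map_comp[symmetric] permutes_image_mset)
  finally have "add_mset (iter A k i) (image_mset (omit i (iter A k)) (mset_set {1..n}))
      = add_mset (iter B k (p i)) (image_mset (omit (p i) (iter B k)) (mset_set {1..n}))"
    unfolding mset_omit[OF Suc.prems] mset_omit[OF pi] .
  then have "image_mset (omit i (iter A k)) (mset_set {1..n}) = image_mset (omit (p i) (iter B k)) (mset_set {1..n})"
    using Suc.IH[OF Suc.prems] by simp
  then have "M (omit i (iter A k)) = M (omit (p i) (iter B k))"
    by (intro M_mset posdefs_omit[OF posdefs_iter[OF A] Suc.prems])
  then show ?case using Suc.IH[OF Suc.prems] by simp
qed

lemma step_symbol:
  assumes A: "posdefs A" and a: "\<And>j. j \<in> {1..Suc n} \<Longrightarrow> pos_symbol (a j) (A j)" and i: "i \<in> {1..Suc n}"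
  shows "pos_symbol (\<lambda>t. (\<Prod>j=1..Suc n. a j t) powr (1 / (n + 1))) (step A i)"
proof -
  have "pos_symbol (\<lambda>t. (\<Prod>j=1..n. omit i a j t) powr (1 / n)) (M (omit i A))"
  proof (rule M_symbol)
    fix j assume j: "j \<in> {1..n}"
    show "posdef (omit i A j)" by (rule posdefs_omit[OF A i j])
    have "skip i j \<in> {1..Suc n} - {i}" by (rule skip_mem[OF j i])
    then show "pos_symbol (omit i a j) (omit i A j)" using a by (simp add: omit_eq_comp_skip)
  qed
  then have "pos_symbol (\<lambda>t. a i t powr (1 - s) * ((\<Prod>j=1..n. omit i a j t) powr (1 / n)) powr s) (step A i)"
    unfolding step_def using A i
    by (intro pos_symbol_wgm a posdef_step) auto
  then show ?thesis
  proof (rule pos_symbol_cong)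
    fix t assume t: "t \<in> {0..2*pi}"
    have pos: "a j t > 0" if "j \<in> {1..Suc n}" for j using a[OF that] t by (simp add: pos_symbol_def)
    let ?P = "\<Prod>j\<in>{1..Suc n} - {i}. a j t"
    have "(\<Prod>j=1..n. omit i a j t) = ?P"
      using prod.reindex_bij_betw[OF skip_bij[OF i], of "\<lambda>j. a j t"] by (simp add: omit_eq_comp_skip)
    moreover have "1 / real n * s = 1 / (real n + 1)" "1 - s = 1 / (real n + 1)"
      using n by (simp_all add: s_def field_simps)
    moreover have "(\<Prod>j=1..Suc n. a j t) = a i t * ?P" by (rule prod.remove) (use i in auto)
    moreover have "?P \<ge> 0" using pos by (intro prod_nonneg) (auto intro: less_imp_le)
    ultimately show "a i t powr (1 - s) * ((\<Prod>j=1..n. omit i a j t) powr (1 / n)) powr s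
        = (\<Prod>j=1..Suc n. a j t) powr (1 / (n + 1))"
      using pos[OF i] by (simp add: powr_powr powr_mult add.commute)
  qed
qed

lemma iter_symbol:
  assumes A: "posdefs A" and a: "\<And>j. j \<in> {1..Suc n} \<Longrightarrow> pos_symbol (a j) (A j)" and i: "i \<in> {1..Suc n}"
  shows "pos_symbol (\<lambda>t. (\<Prod>j=1..Suc n. a j t) powr (1 / (n + 1))) (iter A (Suc k) i)"
  using i
proof (induction k arbitrary: i)
  case 0
  then show ?case using step_symbol[OF A a] by (simp add: iter_Suc del: mean_iter.simps(2))
next
  case (Suc k)
  let ?g = "\<lambda>t. (\<Prod>j=1..Suc n. a j t) powr (1 / (n + 1))"
  have "pos_symbol (\<lambda>t. (\<Prod>j=1..Suc n. ?g t) powr (1 / (n + 1))) (step (iter A (Suc k)) i)"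
    by (rule step_symbol[OF posdefs_iter[OF A] Suc.IH Suc.prems])
  then have "pos_symbol ?g (step (iter A (Suc k)) i)"
  proof (rule pos_symbol_cong)
    fix t assume t: "t \<in> {0..2*pi}"
    have "a j t > 0" if "j \<in> {1..Suc n}" for j using a[OF that] t by (simp add: pos_symbol_def)
    then have "(\<Prod>j=1..Suc n. a j t) > 0" by (intro prod_pos) auto
    then have "?g t > 0" by (simp only: powr_gt_zero)
    moreover have "(\<Prod>j=1..Suc n. x) powr (1 / (n + 1)) = x" if "x > 0" for x :: real
    proof -
      have "(\<Prod>j=1..Suc n. x) = x powr real (Suc n)"
        using that by (simp add: powr_realpow del: power_Suc of_nat_Suc)
      moreover have "real (Suc n) * (1 / (n + 1)) = 1" by simp
      ultimately show ?thesis using that by (simp only: powr_powr powr_one)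
    qed
    ultimately show "(\<Prod>j=1..Suc n. ?g t) powr (1 / (n + 1)) = ?g t" by blast
  qed
  then show ?case by (simp only: iter_Suc)
qed

lemma G_symbol:
  assumes A: "posdefs A" and a: "\<And>j. j \<in> {1..Suc n} \<Longrightarrow> pos_symbol (a j) (A j)"
  shows "pos_symbol (\<lambda>t. (\<Prod>j=1..Suc n. a j t) powr (1 / (n + 1))) (G A)"
proof -
  let ?g = "\<lambda>t. (\<Prod>j=1..Suc n. a j t) powr (1 / (n + 1))"
  have it: "pos_symbol ?g (iter A (Suc k) 1)" for k using iter_symbol[OF A a] by simp
  then have "has_symbol (\<lambda>t. of_real (?g t)) (iter A (Suc k) 1)" for k by (simp add: pos_symbol_def)
  then have "has_symbol (\<lambda>t. of_real (?g t)) (G A)"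
    \<comment> \<open>The sequence is shifted by one, since the starting operators still have their
      individual symbols.\<close>
    by (rule has_symbol_limit[OF _ _ uniform_limit_const LIMSEQ_Suc[OF G_limit(2)[OF A, of 1]]])
      (use it in \<open>simp_all add: pos_symbol_def has_symbol_def\<close>)
  then show ?thesis using it[of 0] by (simp add: pos_symbol_def)
qed

lemma good_mean_G: "good_mean (Suc n) G"
  unfolding good_mean_def posdefs_def[symmetric]
proof (intro conjI allI impI)
  show "posdef (G A)" if "posdefs A" for A by (rule G_limit(1)[OF that])
next
  fix A B
  assume A: "posdefs A" and eq: "image_mset A (mset_set {1..Suc n}) = image_mset B (mset_set {1..Suc n})"
  then have B: "posdefs B" using mset_eq_posdef[OF eq] by (simp add: posdefs_def)
  obtain p where p: "p permutes {1..Suc n}" "\<forall>i\<in>{1..Suc n}. A i = B (p i)"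
    by (rule image_mset_eq_implies_permutes[OF finite_atLeastAtMost eq])
  show "G A = G B"
  proof (rule G_eqI)
    fix i assume i: "i \<in> {1..Suc n}"
    have "p i \<in> {1..Suc n}" using p(1) i by (simp only: permutes_in_image)
    from G_limit(2)[OF B this] show "(\<lambda>k. iter A k i) \<longlonglongrightarrow> G B"
      using iter_permute[OF A p(1) _ i] p(2) by simp
  qed
next
  fix A B :: "nat \<Rightarrow> bop" and r :: "nat \<Rightarrow> real"
  assume *: "\<forall>i\<in>{1..Suc n}. posdef (A i) \<and> posdef (B i) \<and> thompson (r i) (A i) (B i)"
  then have A: "posdefs A" and B: "posdefs B" and r: "\<And>i. i \<in> {1..Suc n} \<Longrightarrow> thompson (r i) (A i) (B i)"
    by (auto simp: posdefs_def)
  define \<rho> where "\<rho> = (\<Sum>i=1..Suc n. r i) / real (Suc n)"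
  \<comment> \<open>The first step averages the individual distances to \<open>\<rho>\<close> for
    every \<open>i\<close>; averaging equal bounds changes nothing afterwards.\<close>
  have "thompson \<rho> (iter A (Suc k) i) (iter B (Suc k) i)" if "i \<in> {1..Suc n}" for k i
    using that
  proof (induction k arbitrary: i)
    case 0
    from step_thompson[OF A B 0 r] show ?case
      by (simp add: iter_Suc \<rho>_def add.commute del: mean_iter.simps(2))
  next
    case (Suc k)
    have "thompson ((\<Sum>j=1..Suc n. \<rho>) / (n + 1)) (step (iter A (Suc k)) i) (step (iter B (Suc k)) i)"
      by (rule step_thompson[OF posdefs_iter[OF A] posdefs_iter[OF B] Suc.prems Suc.IH])
    moreover have "(\<Sum>j=1..Suc n. \<rho>) / (n + 1) = \<rho>" by simp
    ultimately show ?case by (simp only: iter_Suc)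
  qed
  then have "thompson \<rho> (iter A (Suc k) 1) (iter B (Suc k) 1)" for k by simp
  then have "thompson \<rho> (G A) (G B)"
    by (rule thompson_limit[OF LIMSEQ_Suc[OF G_limit(2)[OF A]] LIMSEQ_Suc[OF G_limit(2)[OF B]], rotated 2]) auto
  then show "thompson ((\<Sum>i=1..Suc n. r i) / real (Suc n)) (G A) (G B)" by (simp add: \<rho>_def)
next
  fix A X assume X: "posdef X" "\<forall>i\<in>{1..Suc n}. A i = X"
  have "iter A k i = X" if "i \<in> {1..Suc n}" for k i
    using that
  proof (induction k arbitrary: i)
    case (Suc k)
    have "M (omit i (iter A k)) = X"
      using Suc by (intro M_idem X(1)) (auto simp: omit_def)
    then show ?case using Suc wgm_self[OF X(1)] by simp
  qed (use X(2) in simp)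
  then show "G A = X" by (intro G_eqI) simp
next
  fix A and a :: "nat \<Rightarrow> real \<Rightarrow> real"
  assume "\<forall>i\<in>{1..Suc n}. posdef (A i) \<and> pos_symbol (a i) (A i)"
  then have "pos_symbol (\<lambda>t. (\<Prod>j=1..Suc n. a j t) powr (1 / (n + 1))) (G A)"
    by (intro G_symbol) (auto simp: posdefs_def)
  then show "pos_symbol (\<lambda>t. (\<Prod>j=1..Suc n. a j t) powr (1 / real (Suc n))) (G A)"
    by (simp add: add.commute)
qed

end

text \<open>The weight \<open>(p - j) / (p - j + 1)\<close> depends on \<open>p - j\<close> only, so
  dropping the first weight of \<open>Suc n\<close> leaves the list for \<open>n\<close>. This makes
  the recursion in \<open>gmean\<close> a recursion between NBMP means.\<close>

lemma nbmp_weights_Suc: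
  assumes "n \<ge> 1"
  shows "nbmp_weights (Suc n) = real n / (real n + 1) # nbmp_weights n"
proof -
  have "[1..<Suc n] = 1 # map Suc [1..<n]"
    using assms by (simp add: upt_conv_Cons map_Suc_upt del: upt_Suc)
  then show ?thesis by (simp add: nbmp_weights_def o_def add.commute)
qed

lemma length_nbmp_weights: "length (nbmp_weights n) = n - 1"
  by (simp add: nbmp_weights_def)

lemma nbmp_mean_2: "nbmp_mean 2 A = wgm (1/2) (A 1) (A 2)"
  by (simp add: nbmp_mean_def nbmp_weights_def upt_rec)

lemma nbmp_Suc:
  assumes "n \<ge> 2"
  shows "nbmp_iter (Suc n) = mean_iter (real n / (real n + 1)) (nbmp_mean n)"
    and "nbmp_mean (Suc n) A = common_limit (Suc n) (mean_iter (real n / (real n + 1)) (nbmp_mean n) A)"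
proof -
  show "nbmp_iter (Suc n) = mean_iter (real n / (real n + 1)) (nbmp_mean n)"
    using assms by (simp add: nbmp_iter_def nbmp_mean_def nbmp_weights_Suc)
  obtain w ws where w: "nbmp_weights n = w # ws"
    using assms length_nbmp_weights[of n] by (cases "nbmp_weights n") auto
  \<comment> \<open>\<open>w # ws\<close> holds \<open>n - 1\<close> weights, so \<open>ws\<close>
    has length \<open>n - 2\<close>; this matches the number of operators in the third equation of
    \<open>gmean\<close>.\<close>
  have len: "length ws + 3 = Suc n" using assms length_nbmp_weights[of n] w by simp
  have "nbmp_mean n = gmean (w # ws)" by (simp add: nbmp_mean_def w)
  then show "nbmp_mean (Suc n) A = common_limit (Suc n) (mean_iter (real n / (real n + 1)) (nbmp_mean n) A)"
    using assms by (simp only: nbmp_mean_def[of "Suc n"] nbmp_weights_Suc w gmean.simps len)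
qed

lemma good_mean_nbmp: "n \<ge> 2 \<Longrightarrow> good_mean n (nbmp_mean n)"
proof (induction n rule: dec_induct)
  case base
  show ?case using good_mean_2 by (simp add: nbmp_mean_2[abs_def])
next
  case (step n)
  then interpret mean_step n "nbmp_mean n" "real n / (real n + 1)" by unfold_locales auto
  have "nbmp_mean (Suc n) = G" using step.hyps by (intro ext) (simp add: nbmp_Suc G_def)
  then show ?case using good_mean_G by simp
qed

theorem theorem19:
  fixes p :: nat and a :: "nat \<Rightarrow> real \<Rightarrow> complex" and A E :: "nat \<Rightarrow> bop"
    and g :: "real \<Rightarrow> complex"
  assumes "p \<ge> 3"
    and "\<And>i. i \<in> {1..p} \<Longrightarrow> a i \<in> C_2pi"
    and "\<And>i. i \<in> {1..p} \<Longrightarrow> compact_op (E i)"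
    and "\<And>i. i \<in> {1..p} \<Longrightarrow> A i = toeplitz (a i) + E i"
    and "\<And>i. i \<in> {1..p} \<Longrightarrow> posdef (A i)"
  defines "g \<equiv> \<lambda>t. (\<Prod>i=1..p. a i t) powr (1 / of_nat p)"
  shows "g \<in> C_2pi \<and>
    (\<exists>K KG.
      (\<forall>i\<in>{1..p}. \<forall>k\<ge>1. compact_op (K k i) \<and>
        nbmp_iter p A k i = toeplitz g + K k i \<and> nbmp_iter p A k i \<in> QT) \<and>
      compact_op KG \<and> nbmp_mean p A = toeplitz g + KG \<and> nbmp_mean p A \<in> QT \<and>
      (\<forall>i\<in>{1..p}. (\<lambda>k. norm (K k i - KG)) \<longlonglongrightarrow> 0))"
proof -
  define n where "n = p - 1"
  have p: "p = Suc n" "n \<ge> 2" using assms(1) by (auto simp: n_def)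
  interpret mean_step n "nbmp_mean n" "real n / (real n + 1)"
    by unfold_locales (use p good_mean_nbmp in auto)
  have iter: "nbmp_iter p A = iter A" by (simp add: p nbmp_Suc)
  have mean: "nbmp_mean p A = G A" using p(2) by (simp add: p(1) nbmp_Suc G_def)
  have A: "posdefs A" using assms(5) by (simp add: posdefs_def p)
  have sym: "has_symbol (a i) (A i)" if "i \<in> {1..p}" for i
    using assms(2-4) that by (simp add: has_symbol_def)
  have re: "pos_symbol (\<lambda>t. Re (a i t)) (A i)" if "i \<in> {1..p}" for i
    by (rule pos_symbol_of_posdef(1)[OF assms(5)[OF that] sym[OF that]])
  define h where "h t = (\<Prod>i=1..p. Re (a i t)) powr (1 / p)" for t
  \<comment> \<open>The complex power in \<open>g\<close> agrees with the real one because each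
    \<open>a i t\<close> is a positive real for \<open>t\<close> in \<open>{0..2*pi}\<close>;
    elsewhere the symbols are arbitrary.\<close>
  have gh: "of_real (h t) = g t" if t: "t \<in> {0..2*pi}" for t
  proof -
    have "(\<Prod>i=1..p. a i t) = of_real (\<Prod>i=1..p. Re (a i t))"
      unfolding of_real_prod
      by (intro prod.cong refl pos_symbol_of_posdef(2)[OF assms(5) sym t]) auto
    moreover have "(\<Prod>i=1..p. Re (a i t)) \<ge> 0"
      using re t by (intro prod_nonneg) (auto simp: pos_symbol_def intro: less_imp_le)
    ultimately show ?thesis
      using powr_of_real[of "\<Prod>i=1..p. Re (a i t)" "1 / p"] by (simp add: g_def h_def)
  qed
  have g: "has_symbol g B" if "pos_symbol (\<lambda>t. (\<Prod>j=1..Suc n. Re (a j t)) powr (1 / (n + 1))) B" for B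
  proof (rule has_symbol_cong)
    have "1 / (real n + 1) = 1 / real p" by (simp add: p)
    then show "has_symbol (\<lambda>t. of_real (h t)) B" using that by (simp add: pos_symbol_def h_def p(1) add.commute)
  qed (rule gh)
  have it: "has_symbol g (iter A k i)" if i: "i \<in> {1..p}" and k: "k \<ge> 1" for i k
  proof -
    obtain l where "k = Suc l" using k by (cases k) auto
    then show ?thesis using g iter_symbol[OF A, of "\<lambda>i t. Re (a i t)" i l] re i p(1) by simp
  qed
  have GA: "has_symbol g (G A)" using g G_symbol[OF A, of "\<lambda>i t. Re (a i t)"] re p(1) by simp
  have QT: "B \<in> QT" if "has_symbol g B" for B
    unfolding QT_def using that
    by (intro CollectI exI[of _ g] exI[of _ "B - toeplitz g"]) (simp add: has_symbol_def)
  show ?thesis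
  \<comment> \<open>The same formula serves for \<open>k = 0\<close>, where compactness is not
    claimed; the term \<open>toeplitz g\<close> cancels in \<open>K k i - KG\<close>, leaving the
    convergence of the iterates.\<close>
  proof (intro conjI exI[of _ "\<lambda>k i. iter A k i - toeplitz g"] exI[of _ "G A - toeplitz g"] ballI allI impI)
    show "g \<in> C_2pi" "compact_op (G A - toeplitz g)" using GA by (auto simp: has_symbol_def)
    show "nbmp_mean p A = toeplitz g + (G A - toeplitz g)" "nbmp_mean p A \<in> QT"
      using QT[OF GA] by (simp_all add: mean)
    fix i assume i: "i \<in> {1..p}"
    show "(\<lambda>k. norm (iter A k i - toeplitz g - (G A - toeplitz g))) \<longlonglongrightarrow> 0"
      using G_limit(2)[OF A, of i] i by (simp add: p(1) tendsto_norm_zero_iff LIM_zero_iff)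
    fix k :: nat assume "k \<ge> 1"
    then show "compact_op (iter A k i - toeplitz g)" "nbmp_iter p A k i = toeplitz g + (iter A k i - toeplitz g)"
      "nbmp_iter p A k i \<in> QT"
      using it[OF i] QT by (auto simp: has_symbol_def iter)
  qed
qed

end
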